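(* Let $u_h(t)\in U_h$, $\rho_h(t)\in F_h$, $p_h(t)\in Q_h$ be a solution of the semidiscrete scheme $$\sum_{e \in \mathcal{E}_h} \int_e \Big( \alpha_e(u_h) (n \times \llbracket \rho_h u_h \rrbracket ) \cdot \llbracket u_h \times v_h \rrbracket + \frac{\beta_e(u_h)}{2|u_h \cdot n|^2} (u_h \cdot n)(v_h \cdot n) \llbracket \overline{u_h \cdot u_h} \rrbracket \cdot \llbracket \rho_h\rrbracket \Big) ds + \langle \partial_t (\rho_h u_h), v_h \rangle + a_h(\rho_h u_h, u_h, v_h) - \frac{1}{2} b_h(v_h, \overline{u_h \cdot u_h}, \rho_h) - \langle p_h, \operatorname{div} v_h \rangle = 0 \quad \forall v_h \in U_h,$$ $$\langle \partial_t \rho_h, \sigma_h \rangle - b_h(u_h, \sigma_h, \rho_h) + \sum_{e \in \mathcal{E}_h} \int_e \beta_e(u_h) \llbracket \sigma_h \rrbracket \cdot \llbracket \rho_h \rrbracket \, ds = 0 \quad \forall \sigma_h \in F_h,$$ $$\langle \operatorname{div} u_h, q_h \rangle = 0 \quad \forall q_h \in Q_h,$$ where $\{\alpha_e\}_{e\in\mathcal{E}_h}$ and $\{\beta_e\}_{e\in\mathcal{E}_h}$ are nonnegative parameters which may depend on $u_h$. Then, for every $t$, $$\frac{d}{dt}\int_\Omega\rho_h\,dx=0,$$ $$\frac{d}{dt}\int_\Omega\rho_h^2\,dx\le 0,\ \text{ with equality if }\beta_e=0\ \text{ for all }e\in\mathcal{E}_h,$$ $$\frac{d}{dt}\int_\Omega\rho_h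 u_h\cdot u_h\,dx=0.$$
   Context: Let $n\in\{2,3\}$ be the dimension and $\Omega\subset\mathbb{R}^n$ a bounded domain with a triangulation $\mathcal{T}_h$ into simplices; $\mathcal{E}_h$ is the set of interior $(n-1)$-dimensional faces. (The symbol $n$ also denotes unit normal vectors.) $P_r(K)$ is the space of polynomials of degree at most $r$ on $K$. Let $H_0(\operatorname{div},\Omega)=\{u\in L^2(\Omega)^n \mid \operatorname{div}u\in L^2(\Omega),\ u\cdot n=0 \text{ on }\partial\Omega\}$. Fix integers $s,m\ge 0$ (not necessarily equal) and set: - $RT_s(\mathcal{T}_h)=\{u\in H_0(\operatorname{div},\Omega)\mid u|_K\in P_s(K)^n+xP_s(K)\ \forall K\in\mathcal{T}_h\}$; - $BDM_{s+1}(\mathcal{T}_h)=\{u\in H_0(\operatorname{div},\Omega)\mid u|_K\in P_{s+1}(K)^n\ \forall K\in\mathcal{T}_h\}$; - $DG_r(\mathcal{T}_h)=\{f\in L^2(\Omega)\mid f|_K\in P_r(K)\ \forall K\in\mathcal{T}_h\}$; - $U_h\in\{RT_s(\mathcal{T}_h),BDM_{s+1}(\mathcal{T}_h)\}$, $F_h=DG_m(\mathcal{T}_h)$, $Q_h=DG_s(\mathcal{T}_h)$. $W_h$ is the space of vector fields on $\Omega$ that are piecewise smooth with respect to $\mathcal{T}_h$. $\langle\cdot,\cdot\rangle$ is the $L^2(\Omega)$ inner product (of scalar or vector fields). $\overline{f}\in F_h$ denotes the $L^2$-orthogonal projection of $f\in L^2(\Omega)$ onto $F_h$. Jumps and averages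 on $e=K_1\cap K_2\in\mathcal{E}_h$: for scalar $f$ with $f_i=f|_{K_i}$, $\llbracket f\rrbracket=f_1n_1+f_2n_2$ and $\{f\}=\frac{f_1+f_2}{2}$, where $n_1$ is the unit normal to $e$ pointing from $K_1$ to $K_2$ and $n_2=-n_1$. For vector fields, fix a choice of unit normal $n$ for each $e$, determine $K_1,K_2$ so that $n$ points from $K_1$ to $K_2$, and set $\llbracket u\rrbracket=u_1-u_2$, $\{u\}=\frac{u_1+u_2}{2}$; thus $\llbracket u\times v\rrbracket=u_1\times v_1-u_2\times v_2$. In dimension 2, cross products are understood by embedding vectors in $\mathbb{R}^3$ with zero third component. The trilinear forms $a_h:W_h\times U_h\times U_h\to\mathbb{R}$ and $b_h:U_h\times F_h\times F_h\to\mathbb{R}$ are $$a_h(w,u,v)=\sum_{K\in\mathcal{T}_h}\int_K w\cdot(v\cdot\nabla u-u\cdot\nabla v)\,dx+\sum_{e\in\mathcal{E}_h}\int_e(n\times\{w\})\cdot\llbracket u\times v\rrbracket\,ds,$$ $$b_h(u,f,g)=\sum_{K\in\mathcal{T}_h}\int_K(u\cdot\nabla f)g\,dx-\sum_{e\in\mathcal{E}_h}\int_e u\cdot\llbracket f\rrbracket\{g\}\,ds.$$ *)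

theory Defs
  imports "HOL-Analysis.Analysis"
begin

text \<open>
  All function spaces consist of honest functions, not of classes modulo null sets. A field that is
  piecewise polynomial or smooth is pinned down on the interiors of the elements; its values on the
  mesh skeleton (a null set) are immaterial, and values on faces are always taken as one-sided
  limits from an adjacent element. Functions are total on the ambient space, but only their values
  in the domain matter.
\<close>


section \<open>Meshes\<close>

text \<open>The equation \<open>\<Omega> = interior (\<Union>Th)\<close> says that the closed domain is the union of the
  elements, and that the domain lies on one side of its boundary (no slits along faces).\<close>

definition domain_mesh :: "(real^'n) set \<Rightarrow> (real^'n) set set \<Rightarrow> bool" where
  "domain_mesh \<Omega> Th \<longleftrightarrow>
     triangulation Th \<and> (\<forall>K\<in>Th. int CARD('n) simplex K) \<and> \<Omega> = interior (\<Union>Th)"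

definition interior_faces :: "(real^'n) set set \<Rightarrow> (real^'n) set set" where
  "interior_faces Th =
     {K1 \<inter> K2 | K1 K2. K1 \<in> Th \<and> K2 \<in> Th \<and> K1 \<noteq> K2 \<and> aff_dim (K1 \<inter> K2) = int CARD('n) - 1}"

definition unit_normal :: "(real^'n) set \<Rightarrow> real^'n \<Rightarrow> bool" where
  "unit_normal e \<nu> \<longleftrightarrow> norm \<nu> = 1 \<and> (\<forall>x\<in>e. \<forall>y\<in>e. \<nu> \<bullet> (x - y) = 0)"

text \<open>The two elements sharing the face \<open>e\<close>, numbered such that the normal \<open>\<nu>\<close> points from the
  first to the second.\<close>

definition elem1 :: "(real^'n) set set \<Rightarrow> real^'n \<Rightarrow> (real^'n) set \<Rightarrow> (real^'n) set" where
  "elem1 Th \<nu> e = (THE K. K \<in> Th \<and> e face_of K \<and> (\<forall>x\<in>K. \<forall>y\<in>e. \<nu> \<bullet> x \<le> \<nu> \<bullet> y))"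

definition elem2 :: "(real^'n) set set \<Rightarrow> real^'n \<Rightarrow> (real^'n) set \<Rightarrow> (real^'n) set" where
  "elem2 Th \<nu> e = (THE K. K \<in> Th \<and> e face_of K \<and> (\<forall>x\<in>K. \<forall>y\<in>e. \<nu> \<bullet> y \<le> \<nu> \<bullet> x))"

text \<open>Surface measure of a flat face \<open>e\<close> of codimension one with unit normal \<open>\<nu>\<close>: Lebesgue measure
  on the prism of height one over \<open>e\<close>, projected orthogonally to the hyperplane of \<open>e\<close>. By Fubini
  this is the (complete) Lebesgue measure of that hyperplane restricted to \<open>e\<close>.\<close>

definition face_measure :: "real^'n \<Rightarrow> (real^'n) set \<Rightarrow> (real^'n) measure" where
  "face_measure \<nu> e =
     completion (distr (restrict_space lborel {y + r *\<^sub>R \<nu> | y r. y \<in> e \<and> 0 \<le> r \<and> r \<le> 1})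
                       borel (closest_point (affine hull e)))"


section \<open>Differential operators and function spaces\<close>

definition grad :: "(real^'n \<Rightarrow> real) \<Rightarrow> real^'n \<Rightarrow> real^'n" where
  "grad f x = (THE D. GDERIV f x :> D)"

text \<open>\<open>(v \<cdot> \<nabla>) u\<close>\<close>

definition advect :: "(real^'n \<Rightarrow> real^'n) \<Rightarrow> (real^'n \<Rightarrow> real^'n) \<Rightarrow> real^'n \<Rightarrow> real^'n" where
  "advect v u x = frechet_derivative u (at x) (v x)"

primrec Ck :: "nat \<Rightarrow> (real^'n \<Rightarrow> real) \<Rightarrow> bool" where
  "Ck 0 f \<longleftrightarrow> continuous_on UNIV f"
| "Ck (Suc k) f \<longleftrightarrow> (\<exists>G. (\<forall>x. GDERIV f x :> G x) \<and> (\<forall>i. Ck k (\<lambda>x. G x $ i)))"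

definition smooth :: "(real^'n \<Rightarrow> real) \<Rightarrow> bool" where
  "smooth f \<longleftrightarrow> (\<forall>k. Ck k f)"

definition test_function :: "(real^'n) set \<Rightarrow> (real^'n \<Rightarrow> real) \<Rightarrow> bool" where
  "test_function \<Omega> \<phi> \<longleftrightarrow>
     smooth \<phi> \<and> compact (closure {x. \<phi> x \<noteq> 0}) \<and> closure {x. \<phi> x \<noteq> 0} \<subseteq> \<Omega>"

definition L2 :: "(real^'n) set \<Rightarrow> (real^'n \<Rightarrow> 'b::euclidean_space) set" where
  "L2 \<Omega> = {f. f \<in> borel_measurable (lebesgue_on \<Omega>) \<and>
              integrable (lebesgue_on \<Omega>) (\<lambda>x. (norm (f x))\<^sup>2)}"

definition L2_inner ::
  "(real^'n) set \<Rightarrow> (real^'n \<Rightarrow> 'b::euclidean_space) \<Rightarrow> (real^'n \<Rightarrow> 'b) \<Rightarrow> real" where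
  "L2_inner \<Omega> f g = (LINT x|lebesgue_on \<Omega>. f x \<bullet> g x)"

definition weak_div :: "(real^'n) set \<Rightarrow> (real^'n \<Rightarrow> real^'n) \<Rightarrow> (real^'n \<Rightarrow> real) \<Rightarrow> bool" where
  "weak_div \<Omega> u d \<longleftrightarrow> d \<in> L2 \<Omega> \<and>
     (\<forall>\<phi>. test_function \<Omega> \<phi> \<longrightarrow> L2_inner \<Omega> u (grad \<phi>) = - L2_inner \<Omega> d \<phi>)"

text \<open>A representative of the distributional divergence, unique up to null sets.\<close>

definition divergence :: "(real^'n) set \<Rightarrow> (real^'n \<Rightarrow> real^'n) \<Rightarrow> real^'n \<Rightarrow> real" where
  "divergence \<Omega> u = (SOME d. weak_div \<Omega> u d)"

text \<open>The normal trace of a field in \<open>H(div,\<Omega>)\<close> is the functional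
  \<open>\<phi> \<mapsto> \<langle>u, \<nabla>\<phi>\<rangle> + \<langle>div u, \<phi>\<rangle>\<close>, with \<open>\<phi>\<close> smooth up to the boundary; \<open>u \<cdot> n = 0\<close> on the
  boundary means that it vanishes.\<close>

definition H0_div :: "(real^'n) set \<Rightarrow> (real^'n \<Rightarrow> real^'n) set" where
  "H0_div \<Omega> = {u. u \<in> L2 \<Omega> \<and> (\<exists>d. weak_div \<Omega> u d) \<and>
     (\<forall>\<phi>. smooth \<phi> \<longrightarrow> L2_inner \<Omega> u (grad \<phi>) + L2_inner \<Omega> (divergence \<Omega> u) \<phi> = 0)}"


section \<open>Finite element spaces\<close>

definition polys :: "nat \<Rightarrow> (real^'n \<Rightarrow> real) set" where
  "polys r = {p. \<exists>c. \<forall>x. p x = (\<Sum>k | (\<Sum>i\<in>UNIV. k i) \<le> r. c k * (\<Prod>i\<in>UNIV. (x $ i) ^ k i))}"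

definition vpolys :: "nat \<Rightarrow> (real^'n \<Rightarrow> real^'n) set" where
  "vpolys r = {p. \<forall>i. (\<lambda>x. p x $ i) \<in> polys r}"

definition RT_polys :: "nat \<Rightarrow> (real^'n \<Rightarrow> real^'n) set" where
  "RT_polys s = {\<lambda>x. p x + q x *\<^sub>R x | p q. p \<in> vpolys s \<and> q \<in> polys s}"

definition piecewise ::
  "(real^'n) set set \<Rightarrow> (real^'n \<Rightarrow> 'b) set \<Rightarrow> (real^'n \<Rightarrow> 'b) set" where
  "piecewise Th P = {f. \<forall>K\<in>Th. \<exists>p\<in>P. \<forall>x\<in>interior K. f x = p x}"

definition RT :: "(real^'n) set \<Rightarrow> (real^'n) set set \<Rightarrow> nat \<Rightarrow> (real^'n \<Rightarrow> real^'n) set" where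
  "RT \<Omega> Th s = H0_div \<Omega> \<inter> piecewise Th (RT_polys s)"

definition BDM :: "(real^'n) set \<Rightarrow> (real^'n) set set \<Rightarrow> nat \<Rightarrow> (real^'n \<Rightarrow> real^'n) set" where
  "BDM \<Omega> Th r = H0_div \<Omega> \<inter> piecewise Th (vpolys r)"

definition DG :: "(real^'n) set \<Rightarrow> (real^'n) set set \<Rightarrow> nat \<Rightarrow> (real^'n \<Rightarrow> real) set" where
  "DG \<Omega> Th r = L2 \<Omega> \<inter> piecewise Th (polys r)"

text \<open>A representative of the \<open>L\<^sup>2\<close>-orthogonal projection of \<open>f\<close> onto \<open>V\<close>.\<close>

definition L2_proj ::
  "(real^'n) set \<Rightarrow> (real^'n \<Rightarrow> real) set \<Rightarrow> (real^'n \<Rightarrow> real) \<Rightarrow> real^'n \<Rightarrow> real" where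
  "L2_proj \<Omega> V f = (SOME g. g \<in> V \<and> (\<forall>v\<in>V. L2_inner \<Omega> (\<lambda>x. f x - g x) v = 0))"


section \<open>Jumps and averages\<close>

text \<open>The restriction \<open>f|\<^sub>K\<close>, extended continuously from the interior to the boundary of \<open>K\<close>.\<close>

definition elem_trace ::
  "(real^'n) set \<Rightarrow> (real^'n \<Rightarrow> 'b::t2_space) \<Rightarrow> real^'n \<Rightarrow> 'b" where
  "elem_trace K f x = Lim (at x within interior K) f"

text \<open>In the following, \<open>\<nu>\<close> assigns to each interior face its chosen unit normal.\<close>

definition tr1 ::
  "(real^'n) set set \<Rightarrow> ((real^'n) set \<Rightarrow> real^'n) \<Rightarrow> (real^'n) set \<Rightarrow>
   (real^'n \<Rightarrow> 'b::t2_space) \<Rightarrow> real^'n \<Rightarrow> 'b" where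
  "tr1 Th \<nu> e = elem_trace (elem1 Th (\<nu> e) e)"

definition tr2 ::
  "(real^'n) set set \<Rightarrow> ((real^'n) set \<Rightarrow> real^'n) \<Rightarrow> (real^'n) set \<Rightarrow>
   (real^'n \<Rightarrow> 'b::t2_space) \<Rightarrow> real^'n \<Rightarrow> 'b" where
  "tr2 Th \<nu> e = elem_trace (elem2 Th (\<nu> e) e)"

definition avg ::
  "(real^'n) set set \<Rightarrow> ((real^'n) set \<Rightarrow> real^'n) \<Rightarrow> (real^'n) set \<Rightarrow>
   (real^'n \<Rightarrow> 'b::euclidean_space) \<Rightarrow> real^'n \<Rightarrow> 'b" where
  "avg Th \<nu> e f x = (1/2) *\<^sub>R (tr1 Th \<nu> e f x + tr2 Th \<nu> e f x)"

text \<open>Jump of a scalar field; it is a vector and does not depend on the orientation of \<open>\<nu> e\<close>.\<close>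

definition jump ::
  "(real^'n) set set \<Rightarrow> ((real^'n) set \<Rightarrow> real^'n) \<Rightarrow> (real^'n) set \<Rightarrow>
   (real^'n \<Rightarrow> real) \<Rightarrow> real^'n \<Rightarrow> real^'n" where
  "jump Th \<nu> e f x = tr1 Th \<nu> e f x *\<^sub>R \<nu> e + tr2 Th \<nu> e f x *\<^sub>R (- \<nu> e)"

text \<open>Jump of a vector field.\<close>

definition vjump ::
  "(real^'n) set set \<Rightarrow> ((real^'n) set \<Rightarrow> real^'n) \<Rightarrow> (real^'n) set \<Rightarrow>
   (real^'n \<Rightarrow> real^'n) \<Rightarrow> real^'n \<Rightarrow> real^'n" where
  "vjump Th \<nu> e u x = tr1 Th \<nu> e u x - tr2 Th \<nu> e u x"

text \<open>Fields in \<open>H(div,\<Omega>)\<close> have a single-valued normal component on interior faces; it is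
  evaluated from the first element.\<close>

definition ncomp ::
  "(real^'n) set set \<Rightarrow> ((real^'n) set \<Rightarrow> real^'n) \<Rightarrow> (real^'n) set \<Rightarrow>
   (real^'n \<Rightarrow> real^'n) \<Rightarrow> real^'n \<Rightarrow> real" where
  "ncomp Th \<nu> e u x = tr1 Th \<nu> e u x \<bullet> \<nu> e"


section \<open>Cross products\<close>

text \<open>Identification of \<open>real^3\<close> with itself, and embedding of \<open>real^2\<close> into \<open>real^3\<close> with zero
  third component. The index types \<open>2\<close> and \<open>3\<close> are rings of integers modulo \<open>2\<close> and \<open>3\<close>, and
  the ring structure is needed only so that the numerals \<open>1\<close>, \<open>2\<close>, \<open>3\<close> denote indices of a type
  variable. In every such ring with two (three) elements, \<open>1\<close>, \<open>2\<close> (and \<open>3\<close>) are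
  all the indices, without repetition.\<close>

type_synonym 'n pt = "(real, 'n) vec"

definition embed3 :: "'n::{finite,comm_ring_1} pt \<Rightarrow> real^3" where
  "embed3 v = vector [v $ 1, v $ 2, if CARD('n) = 3 then v $ 3 else 0]"

definition cross :: "'n::{finite,comm_ring_1} pt \<Rightarrow> 'n pt \<Rightarrow> real^3" where
  "cross v w = cross3 (embed3 v) (embed3 w)"

text \<open>The jump of the cross product of two vector fields.\<close>

definition cross_jump ::
  "('n::{finite,comm_ring_1} pt) set set \<Rightarrow> (('n pt) set \<Rightarrow> 'n pt) \<Rightarrow> ('n pt) set \<Rightarrow>
   ('n pt \<Rightarrow> 'n pt) \<Rightarrow> ('n pt \<Rightarrow> 'n pt) \<Rightarrow> 'n pt \<Rightarrow> real^3" where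
  "cross_jump Th \<nu> e u v x =
     cross (tr1 Th \<nu> e u x) (tr1 Th \<nu> e v x) - cross (tr2 Th \<nu> e u x) (tr2 Th \<nu> e v x)"


section \<open>The trilinear forms\<close>

definition a_form ::
  "('n::{finite,comm_ring_1} pt) set set \<Rightarrow> (('n pt) set \<Rightarrow> 'n pt) \<Rightarrow>
   ('n pt \<Rightarrow> 'n pt) \<Rightarrow> ('n pt \<Rightarrow> 'n pt) \<Rightarrow> ('n pt \<Rightarrow> 'n pt) \<Rightarrow> real" where
  "a_form Th \<nu> w u v =
     (\<Sum>K\<in>Th. LINT x|lebesgue_on K. w x \<bullet> (advect v u x - advect u v x)) +
     (\<Sum>e\<in>interior_faces Th. LINT x|face_measure (\<nu> e) e.
        cross (\<nu> e) (avg Th \<nu> e w x) \<bullet> cross_jump Th \<nu> e u v x)"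

text \<open>A scalar jump is normal to the face, so only the normal component of \<open>u\<close> enters the face
  terms. For \<open>u\<close> in \<open>H(div,\<Omega>)\<close> it is single-valued and may be evaluated from the first element.\<close>

definition b_form ::
  "(real^'n) set set \<Rightarrow> ((real^'n) set \<Rightarrow> real^'n) \<Rightarrow>
   (real^'n \<Rightarrow> real^'n) \<Rightarrow> (real^'n \<Rightarrow> real) \<Rightarrow> (real^'n \<Rightarrow> real) \<Rightarrow> real" where
  "b_form Th \<nu> u f g =
     (\<Sum>K\<in>Th. LINT x|lebesgue_on K. (u x \<bullet> grad f x) * g x) -
     (\<Sum>e\<in>interior_faces Th. LINT x|face_measure (\<nu> e) e.
        (tr1 Th \<nu> e u x \<bullet> jump Th \<nu> e f x) * avg Th \<nu> e g x)"


section \<open>Time dependence\<close>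

text \<open>Differentiability in time of a curve in a space of piecewise polynomials. That space is
  finite-dimensional and its elements are determined by their values inside the elements of the
  mesh, so this is differentiability in the space for any norm.
  Derivatives are one-sided at end points of the time interval \<open>I\<close>.\<close>

definition time_differentiable ::
  "real set \<Rightarrow> (real^'n) set set \<Rightarrow> (real \<Rightarrow> real^'n \<Rightarrow> 'b::real_normed_vector) \<Rightarrow> bool" where
  "time_differentiable I Th f \<longleftrightarrow>
     (\<forall>t\<in>I. \<forall>K\<in>Th. \<forall>x\<in>interior K. (\<lambda>\<tau>. f \<tau> x) differentiable (at t within I))"

definition time_deriv ::
  "real set \<Rightarrow> (real \<Rightarrow> real^'n \<Rightarrow> 'b::real_normed_vector) \<Rightarrow> real \<Rightarrow> real^'n \<Rightarrow> 'b" where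
  "time_deriv I f t x = vector_derivative (\<lambda>\<tau>. f \<tau> x) (at t within I)"

end

theory Submission
  imports Defs
begin

text \<open>
  Conservation of mass and energy is algebra: test the continuity equation with \<open>1\<close> and with the
  projection \<open>W\<close> of \<open>u \<cdot> u\<close>, and the momentum equation with \<open>u\<close> itself. Then \<open>a\<^sub>h\<close>, the
  \<open>\<alpha>\<close>-term and the pressure term drop out, and the remaining face and transport terms agree up to
  the factor \<open>1/2\<close>, so that
  \<open>2 \<langle>\<partial>\<^sub>t(\<rho>u), u\<rangle> = \<langle>\<partial>\<^sub>t\<rho>, W\<rangle> = \<langle>\<partial>\<^sub>t\<rho>, u \<cdot> u\<rangle>\<close>, which says that the
  energy is constant.

  The estimate for \<open>\<rho>\<^sup>2\<close> needs \<open>b\<^sub>h(u, \<rho>, \<rho>) = 0\<close>, that is, integration by parts on every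
  element. The divergence theorem on a simplex is obtained by multiplying the field with the product
  of the truncated distances \<open>min 1 (N d)\<close> to the facets, whose gradient concentrates on slabs of
  thickness \<open>1/N\<close> along the facets; stacking translates of a slab yields exactly the unit prisms
  that define the surface measure. The divergence of \<open>u\<close> lies in \<open>Q\<^sub>h\<close>, so it vanishes, and
  testing the weak divergence with bumps near a point of a facet gives continuity of the normal
  components across interior faces and their vanishing on the boundary.
\<close>

section \<open>Polynomials and smooth functions\<close>

text \<open>The form of \<open>face_measure\<close> shapes the integration by parts: a surface
  integral is by definition a volume integral over a unit prism of the integrand composed with a
  projection, so boundary terms arise as limits of volume integrals and no facet is ever
  parametrised. The other obstacle is weak information: \<open>divergence\<close> is an arbitrary
  choice, known only through integrals against test functions, and differentiability in time is
  given only pointwise inside the elements. Both are overcome because the fields are polynomial on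
  every element. A piece extends continuously to the whole space, a trace is a value of the piece,
  the chosen divergence can be tested with the divergence of the piece, and finitely many point
  values control a curve of polynomials. Finally, \<open>\<alpha>\<close> and \<open>\<beta>\<close>
  are arbitrary functions on the faces, possibly not measurable, so an integral containing them is
  never split into a sum: the \<open>\<alpha>\<close>-term vanishes pointwise and the
  \<open>\<beta>\<close>-terms are compared as they stand. The energy balance rests on the product
  rule in the form d/dt (\<rho> |u|^2) = 2 u . d/dt (\<rho> u) - |u|^2 d/dt \<rho>.\<close>

lemma finite_degree_le: "finite {k::'n::finite \<Rightarrow> nat. (\<Sum>i\<in>UNIV. k i) \<le> r}"
proof (rule finite_subset)
  show "{k::'n \<Rightarrow> nat. (\<Sum>i\<in>UNIV. k i) \<le> r} \<subseteq> PiE UNIV (\<lambda>_. {..r})"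
  proof
    fix k :: "'n \<Rightarrow> nat" assume "k \<in> {k. (\<Sum>i\<in>UNIV. k i) \<le> r}"
    moreover have "k i \<le> (\<Sum>i\<in>UNIV. k i)" for i
      by (rule member_le_sum) auto
    ultimately have "k i \<le> r" for i
      by (metis (mono_tags) mem_Collect_eq order_trans)
    then show "k \<in> PiE UNIV (\<lambda>_. {..r})" by (simp add: PiE_def Pi_def)
  qed
  show "finite (PiE (UNIV::'n set) (\<lambda>_. {..r}))"
    by (intro finite_PiE) auto
qed

abbreviation monomial :: "('n \<Rightarrow> nat) \<Rightarrow> real^'n \<Rightarrow> real" where
  "monomial k x \<equiv> (\<Prod>i\<in>UNIV. (x $ i) ^ k i)"

lemma polysI:
  "(\<And>x. p x = (\<Sum>k | (\<Sum>i\<in>UNIV. k i) \<le> r. c k * monomial k x)) \<Longrightarrow> p \<in> polys r"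
  unfolding polys_def by auto

lemma polys_zero: "(\<lambda>x. 0) \<in> polys r"
  by (rule polysI[of _ "\<lambda>_. 0"]) simp

lemma polys_add:
  assumes "p \<in> polys r" "q \<in> polys r" shows "(\<lambda>x. p x + q x) \<in> polys r"
proof -
  obtain c d where "\<And>x. p x = (\<Sum>k | sum k UNIV \<le> r. c k * monomial k x)"
    "\<And>x. q x = (\<Sum>k | sum k UNIV \<le> r. d k * monomial k x)"
    using assms unfolding polys_def by blast
  then have "p x + q x = (\<Sum>k | sum k UNIV \<le> r. (c k + d k) * monomial k x)" for x
    by (simp add: sum.distrib distrib_right)
  then show ?thesis by (rule polysI)
qed

lemma polys_cmult:
  assumes "p \<in> polys r" shows "(\<lambda>x. a * p x) \<in> polys r"
proof -
  obtain c where "\<And>x. p x = (\<Sum>k | sum k UNIV \<le> r. c k * monomial k x)"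
    using assms unfolding polys_def by blast
  then have "a * p x = (\<Sum>k | sum k UNIV \<le> r. (a * c k) * monomial k x)" for x
    by (simp add: sum_distrib_left mult.assoc)
  then show ?thesis by (rule polysI)
qed

lemma polys_sum: "(\<And>i. i \<in> A \<Longrightarrow> p i \<in> polys r) \<Longrightarrow> (\<lambda>x. \<Sum>i\<in>A. p i x) \<in> polys r"
proof (induction A rule: infinite_finite_induct)
  case (insert i A)
  have "(\<lambda>x. p i x + (\<Sum>i\<in>A. p i x)) \<in> polys r"
    by (rule polys_add) (use insert in simp_all)
  with insert show ?case by simp
qed (simp_all add: polys_zero)

lemma polys_monomial:
  assumes "(\<Sum>i\<in>UNIV. k i) \<le> r" shows "monomial k \<in> polys r"
proof (rule polysI[of _ "\<lambda>j. if j = k then 1 else 0"])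
  fix x :: "real^'a"
  have "(\<Sum>j | sum j UNIV \<le> r. (if j = k then 1 else 0) * monomial j x) =
      (\<Sum>j\<in>{k}. (if j = k then 1 else 0) * monomial j x)"
    by (rule sum.mono_neutral_right) (use assms in \<open>auto simp: finite_degree_le\<close>)
  also have "\<dots> = monomial k x"
    by simp
  finally show "monomial k x = (\<Sum>j | sum j UNIV \<le> r. (if j = k then 1 else 0) * monomial j x)"
    by (rule sym)
qed

text \<open>A property that is stable under linear combinations has to be checked on monomials only.
  Partial sums over \<open>A\<close> make the sum in \<open>polys\<close> accessible to
  induction.\<close>

lemma polys_induct [consumes 1, case_names zero add cmult monomial]:
  assumes p: "p \<in> polys r"
    and zero: "P (\<lambda>x. 0)"
    and add: "\<And>f g. P f \<Longrightarrow> P g \<Longrightarrow> P (\<lambda>x. f x + g x)"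
    and cmult: "\<And>a f. P f \<Longrightarrow> P (\<lambda>x. a * f x)"
    and mono: "\<And>k. (\<Sum>i\<in>UNIV. k i) \<le> r \<Longrightarrow> P (monomial k)"
  shows "P p"
proof -
  obtain c where c: "\<And>x. p x = (\<Sum>k | (\<Sum>i\<in>UNIV. k i) \<le> r. c k * monomial k x)"
    using p unfolding polys_def by blast
  have "P (\<lambda>x. \<Sum>k\<in>A. c k * monomial k x)" if "A \<subseteq> {k. (\<Sum>i\<in>UNIV. k i) \<le> r}" for A
    using finite_subset[OF that finite_degree_le] that
  proof (induction A rule: finite_induct)
    case (insert k A)
    then have "P (\<lambda>x. c k * monomial k x + (\<Sum>k\<in>A. c k * monomial k x))"
      by (intro add cmult mono) auto
    with insert show ?case by (simp cong: if_cong)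
  qed (simp add: zero)
  from this[OF order_refl] show ?thesis
    unfolding ext[of p, OF c] .
qed

lemma polys_mono:
  assumes "p \<in> polys r" "r \<le> r'" shows "p \<in> polys r'"
  using assms(1)
proof (induction rule: polys_induct)
  case (monomial k)
  then show ?case using assms(2) by (intro polys_monomial) simp
next
  case (add f g)
  then show ?case by (rule polys_add)
next
  case (cmult a f)
  then show ?case by (rule polys_cmult)
qed (rule polys_zero)

lemma polys_const: "(\<lambda>x. a) \<in> polys r"
  using polys_cmult[OF polys_monomial[of "\<lambda>_. 0" r], of a] by simp

lemma polys_coord: "(\<lambda>x. x $ i) \<in> polys (Suc r)"
proof -
  have "(\<Prod>j\<in>UNIV. (x $ j) ^ (if j = i then 1 else 0)) = x $ i" for x :: "real^'a"
    by (subst prod.mono_neutral_right[of _ "{i}"]) auto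
  then show ?thesis
    using polys_monomial[of "\<lambda>j. if j = i then 1 else 0" "Suc r"] by simp
qed

lemma polys_mult:
  assumes "p \<in> polys r" "q \<in> polys r'" shows "(\<lambda>x. p x * q x) \<in> polys (r + r')"
  using assms(1)
proof (induction rule: polys_induct)
  case (add f g)
  from polys_add[OF this] show ?case by (simp add: distrib_right)
next
  case (cmult a f)
  from polys_cmult[OF this] show ?case by (simp add: mult.assoc)
next
  case (monomial k)
  note k = monomial
  from assms(2) show ?case
  proof (induction rule: polys_induct)
    case (add f g)
    from polys_add[OF this] show ?case by (simp add: distrib_left)
  next
    case (cmult a f)
    from polys_cmult[OF this] show ?case by (simp add: mult_ac)
  next
    case (monomial l)
    have "monomial (\<lambda>i. k i + l i) \<in> polys (r + r')"
      using k monomial by (intro polys_monomial) (simp add: sum.distrib)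
    then show ?case by (simp add: power_add prod.distrib)
  qed (simp add: polys_zero)
qed (simp add: polys_zero)

lemma GDERIV_unique:
  assumes "GDERIV f x :> D" "GDERIV f x :> E" shows "D = E"
proof -
  have "(\<lambda>h. h \<bullet> D) = (\<lambda>h. h \<bullet> E)"
    using assms unfolding gderiv_def by (rule has_derivative_unique)
  then show ?thesis by (metis inner_commute vector_eq_rdot)
qed

lemma grad_eqI: "GDERIV f x :> D \<Longrightarrow> grad f x = D"
  unfolding grad_def by (blast intro: the_equality GDERIV_unique)

text \<open>A variable with exponent 0 keeps that exponent under truncated subtraction; the factor
  \<open>of_nat (k i)\<close> then removes its term.\<close>

lemma GDERIV_monomial:
  "GDERIV (monomial k) x :> (\<chi> i. of_nat (k i) * monomial (k(i := k i - 1)) x)"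
proof -
  have *: "monomial (k(i := k i - 1)) x = x $ i ^ (k i - 1) * (\<Prod>j\<in>UNIV - {i}. x $ j ^ k j)" for i
    by (subst prod.remove[of _ i]) (auto intro!: prod.cong)
  have "((\<lambda>x. \<Prod>i\<in>UNIV. x $ i ^ k i) has_derivative
      (\<lambda>h. \<Sum>i\<in>UNIV. of_nat (k i) * h $ i * x $ i ^ (k i - 1) * (\<Prod>j\<in>UNIV - {i}. x $ j ^ k j))) (at x)"
    by (rule has_derivative_prod)
      (auto intro!: derivative_eq_intros simp: bounded_linear.has_derivative[OF bounded_linear_vec_nth])
  then show ?thesis
    unfolding gderiv_def inner_vec_def vec_lambda_beta * by (simp add: mult_ac)
qed

text \<open>The last clause is Euler's relation for homogeneous polynomials; it keeps the divergence of
  Raviart-Thomas polynomials in degree \<open>r\<close>.\<close>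

lemma polys_GDERIV:
  assumes "p \<in> polys r"
  shows "\<exists>G. (\<forall>x. GDERIV p x :> G x) \<and> (\<forall>i. (\<lambda>x. G x $ i) \<in> polys (r - 1)) \<and>
    (\<lambda>x. x \<bullet> G x) \<in> polys r"
  using assms
proof (induction rule: polys_induct)
  case zero
  then show ?case by (intro exI[of _ "\<lambda>_. 0"]) (auto simp: polys_zero GDERIV_const)
next
  case (add f g)
  then obtain F G where
    "\<forall>x. GDERIV f x :> F x" "\<forall>i. (\<lambda>x. F x $ i) \<in> polys (r - 1)" "(\<lambda>x. x \<bullet> F x) \<in> polys r"
    "\<forall>x. GDERIV g x :> G x" "\<forall>i. (\<lambda>x. G x $ i) \<in> polys (r - 1)" "(\<lambda>x. x \<bullet> G x) \<in> polys r"
    by blast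
  then show ?case
    by (intro exI[of _ "\<lambda>x. F x + G x"]) (auto simp: inner_add_right intro: polys_add GDERIV_add)
next
  case (cmult a f)
  then obtain F where
    "\<forall>x. GDERIV f x :> F x" "\<forall>i. (\<lambda>x. F x $ i) \<in> polys (r - 1)" "(\<lambda>x. x \<bullet> F x) \<in> polys r"
    by blast
  moreover from this have "\<forall>x. GDERIV (\<lambda>x. a * f x) x :> a *\<^sub>R F x"
    unfolding gderiv_def by (auto intro!: derivative_eq_intros)
  ultimately show ?case
    by (intro exI[of _ "\<lambda>x. a *\<^sub>R F x"]) (auto intro: polys_cmult)
next
  case (monomial k)
  let ?G = "\<lambda>x. \<chi> i. of_nat (k i) * monomial (k(i := k i - 1)) x"
  have "(\<lambda>x. ?G x $ i) \<in> polys (r - 1)" for i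
  proof (cases "k i = 0")
    case False
    have "sum k UNIV = k i + sum k (UNIV - {i})"
      by (rule sum.remove) auto
    moreover have "sum (k(i := k i - 1)) UNIV = (k i - 1) + sum k (UNIV - {i})"
      by (subst sum.remove[of _ i]) (auto intro!: sum.cong)
    ultimately have "sum (k(i := k i - 1)) UNIV \<le> r - 1"
      using monomial False by simp
    then show ?thesis
      unfolding vec_lambda_beta by (intro polys_cmult polys_monomial)
  qed (simp add: polys_zero)
  moreover have "x \<bullet> ?G x = of_nat (sum k UNIV) * monomial k x" for x
  proof -
    have "x $ i * (of_nat (k i) * monomial (k(i := k i - 1)) x) = of_nat (k i) * monomial k x" for i
    proof (cases "k i")
      case (Suc l)
      then have "monomial k x = x $ i * monomial (k(i := k i - 1)) x"
        by (subst (1 2) prod.remove[of _ i]) (auto intro!: prod.cong)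
      then show ?thesis by simp
    qed simp
    then show ?thesis
      unfolding inner_vec_def inner_real_def vec_lambda_beta by (simp only: of_nat_sum sum_distrib_right)
  qed
  then have "(\<lambda>x. x \<bullet> ?G x) \<in> polys r"
    using polys_cmult[OF polys_monomial[OF monomial], of "of_nat (sum k UNIV)"] by presburger
  ultimately show ?case
    using GDERIV_monomial by (intro exI[of _ ?G] conjI allI) blast+
qed

lemma polys_grad:
  assumes "p \<in> polys r"
  shows "GDERIV p x :> grad p x" "(\<lambda>x. grad p x $ i) \<in> polys (r - 1)" "(\<lambda>x. x \<bullet> grad p x) \<in> polys r"
proof -
  obtain G where G: "\<And>x. GDERIV p x :> G x" "\<And>i. (\<lambda>x. G x $ i) \<in> polys (r - 1)"
    "(\<lambda>x. x \<bullet> G x) \<in> polys r"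
    using polys_GDERIV[OF assms] by blast
  then have "grad p = G" by (auto intro: grad_eqI)
  with G show "GDERIV p x :> grad p x" "(\<lambda>x. grad p x $ i) \<in> polys (r - 1)"
    "(\<lambda>x. x \<bullet> grad p x) \<in> polys r" by auto
qed

lemma polys_continuous: "p \<in> polys r \<Longrightarrow> continuous_on A p"
  using polys_grad(1) unfolding gderiv_def
  by (meson continuous_at_imp_continuous_on has_derivative_continuous)

text \<open>The classical pointwise divergence. \<open>divergence\<close>, in contrast, is a chosen
  weak one; \<open>weak_div_element\<close> ties the two together.\<close>

definition pdiv :: "(real^'n \<Rightarrow> real^'n) \<Rightarrow> real^'n \<Rightarrow> real" where
  "pdiv p x = (\<Sum>i\<in>UNIV. grad (\<lambda>y. p y $ i) x $ i)"

lemma pdiv_vpolys: "p \<in> vpolys r \<Longrightarrow> pdiv p \<in> polys (r - 1)"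
  unfolding vpolys_def pdiv_def[abs_def] by (intro polys_sum polys_grad(2)) auto

lemma RT_polys_subset: "RT_polys r \<subseteq> vpolys (Suc r)"
proof -
  have "(\<lambda>x. q x * x $ i) \<in> polys (Suc r)" if "q \<in> polys r" for q :: "real^'n \<Rightarrow> real" and i
    using polys_mult[OF that polys_coord[of i 0]] by simp
  then have "(\<lambda>x. p x $ i + q x * x $ i) \<in> polys (Suc r)"
    if "p \<in> vpolys r" "q \<in> polys r" for p :: "real^'n \<Rightarrow> real^'n" and q i
    using that unfolding vpolys_def by (intro polys_add) (blast intro: polys_mono le_SucI)+
  then show ?thesis
    unfolding RT_polys_def by (fastforce simp: vpolys_def[of "Suc r"])
qed

text \<open>The divergence of q x is n q + x . grad q, with n the dimension, and neither summand
  exceeds the degree bound of q.\<close>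

lemma pdiv_RT_polys:
  assumes "w \<in> RT_polys r" shows "pdiv w \<in> polys r"
proof -
  obtain p q where w: "w = (\<lambda>x. p x + q x *\<^sub>R x)" and p: "p \<in> vpolys r" and q: "q \<in> polys r"
    using assms unfolding RT_polys_def by blast
  have D: "GDERIV (\<lambda>x. w x $ i) x :> grad (\<lambda>x. p x $ i) x + (q x *\<^sub>R axis i 1 + x $ i *\<^sub>R grad q x)" for x i
  proof -
    have "GDERIV (\<lambda>x. x $ i) x :> axis i 1"
      unfolding gderiv_def inner_axis by (simp add: bounded_linear_vec_nth bounded_linear_imp_has_derivative)
    then show ?thesis
      unfolding w vector_add_component vector_scaleR_component real_scaleR_def
      using p unfolding vpolys_def
      by (intro GDERIV_add GDERIV_mult polys_grad(1)[OF q]) (auto intro: polys_grad(1))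
  qed
  have "grad (\<lambda>x. w x $ i) x $ i = grad (\<lambda>x. p x $ i) x $ i + (q x + x $ i * grad q x $ i)" for x i
    by (simp add: grad_eqI[OF D])
  then have "pdiv w x = pdiv p x + (of_nat CARD('a) * q x + x \<bullet> grad q x)" for x
    unfolding pdiv_def by (simp add: sum.distrib inner_vec_def)
  moreover have "(\<lambda>x. pdiv p x + (of_nat CARD('a) * q x + x \<bullet> grad q x)) \<in> polys r"
    by (intro polys_add polys_cmult q polys_grad(3)[OF q] polys_mono[OF pdiv_vpolys[OF p]]) auto
  ultimately show ?thesis by presburger
qed

lemma Ck_const: "Ck k (\<lambda>x. a)"
  by (induction k arbitrary: a) (auto intro!: exI[of _ "\<lambda>_. 0"] simp: GDERIV_const)

lemma Ck_imp_continuous: "Ck k f \<Longrightarrow> continuous_on UNIV f"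
  by (cases k)
    (auto simp: gderiv_def intro!: continuous_at_imp_continuous_on dest!: spec has_derivative_continuous)

lemma Ck_Suc_D: "Ck (Suc k) f \<Longrightarrow> Ck k f"
proof (induction k arbitrary: f)
  case 0
  then show ?case using Ck_imp_continuous by (metis Ck.simps(1))
next
  case (Suc k)
  from Suc.prems obtain G where "\<forall>x. GDERIV f x :> G x" "\<forall>i. Ck (Suc k) (\<lambda>x. G x $ i)"
    unfolding Ck.simps(2)[of "Suc k"] by blast
  with Suc.IH show ?case unfolding Ck.simps(2)[of k] by blast
qed

lemma Ck_add: "Ck k f \<Longrightarrow> Ck k g \<Longrightarrow> Ck k (\<lambda>x. f x + g x)"
proof (induction k arbitrary: f g)
  case 0
  then show ?case by (auto intro: continuous_intros)
next
  case (Suc k)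
  then obtain F G where "\<forall>x. GDERIV f x :> F x" "\<forall>i. Ck k (\<lambda>x. F x $ i)"
     "\<forall>x. GDERIV g x :> G x" "\<forall>i. Ck k (\<lambda>x. G x $ i)" by auto
  with Suc.IH show ?case by (auto intro!: exI[of _ "\<lambda>x. F x + G x"] GDERIV_add)
qed

text \<open>The product rule leaves one factor undifferentiated, so the induction also needs
  \<open>f\<close> and \<open>g\<close> themselves one class lower, which \<open>Ck_Suc_D\<close>
  supplies.\<close>

lemma Ck_mult: "Ck k f \<Longrightarrow> Ck k g \<Longrightarrow> Ck k (\<lambda>x. f x * g x)"
proof (induction k arbitrary: f g)
  case 0
  then show ?case by (auto intro: continuous_intros)
next
  case (Suc k)
  then obtain F G where FG: "\<And>x. GDERIV f x :> F x" "\<And>i. Ck k (\<lambda>x. F x $ i)"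
     "\<And>x. GDERIV g x :> G x" "\<And>i. Ck k (\<lambda>x. G x $ i)"
    unfolding Ck.simps(2) by blast
  note f = Ck_Suc_D[OF Suc.prems(1)] and g = Ck_Suc_D[OF Suc.prems(2)]
  have "Ck k (\<lambda>x. f x * G x $ i + g x * F x $ i)" for i
    by (intro Ck_add Suc.IH f g FG)
  moreover have "GDERIV (\<lambda>x. f x * g x) x :> f x *\<^sub>R G x + g x *\<^sub>R F x" for x
    by (intro GDERIV_mult FG)
  ultimately show ?case
    by (auto intro!: exI[of _ "\<lambda>x. f x *\<^sub>R G x + g x *\<^sub>R F x"])
qed

lemma polys_Ck: "p \<in> polys r \<Longrightarrow> Ck k p"
proof (induction k arbitrary: p r)
  case (Suc k)
  show ?case
    unfolding Ck.simps(2)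
    using polys_grad(1)[OF Suc.prems] Suc.IH[OF polys_grad(2)[OF Suc.prems]]
    by (intro exI[of _ "grad p"] conjI allI)
qed (simp add: polys_continuous)

lemma smooth_mult: "smooth f \<Longrightarrow> smooth g \<Longrightarrow> smooth (\<lambda>x. f x * g x)"
  by (simp add: smooth_def Ck_mult)

lemma smooth_const: "smooth (\<lambda>x. a)"
  by (simp add: smooth_def Ck_const)

lemma smooth_prod: "(\<And>i. i \<in> A \<Longrightarrow> smooth (f i)) \<Longrightarrow> smooth (\<lambda>x. \<Prod>i\<in>A. f i x)"
proof (induction A rule: infinite_finite_induct)
  case (insert i A)
  have "smooth (\<lambda>x. f i x * (\<Prod>i\<in>A. f i x))"
    by (rule smooth_mult) (use insert in simp_all)
  with insert show ?case by simp
qed (simp_all add: smooth_const)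

lemma smooth_polys: "p \<in> polys r \<Longrightarrow> smooth p"
  by (simp add: smooth_def polys_Ck)

lemma smooth_GDERIV: "smooth f \<Longrightarrow> GDERIV f x :> grad f x"
  unfolding smooth_def by (metis Ck.simps(2) grad_eqI)

lemma smooth_continuous: "smooth f \<Longrightarrow> continuous_on A f"
  unfolding smooth_def using Ck_imp_continuous continuous_on_subset by blast

lemma smooth_grad_continuous:
  assumes "smooth f" shows "continuous_on A (grad f)"
proof -
  obtain G where G: "\<forall>x. GDERIV f x :> G x" "\<forall>i. Ck 0 (\<lambda>x. G x $ i)"
    using assms unfolding smooth_def by (metis Ck.simps(2))
  then have "grad f = G" by (auto intro: grad_eqI)
  moreover have "continuous_on UNIV G"
    using G(2) continuous_on_vec_lambda[of UNIV "\<lambda>i x. G x $ i"] by simp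
  ultimately show ?thesis using continuous_on_subset by blast
qed

text \<open>The family \<open>t\<^sup>-\<^sup>j exp (-1/t)\<close> is, up to linear combinations, closed under differentiation;
  the member \<open>j = 0\<close> is the classical smooth cutoff.\<close>

definition flat :: "nat \<Rightarrow> real \<Rightarrow> real" where
  "flat j t = (if t > 0 then (1 / t) ^ j * exp (- (1 / t)) else 0)"

lemma flat_tendsto_0: "(flat j \<longlongrightarrow> 0) (at 0)"
proof -
  have "((\<lambda>x::real. x ^ j / exp x) \<longlongrightarrow> 0) at_top"
    by (rule tendsto_power_div_exp_0)
  then have "((\<lambda>t::real. inverse t ^ j / exp (inverse t)) \<longlongrightarrow> 0) (at_right 0)"
    by (rule filterlim_compose[OF _ filterlim_inverse_at_top_right])
  moreover have "\<forall>\<^sub>F t in at_right 0. inverse t ^ j / exp (inverse t) = flat j t"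
    by (rule eventually_mono[OF eventually_at_right_less]) (simp add: flat_def exp_minus divide_inverse)
  ultimately have "(flat j \<longlongrightarrow> 0) (at_right 0)"
    by (rule Lim_transform_eventually)
  moreover have "(flat j \<longlongrightarrow> 0) (at_left 0)"
    by (rule tendsto_eventually, simp add: eventually_at_filter flat_def)
  ultimately show ?thesis
    by (intro filterlim_split_at_real)
qed

text \<open>At 0 the difference quotient of \<open>flat j\<close> is \<open>flat (Suc j)\<close>
  itself, so differentiability there is \<open>flat_tendsto_0\<close> for the next index.\<close>

lemma DERIV_flat: "DERIV (flat j) t :> flat (j + 2) t - of_nat j * flat (j + 1) t"
proof -
  consider "t < 0" | "t = 0" | "t > 0" by linarith
  then show ?thesis
  proof cases
    case 1
    have "DERIV (\<lambda>_. 0) t :> (0::real)" by simp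
    then have "DERIV (flat j) t :> 0"
      by (rule DERIV_cong_ev[THEN iffD1, rotated 3, OF _ refl _ refl])
         (use eventually_nhds_in_open[of "{..<0}" t] 1 in \<open>auto simp: flat_def elim!: eventually_mono\<close>)
    with 1 show ?thesis by (simp add: flat_def)
  next
    case 2
    have "(\<lambda>h. (flat j (0 + h) - flat j 0) / h) = flat (Suc j)"
      by (auto simp: flat_def fun_eq_iff)
    then have "DERIV (flat j) 0 :> 0"
      unfolding DERIV_def using flat_tendsto_0[of "Suc j"] by simp
    with 2 show ?thesis by (simp add: flat_def)
  next
    case 3
    have "DERIV (\<lambda>t. (1 / t) ^ j * exp (- (1 / t))) t :>
        flat (j + 2) t - of_nat j * flat (j + 1) t"
      using 3 by (auto intro!: derivative_eq_intros simp: flat_def)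
        (cases j; auto simp: field_simps power2_eq_square)
    then show ?thesis
      by (rule DERIV_cong_ev[THEN iffD1, rotated 3, OF _ refl _ refl])
         (use eventually_nhds_in_open[of "{0<..}" t] 3 in \<open>auto simp: flat_def elim!: eventually_mono\<close>)
  qed
qed

text \<open>The induction on \<open>k\<close> runs over all \<open>j\<close> at once, since
  differentiation raises the index of \<open>flat\<close>.\<close>

lemma Ck_flat:
  assumes "smooth f" shows "Ck k (\<lambda>x. flat j (f x))"
proof (induction k arbitrary: j)
  case 0
  have "continuous_on UNIV (flat j)"
    by (rule DERIV_continuous_on[OF DERIV_flat])
  from continuous_on_compose2[OF this smooth_continuous[OF assms, of UNIV]] show ?case
    by simp
next
  case (Suc k)
  obtain G where G: "\<forall>x. GDERIV f x :> G x" "\<forall>i. Ck k (\<lambda>x. G x $ i)"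
    using assms unfolding smooth_def by (metis Ck.simps(2))
  have "Ck k (\<lambda>x. (flat (j + 2) (f x) + (- of_nat j) * flat (j + 1) (f x)) * G x $ i)" for i
    by (intro Ck_mult Ck_add Ck_const Suc.IH) (use G in auto)
  moreover have "GDERIV (\<lambda>x. flat j (f x)) x :>
      (flat (j + 2) (f x) - of_nat j * flat (j + 1) (f x)) *\<^sub>R G x" for x
    using GDERIV_DERIV_compose[OF _ DERIV_flat] G by blast
  ultimately show ?case
    by (auto intro!: exI[of _ "\<lambda>x. (flat (j + 2) (f x) - of_nat j * flat (j + 1) (f x)) *\<^sub>R G x"])
qed

lemma smooth_flat: "smooth f \<Longrightarrow> smooth (\<lambda>x. flat 0 (f x))"
  using Ck_flat unfolding smooth_def[of "\<lambda>x. flat 0 (f x)"] by blast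


section \<open>Integration by translation\<close>

lemma borel_measurable_cong_AE_complete:
  assumes M: "complete_measure M" and ae: "AE x in M. f x = g x"
    and f: "f \<in> borel_measurable M"
  shows "g \<in> borel_measurable M"
proof (rule measurableI)
  fix A :: "'b set" assume "A \<in> sets borel"
  then have "f -` A \<inter> space M \<in> sets M"
    using f by (rule measurable_sets[rotated])
  moreover have "AE x in M. x \<in> f -` A \<inter> space M \<longleftrightarrow> x \<in> g -` A \<inter> space M"
    using ae by eventually_elim auto
  ultimately show "g -` A \<inter> space M \<in> sets M"
    using complete_measure.in_sets_AE[OF M] by blast
qed simp

text \<open>Over a complete measure, almost equal functions are measurable together, and if neither
  is, both integrals are 0 by convention. Thus no measurability is asked for, which admits
  integrands containing the arbitrary parameter \<open>\<beta>\<close>.\<close>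

lemma integral_cong_AE_complete:
  fixes f g :: "'a \<Rightarrow> 'b::{banach, second_countable_topology}"
  assumes M: "complete_measure M" and ae: "AE x in M. f x = g x"
  shows "integrable M f \<longleftrightarrow> integrable M g" "integral\<^sup>L M f = integral\<^sup>L M g"
proof -
  have ae': "AE x in M. g x = f x" using ae by eventually_elim simp
  have meas: "f \<in> borel_measurable M \<longleftrightarrow> g \<in> borel_measurable M"
    using borel_measurable_cong_AE_complete[OF M ae] borel_measurable_cong_AE_complete[OF M ae']
    by blast
  show int: "integrable M f \<longleftrightarrow> integrable M g"
    using integrable_cong_AE[OF _ _ ae] meas by (metis borel_measurable_integrable)
  show "integral\<^sup>L M f = integral\<^sup>L M g"
  proof (cases "f \<in> borel_measurable M")
    case True
    then show ?thesis using integral_cong_AE[OF _ _ ae] meas by blast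
  next
    case False
    then have "\<not> integrable M f" by (meson borel_measurable_integrable)
    then show ?thesis using int by (simp add: not_integrable_integral_eq)
  qed
qed

text \<open>Moves an integral between different domains: the open and the closed element, or
  \<open>\<Omega>\<close> and an element outside of which the integrand vanishes.\<close>

lemma LINT_cong_negligible:
  fixes f g :: "'a::euclidean_space \<Rightarrow> 'b::{banach, second_countable_topology}"
  assumes "S \<in> sets lebesgue" "T \<in> sets lebesgue" "negligible N"
    and eq: "\<And>x. x \<notin> N \<Longrightarrow> indicator S x *\<^sub>R f x = indicator T x *\<^sub>R g x"
  shows "integrable (lebesgue_on S) f \<longleftrightarrow> integrable (lebesgue_on T) g"
    "(LINT x|lebesgue_on S. f x) = (LINT x|lebesgue_on T. g x)"
proof -
  have "AE x in lebesgue. x \<notin> N"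
    using assms(3) by (simp add: negligible_iff_null_sets AE_not_in)
  then have "AE x in lebesgue. indicator S x *\<^sub>R f x = indicator T x *\<^sub>R g x"
    by eventually_elim (rule eq)
  note * = integral_cong_AE_complete[OF completion.complete_measure_axioms this]
  show "integrable (lebesgue_on S) f \<longleftrightarrow> integrable (lebesgue_on T) g"
    "(LINT x|lebesgue_on S. f x) = (LINT x|lebesgue_on T. g x)"
    using * assms(1,2) by (simp_all add: integrable_restrict_space integral_restrict_space)
qed

lemma LINT_lebesgue_on_eq_lborel:
  fixes f :: "'a::euclidean_space \<Rightarrow> real"
  assumes "S \<in> sets borel" "(\<lambda>x. indicator S x * f x) \<in> borel_measurable borel"
  shows "(LINT x|lebesgue_on S. f x) = (LINT x|lborel. indicator S x * f x)"
  using assms by (simp add: integral_restrict_space integral_completion)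

lemma integrable_lebesgue_on_compact:
  fixes f :: "'a::euclidean_space \<Rightarrow> 'b::{banach, second_countable_topology}"
  assumes "compact S" "continuous_on S f"
  shows "integrable (lebesgue_on S) f"
proof -
  have "integrable lborel (\<lambda>x. indicator S x *\<^sub>R f x)"
    using assms by (rule borel_integrable_compact)
  then have "integrable lebesgue (\<lambda>x. indicator S x *\<^sub>R f x)"
    by (simp add: integrable_completion borel_measurable_integrable)
  then show ?thesis
    using assms(1) by (simp add: integrable_restrict_space borel_compact)
qed

lemma lborel_integral_translate:
  fixes f :: "'a::euclidean_space \<Rightarrow> real"
  assumes [measurable]: "f \<in> borel_measurable borel"
  shows "(LINT x|lborel. f (x + c)) = (LINT x|lborel. f x)"
    "integrable lborel (\<lambda>x. f (x + c)) \<longleftrightarrow> integrable lborel f"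
proof -
  have "(LINT x|lborel. f x) = (LINT x|distr lborel borel ((+) c). f x)"
    by (simp add: lborel_distr_plus)
  also have "\<dots> = (LINT x|lborel. f (c + x))"
    by (rule integral_distr) auto
  finally show "(LINT x|lborel. f (x + c)) = (LINT x|lborel. f x)"
    by (simp add: add.commute)
  have "integrable lborel f \<longleftrightarrow> integrable (distr lborel borel ((+) c)) f"
    by (simp add: lborel_distr_plus)
  also have "\<dots> \<longleftrightarrow> integrable lborel (\<lambda>x. f (c + x))"
    by (rule integrable_distr_eq) auto
  finally show "integrable lborel (\<lambda>x. f (x + c)) \<longleftrightarrow> integrable lborel f"
    by (simp add: add.commute)
qed

lemma integrable_const_cball: "integrable lborel (\<lambda>x::'a::euclidean_space. indicator (cball 0 R) x * (B::real))"
  using borel_integrable_compact[of "cball (0::'a) R" "\<lambda>_. B"]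
  by (simp only: real_scaleR_def compact_cball continuous_on_const simp_thms)

lemma integrable_bounded_support:
  fixes f :: "'a::euclidean_space \<Rightarrow> real"
  assumes [measurable]: "f \<in> borel_measurable borel"
    and bound: "\<And>x. \<bar>f x\<bar> \<le> B" and supp: "\<And>x. R < norm x \<Longrightarrow> f x = 0"
  shows "integrable lborel f"
proof (rule Bochner_Integration.integrable_bound)
  show "integrable lborel (\<lambda>x. indicator (cball 0 R) x * B)"
    by (rule integrable_const_cball)
  show "AE x in lborel. norm (f x) \<le> norm (indicator (cball 0 R) x * B)"
  proof (rule AE_I2)
    fix x
    have "\<bar>f x\<bar> \<le> \<bar>B\<bar>" using bound[of x] by linarith
    then show "norm (f x) \<le> norm (indicator (cball 0 R) x * B)"
      using supp[of x] by (auto simp: indicator_def)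
  qed
qed simp

text \<open>The difference quotients of a compactly supported function integrate to zero by translation
  invariance, and the Lipschitz bound lets the limit pass under the integral.\<close>

lemma integral_directional_derivative_eq_0:
  fixes f D :: "'a::euclidean_space \<Rightarrow> real"
  assumes lip: "\<And>x y. \<bar>f x - f y\<bar> \<le> L * norm (x - y)"
    and supp: "\<And>x. R < norm x \<Longrightarrow> f x = 0"
    and N: "negligible N"
    and D: "\<And>x. x \<notin> N \<Longrightarrow> ((\<lambda>t. f (x + t *\<^sub>R e)) has_real_derivative D x) (at 0)"
  shows "integrable lebesgue D" "(LINT x|lebesgue. D x) = 0"
proof -
  have "continuous_on UNIV f"
  proof (rule continuous_on_subset[OF lipschitz_on_continuous_on[of "\<bar>L\<bar>" UNIV f]])
    have "dist (f x) (f y) \<le> \<bar>L\<bar> * dist x y" for x y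
      using order_trans[OF lip[of x y] mult_right_mono[OF abs_ge_self norm_ge_zero]]
      by (simp add: dist_norm)
    then show "\<bar>L\<bar>-lipschitz_on UNIV f" by (auto intro: lipschitz_onI)
  qed simp
  then have f[measurable]: "f \<in> borel_measurable borel"
    by (rule borel_measurable_continuous_onI)
  have intf: "integrable lborel f"
  proof (rule integrable_bounded_support[OF f _ supp])
    fix x
    \<comment> \<open>Any point outside the ball of radius \<open>R\<close> would do:
      \<open>f\<close> vanishes there, and the Lipschitz estimate becomes a bound on
      \<open>f\<close>.\<close>
    define y where "y = (\<bar>R\<bar> + 1) *\<^sub>R (SOME b. b \<in> (Basis :: 'a set))"
    have "(SOME b. b \<in> (Basis :: 'a set)) \<in> Basis" using nonempty_Basis by (simp add: some_in_eq)
    then have y: "norm y = \<bar>R\<bar> + 1" unfolding y_def by simp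
    then have "f y = 0" by (intro supp) auto
    show "\<bar>f x\<bar> \<le> \<bar>L\<bar> * (\<bar>R\<bar> + (\<bar>R\<bar> + 1))"
    proof (cases "R < norm x")
      case False
      then have "norm (x - y) \<le> \<bar>R\<bar> + (\<bar>R\<bar> + 1)"
        using norm_triangle_ineq4[of x y] y by linarith
      then have "L * norm (x - y) \<le> \<bar>L\<bar> * (\<bar>R\<bar> + (\<bar>R\<bar> + 1))"
        by (intro mult_mono) auto
      then show ?thesis using lip[of x y] \<open>f y = 0\<close> by simp
    qed (simp add: supp)
  qed
  define q where "q k x = (f (x + (1 / real (Suc k)) *\<^sub>R e) - f x) * real (Suc k)" for k x
  have [measurable]: "q k \<in> borel_measurable borel" for k
    unfolding q_def[abs_def] by measurable
  \<comment> \<open>\<open>D\<close> is specified only off \<open>N\<close>. The limit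
    \<open>E\<close> of the difference quotients is Borel measurable everywhere and stands in for
    it.\<close>
  define E where "E x = lim (\<lambda>k. q k x)" for x
  have E[measurable]: "E \<in> borel_measurable borel"
    unfolding E_def[abs_def] by measurable
  have N': "AE x in lebesgue. x \<notin> N"
    using N by (simp add: negligible_iff_null_sets AE_not_in)
  have lim: "(\<lambda>k. q k x) \<longlonglongrightarrow> D x" if "x \<notin> N" for x
  proof -
    have "((\<lambda>t. (f (x + t *\<^sub>R e) - f x) / t) \<longlongrightarrow> D x) (at 0)"
      using D[OF that] by (simp add: DERIV_def)
    moreover have "filterlim (\<lambda>k. 1 / real (Suc k)) (at 0) sequentially"
      unfolding filterlim_at using LIMSEQ_inverse_real_of_nat by (auto simp: inverse_eq_divide)
    ultimately have "(\<lambda>k. (f (x + (1 / real (Suc k)) *\<^sub>R e) - f x) / (1 / real (Suc k))) \<longlonglongrightarrow> D x"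
      by (rule filterlim_compose)
    then show ?thesis by (simp add: q_def)
  qed
  have ae_lim: "AE x in lebesgue. (\<lambda>k. q k x) \<longlonglongrightarrow> E x"
    using N'
  proof eventually_elim
    case (elim x)
    then show ?case using lim[OF elim] limI[OF lim[OF elim]] by (simp add: E_def)
  qed
  have ae: "AE x in lebesgue. E x = D x"
    using N' by eventually_elim (use lim in \<open>auto simp: E_def limI\<close>)
  \<comment> \<open>The step sizes are at most 1, so the translates enlarge the support by no more
    than \<open>norm e\<close>.\<close>
  let ?w = "\<lambda>x. indicator (cball 0 (\<bar>R\<bar> + norm e)) x * (\<bar>L\<bar> * norm e)"
  have w: "integrable lebesgue ?w"
    by (rule integrable_completion[THEN iffD2, OF borel_measurable_integrable[OF integrable_const_cball]
          integrable_const_cball])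
  have bound: "norm (q k x) \<le> ?w x" for k x
  proof (cases "x \<in> cball 0 (\<bar>R\<bar> + norm e)")
    case True
    have "\<bar>f (x + (1 / real (Suc k)) *\<^sub>R e) - f x\<bar> \<le> L * norm ((1 / real (Suc k)) *\<^sub>R e)"
      using lip[of "x + (1 / real (Suc k)) *\<^sub>R e" x] by simp
    then have "\<bar>f (x + (1 / real (Suc k)) *\<^sub>R e) - f x\<bar> * real (Suc k) \<le> L * norm e"
      by (simp add: field_simps)
    also have "\<dots> \<le> \<bar>L\<bar> * norm e" by (intro mult_right_mono) auto
    finally show ?thesis using True by (simp add: q_def abs_mult)
  next
    case False
    let ?y = "x + (1 / real (Suc k)) *\<^sub>R e"
    have "norm ((1 / real (Suc k)) *\<^sub>R e) \<le> norm e"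
      by (simp add: divide_le_eq) (simp add: mult_le_cancel_left1 distrib_left)
    then have "\<bar>R\<bar> < norm ?y" "\<bar>R\<bar> < norm x"
      using False norm_diff_ineq[of x "(1 / real (Suc k)) *\<^sub>R e"] norm_ge_zero[of e]
      unfolding mem_cball_0 by linarith+
    then show ?thesis using False by (simp add: q_def supp)
  qed
  have ints: "integrable lebesgue E"
    by (rule integrable_dominated_convergence[OF _ _ w ae_lim AE_I2[OF bound]])
      (simp_all add: measurable_completion)
  have ints2: "(\<lambda>k. LINT x|lebesgue. q k x) \<longlonglongrightarrow> (LINT x|lebesgue. E x)"
    by (rule integral_dominated_convergence[OF _ _ w ae_lim AE_I2[OF bound]])
      (simp_all add: measurable_completion)
  have "(LINT x|lebesgue. q k x) = 0" for k
  proof -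
    have "(LINT x|lebesgue. q k x) = (LINT x|lborel. q k x)"
      by (simp add: integral_completion)
    also have "\<dots> = ((LINT x|lborel. f (x + (1 / real (Suc k)) *\<^sub>R e)) - (LINT x|lborel. f x)) * real (Suc k)"
      unfolding q_def using intf
      by (subst integral_mult_left_zero, subst Bochner_Integration.integral_diff)
        (auto simp: lborel_integral_translate(2))
    also have "\<dots> = 0" by (simp add: lborel_integral_translate(1))
    finally show ?thesis .
  qed
  with ints2 have "(LINT x|lebesgue. E x) = 0"
    by (simp add: LIMSEQ_const_iff)
  with ints show "integrable lebesgue D" "(LINT x|lebesgue. D x) = 0"
    using integral_cong_AE_complete[OF completion.complete_measure_axioms ae] by auto
qed

text \<open>Replaces the rescaling of a thin slab to unit thickness: the slab is translated \<open>N\<close> times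
  on top of itself.\<close>

lemma integral_slab_fold:
  fixes f :: "'a::euclidean_space \<Rightarrow> real"
  assumes n: "norm n = 1" and N: "0 < N" and [measurable]: "f \<in> borel_measurable borel"
    and int: "integrable lborel (\<lambda>x. indicator {x. 0 \<le> n \<bullet> x + c \<and> n \<bullet> x + c < 1 / real N} x * f x)"
  shows "real N * (LINT x|lborel. indicator {x. 0 \<le> n \<bullet> x + c \<and> n \<bullet> x + c < 1 / real N} x * f x) =
    (LINT x|lborel. indicator {x. 0 \<le> n \<bullet> x + c \<and> n \<bullet> x + c < 1} x *
       f (x - (of_int \<lfloor>real N * (n \<bullet> x + c)\<rfloor> / real N) *\<^sub>R n))"
proof -
  define d where "d x = n \<bullet> x + c" for x
  have d_shift: "d (x + t *\<^sub>R n) = d x + t" for x t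
    using n by (simp add: d_def inner_add_right power2_norm_eq_inner[symmetric])
  \<comment> \<open>\<open>A 0\<close> is the thin slab. Its translates \<open>A j\<close> with
    \<open>j < N\<close> are half-open, hence disjoint, and tile the unit slab; the floor in the
    claim recovers the index of the slice.\<close>
  define A where "A j = {x. real j / real N \<le> d x \<and> d x < real (Suc j) / real N}" for j
  have [measurable]: "d \<in> borel_measurable borel"
    unfolding d_def[abs_def] by measurable
  have [measurable]: "A j \<in> sets borel" for j
    unfolding A_def by measurable
  define g where "g x = indicator (A 0) x * f x" for x
  have [measurable]: "g \<in> borel_measurable borel"
    unfolding g_def[abs_def] by measurable
  have g_eq: "g x = indicator {x. 0 \<le> n \<bullet> x + c \<and> n \<bullet> x + c < 1 / real N} x * f x" for x
    by (simp add: g_def A_def d_def)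
  have g_shift: "g (x + (- (real j / real N)) *\<^sub>R n) = indicator (A j) x * f (x - (real j / real N) *\<^sub>R n)" for j x
  proof -
    have "x + (- (real j / real N)) *\<^sub>R n \<in> A 0 \<longleftrightarrow> x \<in> A j"
      unfolding A_def mem_Collect_eq d_shift by (auto simp: add_divide_distrib)
    then show ?thesis by (simp add: g_def indicator_def)
  qed
  have int_g: "integrable lborel (\<lambda>x. g (x + t))" for t
    using int by (subst lborel_integral_translate(2)) (simp_all add: g_eq[abs_def])
  have "real N * (LINT x|lborel. g x) = (\<Sum>j<N. LINT x|lborel. g (x + (- (real j / real N)) *\<^sub>R n))"
    by (subst lborel_integral_translate(1)) auto
  also have "\<dots> = (LINT x|lborel. (\<Sum>j<N. g (x + (- (real j / real N)) *\<^sub>R n)))"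
    by (rule Bochner_Integration.integral_sum[symmetric]) (rule int_g)
  also have "\<dots> = (LINT x|lborel. indicator {x. 0 \<le> d x \<and> d x < 1} x *
       f (x - (of_int \<lfloor>real N * d x\<rfloor> / real N) *\<^sub>R n))"
  proof (rule Bochner_Integration.integral_cong[OF refl])
    fix x
    have iff: "x \<in> A j \<longleftrightarrow> \<lfloor>real N * d x\<rfloor> = int j" for j
      using N unfolding A_def floor_eq_iff by (auto simp: field_simps)
    show "(\<Sum>j<N. g (x + (- (real j / real N)) *\<^sub>R n)) =
       indicator {x. 0 \<le> d x \<and> d x < 1} x * f (x - (of_int \<lfloor>real N * d x\<rfloor> / real N) *\<^sub>R n)"
    proof (cases "0 \<le> d x \<and> d x < 1")
      case True
      then have "0 \<le> real N * d x" "real N * d x < real N" using N by auto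
      then have *: "0 \<le> \<lfloor>real N * d x\<rfloor>" "\<lfloor>real N * d x\<rfloor> < int N"
        by (simp_all add: floor_less_iff)
      define j where "j = nat \<lfloor>real N * d x\<rfloor>"
      have j: "j < N" "\<lfloor>real N * d x\<rfloor> = int j" using * N by (auto simp: j_def nat_less_iff)
      have "(\<Sum>i<N. indicator (A i) x * f (x - (real i / real N) *\<^sub>R n)) =
          (\<Sum>i\<in>{j}. indicator (A i) x * f (x - (real i / real N) *\<^sub>R n))"
        by (rule sum.mono_neutral_right) (use j iff in \<open>auto simp: indicator_def\<close>)
      then show ?thesis
        unfolding g_shift using True j iff[of j] by (simp add: indicator_def)
    next
      case False
      have "x \<notin> A j" if "j < N" for j
      proof
        assume "x \<in> A j"
        then have "real j / real N \<le> d x" "d x < real (Suc j) / real N" by (auto simp: A_def)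
        moreover have "0 \<le> real j / real N" "real (Suc j) / real N \<le> 1" using that by auto
        ultimately show False using False by linarith
      qed
      then show ?thesis
        unfolding g_shift using False by (simp add: indicator_def)
    qed
  qed
  finally show ?thesis by (simp add: g_eq d_def)
qed


section \<open>Simplices and signed distances to facets\<close>

text \<open>For z in the hyperplane, n . x + c = n . (x - z), so Cauchy-Schwarz bounds the distance
  from below. This makes the projection in \<open>face_measure\<close> explicit.\<close>

lemma closest_point_hyperplane:
  fixes x :: "'a::euclidean_space"
  assumes n: "norm n = 1"
  shows "closest_point {y. n \<bullet> y + c = 0} x = x - (n \<bullet> x + c) *\<^sub>R n"
proof (rule closest_point_unique[symmetric])
  have H: "{y. n \<bullet> y + c = 0} = {y. n \<bullet> y = - c}" by auto
  show "convex {y. n \<bullet> y + c = 0}" "closed {y. n \<bullet> y + c = 0}"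
    unfolding H by (auto intro: convex_hyperplane closed_hyperplane)
  have nn: "n \<bullet> n = 1" using n by (simp add: power2_norm_eq_inner[symmetric])
  then show "x - (n \<bullet> x + c) *\<^sub>R n \<in> {y. n \<bullet> y + c = 0}"
    by (simp add: inner_diff_right)
  show "\<forall>z\<in>{y. n \<bullet> y + c = 0}. dist x (x - (n \<bullet> x + c) *\<^sub>R n) \<le> dist x z"
  proof
    fix z assume "z \<in> {y. n \<bullet> y + c = 0}"
    then have "n \<bullet> x + c = n \<bullet> (x - z)" by (simp add: inner_diff_right)
    then have "\<bar>n \<bullet> x + c\<bar> \<le> norm (x - z)"
      using Cauchy_Schwarz_ineq2[of n "x - z"] n by simp
    then show "dist x (x - (n \<bullet> x + c) *\<^sub>R n) \<le> dist x z"
      using n by (simp add: dist_norm)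
  qed
qed

lemma AE_lborel_negligible: "negligible N \<Longrightarrow> AE x in lborel. x \<notin> N"
  by (subst AE_completion_iff[symmetric]) (simp add: negligible_iff_null_sets AE_not_in)

definition clamp01 :: "real \<Rightarrow> real" where "clamp01 t = max 0 (min 1 t)"

lemma clamp01_bounds: "0 \<le> clamp01 t" "clamp01 t \<le> 1"
  by (auto simp: clamp01_def)

lemma clamp01_eq: "t \<le> 0 \<Longrightarrow> clamp01 t = 0" "1 \<le> t \<Longrightarrow> clamp01 t = 1"
  by (auto simp: clamp01_def)

lemma clamp01_lipschitz: "\<bar>clamp01 s - clamp01 t\<bar> \<le> \<bar>s - t\<bar>"
  by (auto simp: clamp01_def min_def max_def)

lemma clamp01_measurable[measurable]: "clamp01 \<in> borel_measurable borel"
  unfolding clamp01_def[abs_def] by measurable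

lemma clamp01_deriv:
  assumes "s \<noteq> 0" "s \<noteq> 1"
  shows "(clamp01 has_real_derivative (if 0 < s \<and> s < 1 then 1 else 0)) (at s)"
proof -
  consider "s < 0" | "0 < s" "s < 1" | "1 < s" using assms by linarith
  then show ?thesis
  proof cases
    case 1
    have "((\<lambda>_. 0) has_real_derivative 0) (at s)" by simp
    then have "(clamp01 has_real_derivative 0) (at s)"
      by (rule has_field_derivative_transform_within_open[where S = "{..<0}"])
        (use 1 in \<open>auto simp: clamp01_def\<close>)
    then show ?thesis using 1 by simp
  next
    case 2
    have "((\<lambda>t. t) has_real_derivative 1) (at s)" by simp
    then have "(clamp01 has_real_derivative 1) (at s)"
      by (rule has_field_derivative_transform_within_open[where S = "{0<..<1}"])
        (use 2 in \<open>auto simp: clamp01_def\<close>)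
    then show ?thesis using 2 by simp
  next
    case 3
    have "((\<lambda>_. 1) has_real_derivative 0) (at s)" by simp
    then have "(clamp01 has_real_derivative 0) (at s)"
      by (rule has_field_derivative_transform_within_open[where S = "{1<..}"])
        (use 3 in \<open>auto simp: clamp01_def\<close>)
    then show ?thesis using 3 by simp
  qed
qed

text \<open>The limit \<open>y0 = 0\<close> is excluded because the scaled values may then converge
  to anything or not at all.\<close>

lemma clamp01_scaled_tendsto:
  assumes y: "y \<longlonglongrightarrow> y0" and "y0 \<noteq> 0"
  shows "(\<lambda>k. clamp01 (real (Suc k) * y k)) \<longlonglongrightarrow> (if 0 < y0 then 1 else 0)"
proof (cases "0 < y0")
  case True
  have "filterlim (\<lambda>k. real (Suc k)) at_top sequentially"
    by (rule filterlim_compose[OF filterlim_real_sequentially filterlim_Suc])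
  then have "filterlim (\<lambda>k. real (Suc k) * y k) at_top sequentially"
    by (rule filterlim_at_top_mult_tendsto_pos[OF y True])
  then have "\<forall>\<^sub>F k in sequentially. 1 \<le> real (Suc k) * y k"
    unfolding filterlim_at_top by blast
  then have "\<forall>\<^sub>F k in sequentially. clamp01 (real (Suc k) * y k) = 1"
    by eventually_elim (rule clamp01_eq)
  then show ?thesis using True by (simp add: tendsto_eventually)
next
  case False
  then have "y0 < 0" using assms(2) by simp
  then have "\<forall>\<^sub>F k in sequentially. y k < 0"
    using y by (simp add: order_tendstoD)
  then have "\<forall>\<^sub>F k in sequentially. clamp01 (real (Suc k) * y k) = 0"
    by eventually_elim (rule clamp01_eq, simp add: mult_le_0_iff)
  then show ?thesis using False by (simp add: tendsto_eventually)
qed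

text \<open>Folding lowers a point at height \<open>t\<close> by this amount, so in the limit the
  point reaches the hyperplane.\<close>

lemma floor_scaled_tendsto: "(\<lambda>k. of_int \<lfloor>real (Suc k) * t\<rfloor> / real (Suc k)) \<longlonglongrightarrow> (t::real)"
proof (rule tendsto_sandwich)
  show "\<forall>\<^sub>F k in sequentially. t - inverse (real (Suc k)) \<le> of_int \<lfloor>real (Suc k) * t\<rfloor> / real (Suc k)"
  proof (rule always_eventually, rule allI)
    fix k
    have "real (Suc k) * t - 1 \<le> of_int \<lfloor>real (Suc k) * t\<rfloor>" by linarith
    then have "(real (Suc k) * t - 1) / real (Suc k) \<le> of_int \<lfloor>real (Suc k) * t\<rfloor> / real (Suc k)"
      by (rule divide_right_mono) simp
    then show "t - inverse (real (Suc k)) \<le> of_int \<lfloor>real (Suc k) * t\<rfloor> / real (Suc k)"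
      by (simp add: diff_divide_distrib inverse_eq_divide)
  qed
  show "\<forall>\<^sub>F k in sequentially. of_int \<lfloor>real (Suc k) * t\<rfloor> / real (Suc k) \<le> t"
  proof (rule always_eventually, rule allI)
    fix k
    have "of_int \<lfloor>real (Suc k) * t\<rfloor> \<le> t * real (Suc k)" by (simp add: mult.commute)
    then show "of_int \<lfloor>real (Suc k) * t\<rfloor> / real (Suc k) \<le> t"
      by (subst pos_divide_le_eq) auto
  qed
  show "(\<lambda>k. t - inverse (real (Suc k))) \<longlonglongrightarrow> t"
    using tendsto_diff[OF tendsto_const[of t] LIMSEQ_inverse_real_of_nat] by simp
qed simp

text \<open>\<open>n v \<bullet> x + c v\<close> is the signed distance of \<open>x\<close> from the facet opposite to the vertex \<open>v\<close>, so
  \<open>n v\<close> is an inward unit normal.\<close>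

locale nsimplex =
  fixes C :: "'a::euclidean_space set" and n :: "'a \<Rightarrow> 'a" and c :: "'a \<Rightarrow> real"
  assumes indep: "\<not> affine_dependent C" and card: "card C = DIM('a) + 1"
    and norm_n: "v \<in> C \<Longrightarrow> norm (n v) = 1"
    and vertex: "v \<in> C \<Longrightarrow> 0 < n v \<bullet> v + c v"
    and opposite: "v \<in> C \<Longrightarrow> w \<in> C \<Longrightarrow> w \<noteq> v \<Longrightarrow> n v \<bullet> w + c v = 0"
begin

definition fdist :: "'a \<Rightarrow> 'a \<Rightarrow> real" where "fdist v x = n v \<bullet> x + c v"

definition fproj :: "'a \<Rightarrow> 'a \<Rightarrow> 'a" where "fproj v x = x - fdist v x *\<^sub>R n v"

lemma finite_C: "finite C"
  using indep by (rule aff_independent_finite)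

text \<open>\<open>fdist v\<close> is affine and vanishes at all vertices but \<open>v\<close>;
  hence \<open>fdist v x / fdist v v\<close> is the barycentric coordinate of \<open>x\<close> at
  \<open>v\<close>.\<close>

lemma fdist_affine_comb:
  assumes "sum u C = 1" "v \<in> C"
  shows "fdist v (\<Sum>w\<in>C. u w *\<^sub>R w) = u v * fdist v v"
proof -
  have "fdist v (\<Sum>w\<in>C. u w *\<^sub>R w) = (\<Sum>w\<in>C. u w * fdist v w)"
    using assms(1) by (simp add: fdist_def inner_sum_right distrib_left sum.distrib flip: sum_distrib_right)
  also have "\<dots> = (\<Sum>w\<in>{v}. u w * fdist v w)"
    by (rule sum.mono_neutral_right) (use assms opposite finite_C in \<open>auto simp: fdist_def\<close>)
  finally show ?thesis by simp
qed

lemma affine_hull_C: "affine hull C = UNIV"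
proof -
  have "aff_dim C = int DIM('a)"
    using aff_dim_affine_independent[OF indep] card by simp
  then show ?thesis by (simp add: aff_dim_eq_full)
qed

lemma affine_comb_exists:
  "\<exists>u. sum u C = 1 \<and> x = (\<Sum>w\<in>C. u w *\<^sub>R w) \<and> (\<forall>v\<in>C. fdist v x = u v * fdist v v)"
proof -
  have "x \<in> affine hull C" by (simp add: affine_hull_C)
  then obtain u where "sum u C = 1" "x = (\<Sum>w\<in>C. u w *\<^sub>R w)"
    unfolding affine_hull_finite[OF finite_C] by auto
  then show ?thesis using fdist_affine_comb by blast
qed

lemma fdist_vertex: "v \<in> C \<Longrightarrow> 0 < fdist v v"
  unfolding fdist_def by (rule vertex)

lemma mem_hull_iff: "x \<in> convex hull C \<longleftrightarrow> (\<forall>v\<in>C. 0 \<le> fdist v x)"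
proof
  assume "x \<in> convex hull C"
  then obtain u where "\<forall>v\<in>C. 0 \<le> u v" "sum u C = 1" "x = (\<Sum>w\<in>C. u w *\<^sub>R w)"
    unfolding convex_hull_finite[OF finite_C] by auto
  then show "\<forall>v\<in>C. 0 \<le> fdist v x"
    using fdist_affine_comb fdist_vertex by (simp add: less_imp_le)
next
  assume *: "\<forall>v\<in>C. 0 \<le> fdist v x"
  obtain u where u: "sum u C = 1" "x = (\<Sum>w\<in>C. u w *\<^sub>R w)"
    "\<And>v. v \<in> C \<Longrightarrow> fdist v x = u v * fdist v v"
    using affine_comb_exists[of x] by blast
  then have "0 \<le> u v" if "v \<in> C" for v
    using * that fdist_vertex[OF that] by (auto simp: zero_le_mult_iff)
  with u(1,2) show "x \<in> convex hull C"
    unfolding convex_hull_finite[OF finite_C] by auto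
qed

lemma fdist_opposite: "v \<in> C \<Longrightarrow> w \<in> C - {v} \<Longrightarrow> fdist v w = 0"
  using opposite by (auto simp: fdist_def)

lemma affine_hull_facet:
  assumes v: "v \<in> C"
  shows "affine hull (C - {v}) = {x. n v \<bullet> x + c v = 0}"
proof
  have "affine {x. n v \<bullet> x = - c v}" by (rule affine_hyperplane)
  moreover have "C - {v} \<subseteq> {x. n v \<bullet> x = - c v}"
    using fdist_opposite[OF v] by (force simp: fdist_def)
  ultimately have "affine hull (C - {v}) \<subseteq> {x. n v \<bullet> x = - c v}"
    by (rule hull_minimal[rotated])
  then show "affine hull (C - {v}) \<subseteq> {x. n v \<bullet> x + c v = 0}" by auto
next
  show "{x. n v \<bullet> x + c v = 0} \<subseteq> affine hull (C - {v})"
  proof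
    fix x assume x: "x \<in> {x. n v \<bullet> x + c v = 0}"
    obtain u where u: "sum u C = 1" "x = (\<Sum>w\<in>C. u w *\<^sub>R w)"
      "\<And>v. v \<in> C \<Longrightarrow> fdist v x = u v * fdist v v"
      using affine_comb_exists[of x] by blast
    then have "u v = 0" using x fdist_vertex[OF v] u(3)[OF v] by (simp add: fdist_def)
    then have "sum u (C - {v}) = 1" "x = (\<Sum>w\<in>C - {v}. u w *\<^sub>R w)"
      using u(1,2) v finite_C by (simp_all add: sum.remove[of C v])
    then show "x \<in> affine hull (C - {v})"
      using finite_C by (subst affine_hull_finite) auto
  qed
qed

lemma mem_facet_iff:
  assumes v: "v \<in> C"
  shows "x \<in> convex hull (C - {v}) \<longleftrightarrow> fdist v x = 0 \<and> (\<forall>w\<in>C. 0 \<le> fdist w x)"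
proof
  assume x: "x \<in> convex hull (C - {v})"
  then have "x \<in> affine hull (C - {v})" using convex_hull_subset_affine_hull by blast
  moreover have "x \<in> convex hull C" using x hull_mono[of "C - {v}" C] by blast
  ultimately show "fdist v x = 0 \<and> (\<forall>w\<in>C. 0 \<le> fdist w x)"
    using mem_hull_iff affine_hull_facet[OF v] by (simp add: fdist_def)
next
  assume *: "fdist v x = 0 \<and> (\<forall>w\<in>C. 0 \<le> fdist w x)"
  obtain u where u: "sum u C = 1" "x = (\<Sum>w\<in>C. u w *\<^sub>R w)"
    "\<And>v. v \<in> C \<Longrightarrow> fdist v x = u v * fdist v v"
    using affine_comb_exists[of x] by blast
  then have "u v = 0" using * fdist_vertex[OF v] u(3)[OF v] by simp
  then have "sum u (C - {v}) = 1" "x = (\<Sum>w\<in>C - {v}. u w *\<^sub>R w)"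
    using u(1,2) v finite_C by (simp_all add: sum.remove[of C v])
  moreover have "0 \<le> u w" if "w \<in> C" for w
    using * that fdist_vertex[OF that] u(3)[OF that] by (auto simp: zero_le_mult_iff)
  ultimately show "x \<in> convex hull (C - {v})"
    using finite_C by (subst convex_hull_finite) auto
qed

lemma fdist_add: "fdist v (x + y) = fdist v x + n v \<bullet> y"
  by (simp add: fdist_def inner_add_right)

lemma n_inner_n: "v \<in> C \<Longrightarrow> n v \<bullet> n v = 1"
  using norm_n by (simp add: power2_norm_eq_inner[symmetric])

lemma continuous_fdist: "continuous_on A (fdist v)"
  unfolding fdist_def[abs_def] by (intro continuous_intros)

lemma interior_hull: "interior (convex hull C) = {x. \<forall>v\<in>C. 0 < fdist v x}"
proof
  have "open (\<Inter>v\<in>C. {x. 0 < fdist v x})"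
    using finite_C by (intro open_INT ballI open_Collect_less continuous_fdist continuous_on_const)
  moreover have "(\<Inter>v\<in>C. {x. 0 < fdist v x}) = {x. \<forall>v\<in>C. 0 < fdist v x}" by auto
  ultimately show "{x. \<forall>v\<in>C. 0 < fdist v x} \<subseteq> interior (convex hull C)"
    using mem_hull_iff by (intro interior_maximal) (auto simp: less_imp_le)
next
  show "interior (convex hull C) \<subseteq> {x. \<forall>v\<in>C. 0 < fdist v x}"
  proof clarify
    fix x v assume x: "x \<in> interior (convex hull C)" and v: "v \<in> C"
    from x obtain e where e: "0 < e" "ball x e \<subseteq> convex hull C"
      unfolding mem_interior by blast
    \<comment> \<open>A move against the inward unit normal lowers \<open>fdist v\<close> by exactly
      its length, so positivity is left over at \<open>x\<close>.\<close>
    have "x + (- (e/2)) *\<^sub>R n v \<in> ball x e"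
      using e(1) norm_n[OF v] by (simp add: dist_norm)
    then have "0 \<le> fdist v (x + (- (e/2)) *\<^sub>R n v)"
      using e(2) v mem_hull_iff by blast
    then show "0 < fdist v x"
      unfolding fdist_add using e(1) by (simp add: n_inner_n[OF v])
  qed
qed

lemma fdist_fproj: "v \<in> C \<Longrightarrow> fdist v (fproj v x) = 0"
  using n_inner_n[of v] by (simp add: fproj_def fdist_def inner_diff_right)

lemma compact_hull: "compact (convex hull C)"
  by (rule finite_imp_compact_convex_hull[OF finite_C])

lemma negligible_fdist_level:
  assumes "v \<in> C" shows "negligible {x. fdist v x = t}"
proof -
  have "{x. fdist v x = t} = {x. n v \<bullet> x = t - c v}" by (auto simp: fdist_def)
  moreover have "n v \<noteq> 0" using norm_n[OF assms] by auto
  ultimately show ?thesis by (simp add: negligible_hyperplane)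
qed

text \<open>The function is affine in \<open>x\<close> with gradient \<open>?g\<close>. A zero
  gradient would make it constant, but it is positive at \<open>w\<close> and 0 at a third vertex
  \<open>z\<close>, both of which are fixed by \<open>fproj v\<close>. Dimension at least 2 provides
  \<open>z\<close>.\<close>

lemma negligible_fdist_fproj:
  assumes dim: "2 \<le> DIM('a)" and v: "v \<in> C" and w: "w \<in> C" "w \<noteq> v"
  shows "negligible {x. fdist w (fproj v x) = 0}"
proof -
  let ?g = "n w - (n w \<bullet> n v) *\<^sub>R n v"
  have eq: "fdist w (fproj v x) = ?g \<bullet> x + (c w - c v * (n w \<bullet> n v))" for x
    by (simp add: fproj_def fdist_def inner_diff_left inner_diff_right algebra_simps)
  have "?g \<noteq> 0"
  proof
    assume "?g = 0"
    then have const: "fdist w (fproj v x) = fdist w (fproj v y)" for x y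
      by (simp add: eq)
    have "\<not> C \<subseteq> {v, w}"
      using card dim card_mono[of "{v, w}" C] w by auto
    then obtain z where z: "z \<in> C" "z \<noteq> v" "z \<noteq> w" by auto
    have "fproj v w = w" "fproj v z = z"
      using fdist_opposite[OF v] z w by (auto simp: fproj_def)
    then have "fdist w w = fdist w z" using const[of w z] by simp
    then show False using fdist_vertex[OF w(1)] fdist_opposite[OF w(1), of z] z by auto
  qed
  moreover have "{x. fdist w (fproj v x) = 0} = {x. ?g \<bullet> x = - (c w - c v * (n w \<bullet> n v))}"
    unfolding eq by auto
  ultimately show ?thesis by (simp only: negligible_hyperplane simp_thms)
qed

lemma fdist_measurable[measurable]: "fdist v \<in> borel_measurable borel"
  by (rule borel_measurable_continuous_onI[OF continuous_fdist])

lemma fproj_measurable[measurable]: "fproj v \<in> borel_measurable borel"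
  unfolding fproj_def[abs_def] by measurable

lemma compact_facet: "compact (convex hull (C - {v}))"
  using finite_C by (intro finite_imp_compact_convex_hull) auto

lemma facet_sets_borel[measurable]: "convex hull (C - {v}) \<in> sets borel"
  by (rule borel_compact[OF compact_facet])

definition cutoff :: "real \<Rightarrow> 'a \<Rightarrow> real" where
  "cutoff N x = (\<Prod>v\<in>C. clamp01 (N * fdist v x))"

lemma cutoff_bounds: "0 \<le> cutoff N x" "cutoff N x \<le> 1"
  unfolding cutoff_def by (auto intro!: prod_nonneg prod_le_1 clamp01_bounds)

lemma cutoff_eq_0: "0 < N \<Longrightarrow> x \<notin> convex hull C \<Longrightarrow> cutoff N x = 0"
proof -
  assume "0 < N" "x \<notin> convex hull C"
  then obtain v where "v \<in> C" "fdist v x < 0" using mem_hull_iff by (auto simp: not_le)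
  then have "v \<in> C" "clamp01 (N * fdist v x) = 0"
    using \<open>0 < N\<close> by (auto intro!: clamp01_eq simp: mult_le_0_iff)
  then show ?thesis unfolding cutoff_def by (intro prod_zero finite_C) auto
qed

text \<open>A product of factors in [0,1] changes by at most the sum of the changes of its factors,
  and each \<open>fdist v\<close> has Lipschitz constant 1.\<close>

lemma cutoff_lipschitz:
  assumes "0 < N"
  shows "\<bar>cutoff N x - cutoff N y\<bar> \<le> (real (card C) * N) * norm (x - y)"
proof -
  have "\<bar>cutoff N x - cutoff N y\<bar> \<le> (\<Sum>v\<in>C. \<bar>clamp01 (N * fdist v x) - clamp01 (N * fdist v y)\<bar>)"
    unfolding cutoff_def real_norm_def[symmetric]
    by (rule norm_prod_diff) (auto simp: clamp01_bounds)
  also have "\<dots> \<le> (\<Sum>v\<in>C. N * norm (x - y))"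
  proof (rule sum_mono)
    fix v assume v: "v \<in> C"
    have "\<bar>clamp01 (N * fdist v x) - clamp01 (N * fdist v y)\<bar> \<le> \<bar>N * fdist v x - N * fdist v y\<bar>"
      by (rule clamp01_lipschitz)
    also have "\<dots> = N * \<bar>n v \<bullet> (x - y)\<bar>"
      using assms by (simp add: fdist_def inner_diff_right abs_mult flip: right_diff_distrib)
    also have "\<dots> \<le> N * norm (x - y)"
      using assms Cauchy_Schwarz_ineq2[of "n v" "x - y"] norm_n[OF v] by simp
    finally show "\<bar>clamp01 (N * fdist v x) - clamp01 (N * fdist v y)\<bar> \<le> N * norm (x - y)" .
  qed
  finally show ?thesis by simp
qed

lemma cutoff_measurable[measurable]: "cutoff N \<in> borel_measurable borel"
  unfolding cutoff_def[abs_def] fdist_def by measurable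

end

lemma simplex_obtain_nsimplex:
  assumes "int DIM('a) simplex (K :: 'a::euclidean_space set)"
  obtains C n c where "nsimplex C n c" "K = convex hull C"
proof -
  obtain C where C: "\<not> affine_dependent C" "int (card C) = int DIM('a) + 1" "K = convex hull C"
    using assms unfolding simplex_def by blast
  have ex: "\<exists>n c. norm n = 1 \<and> 0 < n \<bullet> v + c \<and> (\<forall>w\<in>C - {v}. n \<bullet> w + c = 0)" if v: "v \<in> C" for v
  proof -
    let ?H = "affine hull (C - {v})"
    \<comment> \<open>The foot of the altitude from \<open>v\<close>; normalising
      \<open>v - p\<close> yields the inward normal of the opposite facet.\<close>
    define p where "p = closest_point ?H v"
    have "card (C - {v}) = DIM('a)" using C(2) v by (simp add: card_Diff_singleton)
    then have "C - {v} \<noteq> {}" using DIM_positive[where 'a = 'a] by (metis card.empty less_irrefl)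
    then have ne: "?H \<noteq> {}" by simp
    have cl: "closed ?H" "convex ?H" by (simp_all add: closed_affine_hull affine_imp_convex)
    have pH: "p \<in> ?H" unfolding p_def by (rule closest_point_in_set[OF cl(1) ne])
    have "v \<notin> ?H" using C(1) v unfolding affine_dependent_def by blast
    then have nz: "v - p \<noteq> 0" using pH by auto
    have orth: "(v - p) \<bullet> (w - p) = 0" if w: "w \<in> ?H" for w
    proof -
      have "(v - p) \<bullet> (w - p) \<le> 0"
        unfolding p_def by (rule closest_point_dot[OF cl(2,1) w])
      \<comment> \<open>The reflection of \<open>w\<close> in \<open>p\<close> stays in the affine
        hull, which turns the inequality for closest points into an equality.\<close>
      moreover have "2 *\<^sub>R p + (-1) *\<^sub>R w \<in> ?H"
        using pH w by (intro mem_affine) (auto simp: affine_affine_hull)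
      then have "(v - p) \<bullet> ((2 *\<^sub>R p + (-1) *\<^sub>R w) - p) \<le> 0"
        unfolding p_def by (rule closest_point_dot[OF cl(2,1)])
      then have "(v - p) \<bullet> (p - w) \<le> 0" by (simp add: scaleR_2)
      ultimately show ?thesis by (simp add: inner_diff_right)
    qed
    define n where "n = (1 / norm (v - p)) *\<^sub>R (v - p)"
    have "norm n = 1" using nz by (simp add: n_def)
    moreover have "n \<bullet> v + (- (n \<bullet> p)) > 0"
    proof -
      have "n \<bullet> v - n \<bullet> p = (1 / norm (v - p)) * ((v - p) \<bullet> (v - p))"
        unfolding n_def inner_diff_right[symmetric] by simp
      then show ?thesis using nz by simp
    qed
    moreover have "n \<bullet> w + (- (n \<bullet> p)) = 0" if "w \<in> C - {v}" for w
    proof -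
      have "n \<bullet> (w - p) = 0"
        using orth[OF hull_inc[OF that]] by (simp add: n_def)
      then show ?thesis by (simp add: inner_diff_right)
    qed
    ultimately show ?thesis by blast
  qed
  then obtain n c where "\<And>v. v \<in> C \<Longrightarrow> norm (n v) = 1 \<and> 0 < n v \<bullet> v + c v \<and> (\<forall>w\<in>C - {v}. n v \<bullet> w + c v = 0)"
    by metis
  then have "nsimplex C n c"
    using C by unfold_locales auto
  then show ?thesis using that C(3) by blast
qed


section \<open>The divergence theorem on a simplex\<close>

context nsimplex begin

definition slab :: "real \<Rightarrow> 'a \<Rightarrow> 'a set" where
  "slab N v = {x. 0 \<le> fdist v x \<and> fdist v x < 1 / N}"

text \<open>On the slab of \<open>v\<close> only the \<open>v\<close>-th factor of the cutoff has
  slope \<open>N\<close>. The product rule term of w . grad (cutoff) that belongs to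
  \<open>v\<close> is therefore \<open>N * indicator (slab N v) x * flux w N v x\<close>.\<close>

definition flux :: "('a \<Rightarrow> 'a) \<Rightarrow> real \<Rightarrow> 'a \<Rightarrow> 'a \<Rightarrow> real" where
  "flux w N v x = (\<Prod>u\<in>C - {v}. clamp01 (N * fdist u x)) * (n v \<bullet> w x)"

lemma slab_measurable[measurable]: "slab N v \<in> sets borel"
  unfolding slab_def fdist_def by measurable

text \<open>The excluded levels 0 and \<open>1 / N\<close> are the kinks of
  \<open>clamp01\<close>.\<close>

lemma cutoff_deriv:
  assumes N: "0 < N" and x: "\<And>v. v \<in> C \<Longrightarrow> fdist v x \<noteq> 0 \<and> fdist v x \<noteq> 1 / N"
  shows "((\<lambda>t. cutoff N (x + t *\<^sub>R i)) has_real_derivative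
    (\<Sum>v\<in>C. N * indicator (slab N v) x * (n v \<bullet> i) * (\<Prod>u\<in>C - {v}. clamp01 (N * fdist u x)))) (at 0)"
proof -
  have "((\<lambda>t. clamp01 (N * fdist v (x + t *\<^sub>R i))) has_derivative
      (\<lambda>y. y * (N * indicator (slab N v) x * (n v \<bullet> i)))) (at 0)" if v: "v \<in> C" for v
  proof -
    have "((\<lambda>t. N * fdist v (x + t *\<^sub>R i)) has_real_derivative (N * (n v \<bullet> i))) (at 0)"
      unfolding fdist_add by (auto intro!: derivative_eq_intros)
    moreover have "N * fdist v x \<noteq> 0" "N * fdist v x \<noteq> 1"
      using x[OF v] N by (auto simp: field_simps)
    then have "(clamp01 has_real_derivative (if 0 < N * fdist v x \<and> N * fdist v x < 1 then 1 else 0))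
        (at (N * fdist v (x + 0 *\<^sub>R i)))"
      using clamp01_deriv by simp
    ultimately have "((\<lambda>t. clamp01 (N * fdist v (x + t *\<^sub>R i))) has_real_derivative
        ((if 0 < N * fdist v x \<and> N * fdist v x < 1 then 1 else 0) * (N * (n v \<bullet> i)))) (at 0)"
      by (rule DERIV_chain2[rotated])
    moreover have "(0 < N * fdist v x \<and> N * fdist v x < 1) \<longleftrightarrow> x \<in> slab N v"
      using x[OF v] N by (auto simp: slab_def field_simps zero_less_mult_iff)
    ultimately show ?thesis
      unfolding has_field_derivative_def
      by (elim has_derivative_eq_rhs) (auto simp: fun_eq_iff indicator_def)
  qed
  then have "((\<lambda>t. cutoff N (x + t *\<^sub>R i)) has_derivative
      (\<lambda>y. \<Sum>v\<in>C. (y * (N * indicator (slab N v) x * (n v \<bullet> i))) *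
        (\<Prod>u\<in>C - {v}. clamp01 (N * fdist u (x + 0 *\<^sub>R i))))) (at 0)"
    unfolding cutoff_def by (rule has_derivative_prod)
  then show ?thesis
    unfolding has_field_derivative_def
    by (rule has_derivative_eq_rhs) (simp add: sum_distrib_left fun_eq_iff mult_ac)
qed

lemma prod_clamp01_bounds:
  "0 \<le> (\<Prod>u\<in>A. clamp01 (N * fdist u x))" "(\<Prod>u\<in>A. clamp01 (N * fdist u x)) \<le> 1"
  by (auto intro!: prod_nonneg prod_le_1 clamp01_bounds)

text \<open>A point outside the simplex has a negative signed distance: either for \<open>v\<close>,
  and it misses the slab, or for another vertex, and a factor of the flux is 0.\<close>

lemma slab_flux_support:
  assumes N: "0 < N" and v: "v \<in> C" and x: "x \<notin> convex hull C"
  shows "indicator (slab N v) x * flux w N v x = 0"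
proof (cases "0 \<le> fdist v x")
  case True
  with x obtain u where u: "u \<in> C - {v}" "fdist u x < 0"
    using mem_hull_iff by (force simp: not_le)
  then have "\<exists>u\<in>C - {v}. clamp01 (N * fdist u x) = 0"
    using N by (intro bexI[of _ u] clamp01_eq) (auto simp: mult_le_0_iff)
  then have "flux w N v x = 0"
    unfolding flux_def using finite_C by (simp add: prod_zero)
  then show ?thesis by simp
qed (simp add: slab_def)

lemma slab_flux_bound:
  assumes N: "0 < N" and v: "v \<in> C" and M: "\<And>x. x \<in> convex hull C \<Longrightarrow> norm (w x) \<le> M"
  shows "\<bar>indicator (slab N v) x * flux w N v x\<bar> \<le> \<bar>M\<bar>"
proof (cases "x \<in> convex hull C")
  case True
  have "\<bar>n v \<bullet> w x\<bar> \<le> norm (w x)"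
    using Cauchy_Schwarz_ineq2[of "n v" "w x"] norm_n[OF v] by simp
  also have "\<dots> \<le> \<bar>M\<bar>" using M[OF True] by simp
  finally have "\<bar>flux w N v x\<bar> \<le> 1 * \<bar>M\<bar>"
    unfolding flux_def abs_mult using prod_clamp01_bounds
    by (intro mult_mono) auto
  then show ?thesis by (simp add: indicator_def)
qed (simp add: slab_flux_support[OF N v])

lemma flux_measurable:
  assumes [measurable]: "w \<in> borel_measurable borel"
  shows "flux w N v \<in> borel_measurable borel"
  unfolding flux_def[abs_def] fdist_def by measurable

lemma integrable_slab_flux:
  assumes N: "0 < N" and v: "v \<in> C" and w: "continuous_on UNIV w"
  shows "integrable lborel (\<lambda>x. indicator (slab N v) x * flux w N v x)"
proof -
  have [measurable]: "flux w N v \<in> borel_measurable borel"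
    using w by (intro flux_measurable borel_measurable_continuous_onI)
  have "compact (w ` (convex hull C))"
    using w compact_hull by (metis compact_continuous_image continuous_on_subset subset_UNIV)
  then obtain M where M: "\<And>x. x \<in> convex hull C \<Longrightarrow> norm (w x) \<le> M"
    using compact_imp_bounded[of "w ` (convex hull C)"] by (auto simp: bounded_iff)
  obtain R where R: "\<And>x. x \<in> convex hull C \<Longrightarrow> norm x \<le> R"
    using compact_imp_bounded[OF compact_hull] unfolding bounded_iff by blast
  show ?thesis
  proof (rule integrable_bounded_support)
    show "(\<lambda>x. indicator (slab N v) x * flux w N v x) \<in> borel_measurable borel"
      by measurable
    show "\<bar>indicator (slab N v) x * flux w N v x\<bar> \<le> \<bar>M\<bar>" for x
      using slab_flux_bound[OF N v, of w M x] M by simp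
    show "indicator (slab N v) x * flux w N v x = 0" if "R < norm x" for x
      using that R[of x] slab_flux_support[OF N v] by fastforce
  qed
qed

text \<open>\<open>h\<close> is controlled only on the compact convex simplex, where its gradient is
  bounded. The product still has a global constant: the splitting evaluates \<open>h\<close> at a
  point inside, and the factor \<open>cutoff N y\<close> removes the other summand when
  \<open>y\<close> is outside.\<close>

lemma cutoff_product_lipschitz:
  assumes N: "0 < N" and h: "\<And>x. GDERIV h x :> g x" and g: "continuous_on UNIV g"
  shows "\<exists>L. \<forall>x y. \<bar>cutoff N x * h x - cutoff N y * h y\<bar> \<le> L * norm (x - y)"
proof -
  let ?K = "convex hull C"
  have hd: "(h has_derivative (\<lambda>e. e \<bullet> g x)) (at x)" for x
    using h by (simp add: gderiv_def)
  have ch: "continuous_on ?K h"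
    using hd by (meson continuous_at_imp_continuous_on has_derivative_continuous)
  obtain M where M: "\<And>x. x \<in> ?K \<Longrightarrow> \<bar>h x\<bar> \<le> M"
    using compact_imp_bounded[OF compact_continuous_image[OF ch compact_hull]]
    unfolding bounded_iff by fastforce
  have cg: "continuous_on ?K g" using g continuous_on_subset by blast
  obtain B where B: "\<And>x. x \<in> ?K \<Longrightarrow> norm (g x) \<le> B"
    using compact_imp_bounded[OF compact_continuous_image[OF cg compact_hull]]
    unfolding bounded_iff by fastforce
  have lip: "\<bar>h x - h y\<bar> \<le> \<bar>B\<bar> * norm (x - y)" if "x \<in> ?K" "y \<in> ?K" for x y
  proof -
    have "norm (h x - h y) \<le> \<bar>B\<bar> * norm (x - y)"
    proof (rule differentiable_bound[of ?K h "\<lambda>x e. e \<bullet> g x"])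
      show "(h has_derivative (\<lambda>e. e \<bullet> g x)) (at x within ?K)" for x
        using hd has_derivative_at_withinI by blast
      show "onorm (\<lambda>e. e \<bullet> g x) \<le> \<bar>B\<bar>" if "x \<in> ?K" for x
      proof (rule onorm_le)
        fix e
        have "norm (e \<bullet> g x) \<le> norm e * norm (g x)" by (simp add: Cauchy_Schwarz_ineq2)
        also have "\<dots> \<le> norm e * \<bar>B\<bar>" using B[OF that] by (intro mult_left_mono) auto
        finally show "norm (e \<bullet> g x) \<le> \<bar>B\<bar> * norm e" by (simp add: mult.commute)
      qed
    qed (use that in auto)
    then show ?thesis by simp
  qed
  define L where "L = real (card C) * N * \<bar>M\<bar> + \<bar>B\<bar>"
  have main: "\<bar>cutoff N x * h x - cutoff N y * h y\<bar> \<le> L * norm (x - y)" if x: "x \<in> ?K" for x y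
  proof -
    have eq: "cutoff N x * h x - cutoff N y * h y =
        (cutoff N x - cutoff N y) * h x + cutoff N y * (h x - h y)"
      by (simp add: algebra_simps)
    have "\<bar>(cutoff N x - cutoff N y) * h x\<bar> \<le> (real (card C) * N * norm (x - y)) * \<bar>M\<bar>"
      unfolding abs_mult using cutoff_lipschitz[OF N, of x y] M[OF x] by (intro mult_mono) auto
    moreover have "\<bar>cutoff N y * (h x - h y)\<bar> \<le> \<bar>B\<bar> * norm (x - y)"
    proof (cases "y \<in> ?K")
      case True
      have "\<bar>cutoff N y * (h x - h y)\<bar> \<le> 1 * (\<bar>B\<bar> * norm (x - y))"
        unfolding abs_mult using lip[OF x True] cutoff_bounds[of N y] by (intro mult_mono) auto
      then show ?thesis by simp
    qed (simp add: cutoff_eq_0[OF N])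
    ultimately show ?thesis unfolding eq L_def
      by (simp add: algebra_simps)
  qed
  have "\<bar>cutoff N x * h x - cutoff N y * h y\<bar> \<le> L * norm (x - y)" for x y
  proof (cases "x \<in> ?K")
    case False
    show ?thesis
    proof (cases "y \<in> ?K")
      case True
      from main[OF this, of x] show ?thesis by (simp add: abs_minus_commute norm_minus_commute)
    next
      case y: False
      have "0 \<le> L" unfolding L_def using N by simp
      then show ?thesis by (simp add: cutoff_eq_0[OF N] False y)
    qed
  qed (rule main)
  then show ?thesis by blast
qed

text \<open>For each basis vector \<open>i\<close>, the derivative in direction \<open>i\<close> of
  the compactly supported function \<open>cutoff N x * (w x \<bullet> i)\<close> has integral 0.
  Summation over \<open>i\<close> gives the divergence weighted with the cutoff plus the slab
  terms.\<close>

lemma integral_cutoff_divergence: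
  assumes N: "0 < N"
    and der: "\<And>i x. i \<in> Basis \<Longrightarrow> GDERIV (\<lambda>x. w x \<bullet> i) x :> G i x"
    and cont: "\<And>i. i \<in> Basis \<Longrightarrow> continuous_on UNIV (G i)"
    and w: "continuous_on UNIV w"
  shows "(LINT x|lborel. cutoff N x * (\<Sum>i\<in>Basis. G i x \<bullet> i)) =
    - (\<Sum>v\<in>C. N * (LINT x|lborel. indicator (slab N v) x * flux w N v x))"
proof -
  let ?K = "convex hull C"
  obtain R where R: "\<And>x. x \<in> ?K \<Longrightarrow> norm x \<le> R"
    using compact_imp_bounded[OF compact_hull] unfolding bounded_iff by blast
  \<comment> \<open>Finitely many hyperplanes that contain all kinks of the cutoff.\<close>
  define Z where "Z = (\<Union>v\<in>C. {x. fdist v x = 0} \<union> {x. fdist v x = 1 / N})"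
  have Z: "negligible Z"
    unfolding Z_def using finite_C
    by (intro negligible_Union[OF finite_imageI]) (auto intro: negligible_Un negligible_fdist_level)
  define D where "D i x = cutoff N x * (G i x \<bullet> i) +
      (\<Sum>v\<in>C. N * indicator (slab N v) x * (n v \<bullet> i) * (\<Prod>u\<in>C - {v}. clamp01 (N * fdist u x))) * (w x \<bullet> i)" for i x
  have int_D: "integrable lebesgue (D i)" "(LINT x|lebesgue. D i x) = 0" if i: "i \<in> Basis" for i
  proof -
    obtain L where L: "\<And>x y. \<bar>cutoff N x * (w x \<bullet> i) - cutoff N y * (w y \<bullet> i)\<bar> \<le> L * norm (x - y)"
      using cutoff_product_lipschitz[OF N der[OF i] cont[OF i]] by blast
    have supp: "cutoff N x * (w x \<bullet> i) = 0" if "R < norm x" for x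
      using that R[of x] cutoff_eq_0[OF N, of x] by fastforce
    have dv: "((\<lambda>t. cutoff N (x + t *\<^sub>R i) * (w (x + t *\<^sub>R i) \<bullet> i)) has_real_derivative D i x) (at 0)"
      if x: "x \<notin> Z" for x
    proof -
      have "fdist v x \<noteq> 0 \<and> fdist v x \<noteq> 1 / N" if "v \<in> C" for v
        using x that by (auto simp: Z_def)
      note 1 = cutoff_deriv[OF N this, where i = i]
      have "((\<lambda>y. w y \<bullet> i) has_derivative (\<lambda>h. h \<bullet> G i x)) (at (x + 0 *\<^sub>R i))"
        using der[OF i, of x] by (simp add: gderiv_def)
      moreover have "((\<lambda>t. x + t *\<^sub>R i) has_derivative (\<lambda>t. t *\<^sub>R i)) (at 0)"
        by (auto intro!: derivative_eq_intros)
      ultimately have "((\<lambda>t. w (x + t *\<^sub>R i) \<bullet> i) has_derivative (\<lambda>t. (t *\<^sub>R i) \<bullet> G i x)) (at 0)"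
        by (rule has_derivative_compose[rotated])
      then have 2: "((\<lambda>t. w (x + t *\<^sub>R i) \<bullet> i) has_real_derivative (G i x \<bullet> i)) (at 0)"
        unfolding has_field_derivative_def
        by (rule has_derivative_eq_rhs) (simp add: fun_eq_iff inner_commute)
      show ?thesis
        using DERIV_mult'[OF 1 2] unfolding D_def by simp
    qed
    show "integrable lebesgue (D i)" "(LINT x|lebesgue. D i x) = 0"
      using integral_directional_derivative_eq_0[OF L supp Z dv] by blast+
  qed
  have sumD: "(\<Sum>i\<in>Basis. D i x) = cutoff N x * (\<Sum>i\<in>Basis. G i x \<bullet> i) +
      (\<Sum>v\<in>C. N * (indicator (slab N v) x * flux w N v x))" for x
  proof -
    have "(\<Sum>i\<in>Basis. (\<Sum>v\<in>C. N * indicator (slab N v) x * (n v \<bullet> i) * (\<Prod>u\<in>C - {v}. clamp01 (N * fdist u x))) * (w x \<bullet> i)) =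
       (\<Sum>v\<in>C. \<Sum>i\<in>Basis. N * indicator (slab N v) x * (n v \<bullet> i) * (\<Prod>u\<in>C - {v}. clamp01 (N * fdist u x)) * (w x \<bullet> i))"
      unfolding sum_distrib_right by (rule sum.swap)
    also have "\<dots> = (\<Sum>v\<in>C. N * (indicator (slab N v) x * flux w N v x))"
      unfolding flux_def euclidean_inner[of "n _" "w x"]
      by (simp add: sum_distrib_left sum_distrib_right mult_ac)
    finally show ?thesis
      unfolding D_def by (simp add: sum.distrib sum_distrib_left)
  qed
  have f_int: "integrable lborel (\<lambda>x. N * (indicator (slab N v) x * flux w N v x))" if "v \<in> C" for v
    using integrable_slab_flux[OF N that w] by simp
  have f_int': "integrable lborel (\<lambda>x. \<Sum>v\<in>C. N * (indicator (slab N v) x * flux w N v x))"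
    using f_int by (intro Bochner_Integration.integrable_sum) auto
  have cd: "continuous_on UNIV (\<lambda>x. \<Sum>i\<in>Basis. G i x \<bullet> i)"
    using cont by (intro continuous_intros) auto
  have [measurable]: "(\<lambda>x. \<Sum>i\<in>Basis. G i x \<bullet> i) \<in> borel_measurable borel"
    by (rule borel_measurable_continuous_onI[OF cd])
  have meas: "(\<lambda>x. cutoff N x * (\<Sum>i\<in>Basis. G i x \<bullet> i)) \<in> borel_measurable borel"
    by measurable
  have tot: "integrable lebesgue (\<lambda>x. \<Sum>i\<in>Basis. D i x)" "(LINT x|lebesgue. (\<Sum>i\<in>Basis. D i x)) = 0"
    using int_D by (auto simp: Bochner_Integration.integral_sum)
  have f_int2: "integrable lebesgue (\<lambda>x. \<Sum>v\<in>C. N * (indicator (slab N v) x * flux w N v x))"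
    using f_int' by (simp add: integrable_completion borel_measurable_integrable)
  have c_int: "integrable lebesgue (\<lambda>x. cutoff N x * (\<Sum>i\<in>Basis. G i x \<bullet> i))"
    using Bochner_Integration.integrable_diff[OF tot(1) f_int2] unfolding sumD by simp
  have "0 = (LINT x|lebesgue. cutoff N x * (\<Sum>i\<in>Basis. G i x \<bullet> i)) +
      (LINT x|lebesgue. (\<Sum>v\<in>C. N * (indicator (slab N v) x * flux w N v x)))"
    using tot(2) unfolding sumD Bochner_Integration.integral_add[OF c_int f_int2] by simp
  also have "(LINT x|lebesgue. (\<Sum>v\<in>C. N * (indicator (slab N v) x * flux w N v x))) =
      (LINT x|lborel. (\<Sum>v\<in>C. N * (indicator (slab N v) x * flux w N v x)))"
    using f_int' by (intro integral_completion borel_measurable_integrable)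
  also have "\<dots> = (\<Sum>v\<in>C. N * (LINT x|lborel. indicator (slab N v) x * flux w N v x))"
    using f_int by (subst Bochner_Integration.integral_sum) auto
  finally show ?thesis using meas by (simp add: integral_completion)
qed

text \<open>After folding, the flux is evaluated at a point less than
  \<open>1 / real (Suc k)\<close> away from the hyperplane, and this point converges to
  \<open>fproj v x\<close>. The remaining cutoff factors converge to the indicator of the facet at
  \<open>fproj v x\<close>, so the limit domain is the unit prism.\<close>

lemma slab_flux_tendsto:
  assumes dim: "2 \<le> DIM('a)" and v: "v \<in> C" and w: "continuous_on UNIV w"
  shows "(\<lambda>k. real (Suc k) * (LINT x|lborel. indicator (slab (real (Suc k)) v) x * flux w (real (Suc k)) v x))
    \<longlonglongrightarrow> (LINT x|lborel. indicator {x. 0 \<le> fdist v x \<and> fdist v x \<le> 1 \<and> fproj v x \<in> convex hull (C - {v})} x *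
          (n v \<bullet> w (fproj v x)))" (is "_ \<longlonglongrightarrow> (LINT x|lborel. ?L x)")
proof -
  define shift where
    "shift k x = x - (of_int \<lfloor>real (Suc k) * fdist v x\<rfloor> / real (Suc k)) *\<^sub>R n v" for k x
  define F where
    "F k x = indicator {x. 0 \<le> fdist v x \<and> fdist v x < 1} x * flux w (real (Suc k)) v (shift k x)" for k x
  have [measurable]: "w \<in> borel_measurable borel"
    using w by (rule borel_measurable_continuous_onI)
  have [measurable]: "flux w N v \<in> borel_measurable borel" for N
    by (rule flux_measurable) measurable
  have [measurable]: "F k \<in> borel_measurable borel" for k
    unfolding F_def[abs_def] shift_def[abs_def] by measurable
  have L_meas: "?L \<in> borel_measurable lborel"
    by measurable
  have fold: "real (Suc k) * (LINT x|lborel. indicator (slab (real (Suc k)) v) x * flux w (real (Suc k)) v x) =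
      (LINT x|lborel. F k x)" for k
  proof -
    have "integrable lborel (\<lambda>x. indicator (slab (real (Suc k)) v) x * flux w (real (Suc k)) v x)"
      by (rule integrable_slab_flux[OF _ v w]) simp
    then show ?thesis
      using integral_slab_fold[OF norm_n[OF v], of "Suc k" "flux w (real (Suc k)) v" "c v"]
      by (simp only: slab_def F_def shift_def fdist_def) simp
  qed
  have "compact (w ` (convex hull C))"
    using w compact_hull by (metis compact_continuous_image continuous_on_subset subset_UNIV)
  then obtain M where M: "\<And>x. x \<in> convex hull C \<Longrightarrow> norm (w x) \<le> M"
    using compact_imp_bounded[of "w ` (convex hull C)"] by (auto simp: bounded_iff)
  obtain R where R: "\<And>x. x \<in> convex hull C \<Longrightarrow> norm x \<le> R"
    using compact_imp_bounded[OF compact_hull] unfolding bounded_iff by blast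
  \<comment> \<open>The flux vanishes off the simplex, which lies within radius \<open>R\<close>,
    and folding moves a point by at most 1; hence the radius \<open>R + 1\<close>.\<close>
  have bound: "norm (F k x) \<le> indicator (cball 0 (R + 1)) x * \<bar>M\<bar>" for k x
  proof (cases "0 \<le> fdist v x \<and> fdist v x < 1")
    case True
    define q where "q = of_int \<lfloor>real (Suc k) * fdist v x\<rfloor> / real (Suc k)"
    have q: "0 \<le> q" "q \<le> fdist v x" "fdist v x - q < 1 / real (Suc k)"
    proof -
      have "0 \<le> real (Suc k) * fdist v x" using True by simp
      then show "0 \<le> q" unfolding q_def by (simp del: of_nat_Suc)
      have "of_int \<lfloor>real (Suc k) * fdist v x\<rfloor> \<le> fdist v x * real (Suc k)" by (simp add: mult.commute)
      then show "q \<le> fdist v x" unfolding q_def by (subst pos_divide_le_eq) auto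
      have "real (Suc k) * fdist v x - of_int \<lfloor>real (Suc k) * fdist v x\<rfloor> < 1" by linarith
      then have "(real (Suc k) * fdist v x - of_int \<lfloor>real (Suc k) * fdist v x\<rfloor>) / real (Suc k) < 1 / real (Suc k)"
        by (rule divide_strict_right_mono) simp
      then show "fdist v x - q < 1 / real (Suc k)"
        unfolding q_def by (simp add: diff_divide_distrib del: of_nat_Suc)
    qed
    have "fdist v (shift k x) = fdist v x - q"
      using n_inner_n[OF v] by (simp add: shift_def q_def fdist_def inner_diff_right)
    then have slab: "shift k x \<in> slab (real (Suc k)) v"
      using q by (simp add: slab_def)
    have "x - shift k x = q *\<^sub>R n v"
      unfolding shift_def q_def by simp
    then have "norm (x - shift k x) \<le> 1"
      using q True norm_n[OF v] by simp
    then have "norm x \<le> norm (shift k x) + 1"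
      using norm_triangle_ineq2[of x "shift k x"] by simp
    moreover have "\<bar>flux w (real (Suc k)) v (shift k x)\<bar> \<le> \<bar>M\<bar>"
      using slab_flux_bound[of "real (Suc k)" v w M "shift k x"] M v slab by simp
    moreover have "flux w (real (Suc k)) v (shift k x) = 0" if "R < norm (shift k x)"
      using slab_flux_support[of "real (Suc k)" v "shift k x" w, OF _ v] R[of "shift k x"] that slab by fastforce
    ultimately show ?thesis
      unfolding F_def by (auto simp: indicator_def not_le)
  qed (simp add: F_def)
  \<comment> \<open>Excluded are the points whose projection makes a cutoff factor ambiguous in the
    limit, and the top level 1, where the folded slab is half-open but the prism is closed.\<close>
  define Z where "Z = (\<Union>u\<in>C - {v}. {x. fdist u (fproj v x) = 0}) \<union> {x. fdist v x = 1}"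
  have "negligible Z"
    unfolding Z_def using finite_C
    by (intro negligible_Un negligible_Union negligible_fdist_level[OF v])
      (auto intro: negligible_fdist_fproj[OF dim v])
  then have AE_Z: "AE x in lborel. x \<notin> Z" by (rule AE_lborel_negligible)
  have lim: "(\<lambda>k. F k x) \<longlonglongrightarrow> ?L x" if x: "x \<notin> Z" for x
  proof -
    have sh: "(\<lambda>k. shift k x) \<longlonglongrightarrow> fproj v x"
      unfolding shift_def fproj_def by (intro tendsto_intros floor_scaled_tendsto)
    have fd: "(\<lambda>k. fdist u (shift k x)) \<longlonglongrightarrow> fdist u (fproj v x)" for u
      unfolding fdist_def by (intro tendsto_intros sh)
    have "isCont w (fproj v x)" using w by (simp add: continuous_on_eq_continuous_at)
    then have ww: "(\<lambda>k. w (shift k x)) \<longlonglongrightarrow> w (fproj v x)"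
      using sh by (rule isCont_tendsto_compose)
    have "(\<lambda>k. flux w (real (Suc k)) v (shift k x)) \<longlonglongrightarrow>
        (\<Prod>u\<in>C - {v}. if 0 < fdist u (fproj v x) then 1 else 0) * (n v \<bullet> w (fproj v x))"
      unfolding flux_def
      by (intro tendsto_intros ww clamp01_scaled_tendsto fd) (use x in \<open>auto simp: Z_def\<close>)
    then have lim: "(\<lambda>k. F k x) \<longlonglongrightarrow> indicator {x. 0 \<le> fdist v x \<and> fdist v x < 1} x *
        ((\<Prod>u\<in>C - {v}. if 0 < fdist u (fproj v x) then 1 else 0) * (n v \<bullet> w (fproj v x)))"
      unfolding F_def by (intro tendsto_mult tendsto_const)
    have "(\<Prod>u\<in>C - {v}. if 0 < fdist u (fproj v x) then 1 else 0::real) =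
        (if \<forall>u\<in>C - {v}. 0 < fdist u (fproj v x) then 1 else 0)"
      using finite_C by (auto intro!: prod_zero)
    moreover have "(\<forall>u\<in>C - {v}. 0 < fdist u (fproj v x)) \<longleftrightarrow> fproj v x \<in> convex hull (C - {v})"
      unfolding mem_facet_iff[OF v] using x fdist_fproj[OF v, of x]
      by (force simp: Z_def less_le)
    moreover have "fdist v x \<noteq> 1" using x by (simp add: Z_def)
    ultimately have "indicator {x. 0 \<le> fdist v x \<and> fdist v x < 1} x *
        ((\<Prod>u\<in>C - {v}. if 0 < fdist u (fproj v x) then 1 else 0) * (n v \<bullet> w (fproj v x))) = ?L x"
      by (auto simp: indicator_def)
    with lim show ?thesis by simp
  qed
  have "(\<lambda>k. LINT x|lborel. F k x) \<longlonglongrightarrow> (LINT x|lborel. ?L x)"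
  proof (rule integral_dominated_convergence[OF L_meas _ integrable_const_cball[of "R + 1" "\<bar>M\<bar>"]])
    show "AE x in lborel. (\<lambda>k. F k x) \<longlonglongrightarrow> ?L x"
      using AE_Z by eventually_elim (rule lim)
    show "AE x in lborel. norm (F k x) \<le> indicator (cball 0 (R + 1)) x * \<bar>M\<bar>" for k
      by (rule AE_I2) (rule bound)
  qed measurable
  then show ?thesis by (simp only: fold)
qed

lemma cutoff_integral_tendsto:
  assumes f: "continuous_on UNIV f"
  shows "(\<lambda>k. LINT x|lborel. cutoff (real (Suc k)) x * f x) \<longlonglongrightarrow> (LINT x|lebesgue_on (convex hull C). f x)"
proof -
  let ?K = "convex hull C"
  have [measurable]: "f \<in> borel_measurable borel" "?K \<in> sets borel"
    using f compact_hull by (auto intro: borel_measurable_continuous_onI borel_compact)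
  have "integrable lborel (\<lambda>x. indicator ?K x *\<^sub>R \<bar>f x\<bar>)"
    by (intro borel_integrable_compact compact_hull continuous_intros continuous_on_subset[OF f subset_UNIV])
  then have bnd: "integrable lborel (\<lambda>x. indicator ?K x * \<bar>f x\<bar>)" by simp
  define Z where "Z = (\<Union>v\<in>C. {x. fdist v x = 0})"
  have "negligible Z"
    unfolding Z_def using finite_C by (intro negligible_Union) (auto intro: negligible_fdist_level)
  then have AE_Z: "AE x in lborel. x \<notin> Z" by (rule AE_lborel_negligible)
  have lim: "(\<lambda>k. cutoff (real (Suc k)) x * f x) \<longlonglongrightarrow> indicator ?K x * f x" if x: "x \<notin> Z" for x
  proof -
    have "(\<lambda>k. cutoff (real (Suc k)) x) \<longlonglongrightarrow> (\<Prod>v\<in>C. if 0 < fdist v x then 1 else 0)"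
      unfolding cutoff_def
      by (intro tendsto_prod clamp01_scaled_tendsto tendsto_const) (use x in \<open>auto simp: Z_def\<close>)
    moreover have "(\<Prod>v\<in>C. if 0 < fdist v x then 1 else 0::real) = indicator ?K x"
    proof (cases "x \<in> ?K")
      case True
      then have "\<forall>v\<in>C. 0 < fdist v x"
        using x mem_hull_iff by (force simp: Z_def less_le)
      then show ?thesis using True by simp
    next
      case False
      then have "\<exists>v\<in>C. \<not> 0 < fdist v x" using mem_hull_iff less_imp_le by blast
      then show ?thesis using False finite_C by (auto intro!: prod_zero)
    qed
    ultimately show ?thesis by (auto intro: tendsto_mult)
  qed
  have "(\<lambda>k. LINT x|lborel. cutoff (real (Suc k)) x * f x) \<longlonglongrightarrow> (LINT x|lborel. indicator ?K x * f x)"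
  proof (rule integral_dominated_convergence[OF _ _ bnd])
    show "AE x in lborel. (\<lambda>k. cutoff (real (Suc k)) x * f x) \<longlonglongrightarrow> indicator ?K x * f x"
      using AE_Z by eventually_elim (rule lim)
    show "AE x in lborel. norm (cutoff (real (Suc k)) x * f x) \<le> indicator ?K x * \<bar>f x\<bar>" for k
    proof (rule AE_I2)
      fix x
      show "norm (cutoff (real (Suc k)) x * f x) \<le> indicator ?K x * \<bar>f x\<bar>"
        using cutoff_bounds[of "real (Suc k)" x] cutoff_eq_0[of "real (Suc k)" x]
        by (cases "x \<in> ?K") (auto simp: abs_mult intro!: mult_left_le_one_le simp del: of_nat_Suc)
    qed
  qed measurable
  then show ?thesis
    by (subst LINT_lebesgue_on_eq_lborel) auto
qed

text \<open>Both sides are limits of the same sequence of slab integrals. The minus sign is due to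
  the inward direction of \<open>n v\<close>.\<close>

theorem divergence_theorem:
  assumes dim: "2 \<le> DIM('a)"
    and der: "\<And>i x. i \<in> Basis \<Longrightarrow> GDERIV (\<lambda>x. w x \<bullet> i) x :> G i x"
    and cont: "\<And>i. i \<in> Basis \<Longrightarrow> continuous_on UNIV (G i)"
  shows "(LINT x|lebesgue_on (convex hull C). (\<Sum>i\<in>Basis. G i x \<bullet> i)) =
    - (\<Sum>v\<in>C. LINT x|lborel.
        indicator {x. 0 \<le> fdist v x \<and> fdist v x \<le> 1 \<and> fproj v x \<in> convex hull (C - {v})} x *
          (n v \<bullet> w (fproj v x)))"
proof -
  have "continuous_on UNIV (\<lambda>x. w x \<bullet> i)" if "i \<in> Basis" for i
    using der[OF that] unfolding gderiv_def
    by (meson continuous_at_imp_continuous_on has_derivative_continuous)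
  then have w: "continuous_on UNIV w"
    by (subst continuous_on_componentwise) auto
  have "continuous_on UNIV (\<lambda>x. \<Sum>i\<in>Basis. G i x \<bullet> i)"
    using cont by (intro continuous_intros) auto
  from cutoff_integral_tendsto[OF this]
  have 1: "(\<lambda>k. - (\<Sum>v\<in>C. real (Suc k) *
      (LINT x|lborel. indicator (slab (real (Suc k)) v) x * flux w (real (Suc k)) v x)))
      \<longlonglongrightarrow> (LINT x|lebesgue_on (convex hull C). (\<Sum>i\<in>Basis. G i x \<bullet> i))"
    by (subst (asm) integral_cutoff_divergence[OF _ der cont w]) auto
  have 2: "(\<lambda>k. - (\<Sum>v\<in>C. real (Suc k) *
      (LINT x|lborel. indicator (slab (real (Suc k)) v) x * flux w (real (Suc k)) v x)))
      \<longlonglongrightarrow> - (\<Sum>v\<in>C. LINT x|lborel.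
        indicator {x. 0 \<le> fdist v x \<and> fdist v x \<le> 1 \<and> fproj v x \<in> convex hull (C - {v})} x *
          (n v \<bullet> w (fproj v x)))"
    by (intro tendsto_minus tendsto_sum slab_flux_tendsto dim w)
  show ?thesis by (rule LIMSEQ_unique[OF 1 2])
qed

end


section \<open>Surface measure on facets\<close>

context nsimplex begin

text \<open>Allows sums over facets to be reindexed by the opposite vertices.\<close>

lemma vertices_distinct_hulls:
  assumes "v \<in> C" "w \<in> C" "convex hull (C - {v}) = convex hull (C - {w})"
  shows "v = w"
proof (rule ccontr)
  assume "v \<noteq> w"
  then have "w \<in> convex hull (C - {w})"
    using assms by (metis Diff_iff hull_inc insertE empty_iff)
  then have "fdist w w = 0" using mem_facet_iff[OF assms(2)] by blast
  then show False using fdist_vertex[OF assms(2)] by simp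
qed

lemma card_ge_2: "2 \<le> card C"
  using card DIM_positive[where 'a = 'a] by simp

lemma facet_nonempty: "v \<in> C \<Longrightarrow> convex hull (C - {v}) \<noteq> {}"
proof -
  assume "v \<in> C"
  then have "card (C - {v}) \<noteq> 0" using card_ge_2 by simp
  then show ?thesis by (metis card.empty convex_hull_eq_empty)
qed

lemma facet_of_hull_iff: "F facet_of convex hull C \<longleftrightarrow> (\<exists>v\<in>C. F = convex hull (C - {v}))"
  using facet_of_convex_hull_affine_independent[OF indep] facet_nonempty by blast

lemma affine_hull_convex_facet: "v \<in> C \<Longrightarrow> affine hull (convex hull (C - {v})) = {x. n v \<bullet> x + c v = 0}"
  using affine_hull_facet by simp

lemma closest_point_facet: "v \<in> C \<Longrightarrow> closest_point (affine hull (convex hull (C - {v}))) x = fproj v x"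
  using closest_point_hyperplane[OF norm_n] affine_hull_convex_facet by (simp add: fproj_def fdist_def)

lemma fdist_unit_shift: "v \<in> C \<Longrightarrow> fdist v (x + r *\<^sub>R n v) = fdist v x + r"
  using n_inner_n by (simp add: fdist_add)

lemma fproj_shift: "v \<in> C \<Longrightarrow> fproj v (x + r *\<^sub>R n v) = fproj v x"
  by (simp add: fproj_def fdist_unit_shift scaleR_add_left)

lemma fproj_facet: "v \<in> C \<Longrightarrow> x \<in> convex hull (C - {v}) \<Longrightarrow> fproj v x = x"
  using mem_facet_iff by (simp add: fproj_def)

text \<open>\<open>a = 0\<close> is the unit prism on the inner side of the facet and
  \<open>a = -1\<close> the one on the outer side; these are the two prisms that
  \<open>face_measure\<close> uses for the two orientations of the normal.\<close>

definition prism :: "'a \<Rightarrow> real \<Rightarrow> 'a set" where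
  "prism v a = {x. a \<le> fdist v x \<and> fdist v x \<le> a + 1 \<and> fproj v x \<in> convex hull (C - {v})}"

lemma prism_measurable[measurable]: "prism v a \<in> sets borel"
  unfolding prism_def by measurable

lemma prism_eq:
  assumes v: "v \<in> C"
  shows "{y + r *\<^sub>R n v | y r. y \<in> convex hull (C - {v}) \<and> 0 \<le> r \<and> r \<le> 1} = prism v 0"
    "{y + r *\<^sub>R (- n v) | y r. y \<in> convex hull (C - {v}) \<and> 0 \<le> r \<and> r \<le> 1} = prism v (-1)"
proof -
  have *: "y + r *\<^sub>R n v \<in> prism v a \<longleftrightarrow> a \<le> r \<and> r \<le> a + 1" if "y \<in> convex hull (C - {v})" for y r a
    using that mem_facet_iff[OF v, of y]
    unfolding prism_def mem_Collect_eq fdist_unit_shift[OF v] fproj_shift[OF v] fproj_facet[OF v that]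
    by simp
  have **: "x = fproj v x + fdist v x *\<^sub>R n v" for x by (simp add: fproj_def)
  show "{y + r *\<^sub>R n v | y r. y \<in> convex hull (C - {v}) \<and> 0 \<le> r \<and> r \<le> 1} = prism v 0"
  proof (intro equalityI subsetI)
    fix x assume "x \<in> prism v 0"
    then show "x \<in> {y + r *\<^sub>R n v | y r. y \<in> convex hull (C - {v}) \<and> 0 \<le> r \<and> r \<le> 1}"
      using **[of x] unfolding prism_def by fastforce
  next
    fix x assume "x \<in> {y + r *\<^sub>R n v | y r. y \<in> convex hull (C - {v}) \<and> 0 \<le> r \<and> r \<le> 1}"
    then obtain y r where "x = y + r *\<^sub>R n v" "y \<in> convex hull (C - {v})" "0 \<le> r" "r \<le> 1"
      by auto
    then show "x \<in> prism v 0" using *[of y r 0] by simp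
  qed
  show "{y + r *\<^sub>R (- n v) | y r. y \<in> convex hull (C - {v}) \<and> 0 \<le> r \<and> r \<le> 1} = prism v (-1)"
  proof (intro equalityI subsetI)
    fix x assume x: "x \<in> prism v (-1)"
    have "x = fproj v x + (- fdist v x) *\<^sub>R (- n v)" using **[of x] by simp
    moreover have "0 \<le> - fdist v x" "- fdist v x \<le> 1" "fproj v x \<in> convex hull (C - {v})"
      using x by (auto simp: prism_def)
    ultimately show "x \<in> {y + r *\<^sub>R (- n v) | y r. y \<in> convex hull (C - {v}) \<and> 0 \<le> r \<and> r \<le> 1}"
      by blast
  next
    fix x assume "x \<in> {y + r *\<^sub>R (- n v) | y r. y \<in> convex hull (C - {v}) \<and> 0 \<le> r \<and> r \<le> 1}"
    then obtain y r where "x = y + (- r) *\<^sub>R n v" "y \<in> convex hull (C - {v})" "0 \<le> r" "r \<le> 1"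
      by auto
    then show "x \<in> prism v (-1)" using *[of y "-r" "-1"] by simp
  qed
qed

text \<open>Translation along the normal changes the height and not the projection. Hence surface
  integrals are independent of the orientation of the normal.\<close>

lemma integral_prism_shift:
  assumes v: "v \<in> C" and [measurable]: "g \<in> borel_measurable borel"
  shows "(LINT x|lborel. indicator (prism v a) x * g (fproj v x)) =
    (LINT x|lborel. indicator (prism v 0) x * (g (fproj v x) :: real))"
proof -
  have ind: "indicator (prism v a) (x + a *\<^sub>R n v) = (indicator (prism v 0) x :: real)" for x
    by (simp add: indicator_def prism_def fdist_unit_shift[OF v] fproj_shift[OF v])
  have "(LINT x|lborel. indicator (prism v a) x * g (fproj v x)) =
      (LINT x|lborel. indicator (prism v a) (x + a *\<^sub>R n v) * g (fproj v (x + a *\<^sub>R n v)))"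
    by (rule lborel_integral_translate(1)[symmetric]) measurable
  then show ?thesis by (simp only: ind fproj_shift[OF v])
qed

lemma integrable_prism:
  assumes v: "v \<in> C" and g: "continuous_on UNIV g"
  shows "integrable lborel (\<lambda>x. indicator (prism v a) x * (g (fproj v x) :: real))"
proof -
  have g_meas[measurable]: "g \<in> borel_measurable borel"
    using g by (rule borel_measurable_continuous_onI)
  let ?F = "convex hull (C - {v})"
  obtain B where B: "\<And>x. x \<in> ?F \<Longrightarrow> \<bar>g x\<bar> \<le> B"
    using compact_imp_bounded[OF compact_continuous_image[OF continuous_on_subset[OF g subset_UNIV] compact_facet]]
    by (force simp: bounded_iff)
  obtain R where R: "\<And>x. x \<in> ?F \<Longrightarrow> norm x \<le> R"
    using compact_imp_bounded[OF compact_facet[of v]] unfolding bounded_iff by blast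
  show ?thesis
  proof (rule integrable_bounded_support)
    show "\<bar>indicator (prism v a) x * g (fproj v x)\<bar> \<le> \<bar>B\<bar>" for x
      using B[of "fproj v x"] by (auto simp: indicator_def prism_def)
    show "indicator (prism v a) x * g (fproj v x) = 0" if "R + (\<bar>a\<bar> + 1) < norm x" for x
    proof -
      have "x \<notin> prism v a"
      proof
        assume x: "x \<in> prism v a"
        have "norm x \<le> norm (fproj v x) + norm (fdist v x *\<^sub>R n v)"
          using norm_triangle_ineq[of "fproj v x" "fdist v x *\<^sub>R n v"] by (simp add: fproj_def)
        also have "norm (fdist v x *\<^sub>R n v) \<le> \<bar>a\<bar> + 1"
          using x norm_n[OF v] by (simp add: prism_def) linarith
        also have "norm (fproj v x) \<le> R"
          using x R by (simp add: prism_def)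
        finally show False using that by simp
      qed
      then show ?thesis by simp
    qed
  qed measurable
qed

text \<open>The part \<open>z\<close> of \<open>\<mu>\<close> orthogonal to \<open>n v\<close> is a
  direction of the facet's hyperplane. So \<open>\<mu>\<close> is orthogonal to \<open>z\<close>,
  and then so is \<open>z\<close> itself.\<close>

lemma orthogonal_to_facet:
  assumes v: "v \<in> C" and orth: "\<And>x y. x \<in> convex hull (C - {v}) \<Longrightarrow> y \<in> convex hull (C - {v}) \<Longrightarrow> \<mu> \<bullet> (x - y) = 0"
  shows "\<mu> = (\<mu> \<bullet> n v) *\<^sub>R n v"
proof -
  obtain y0 where y0: "y0 \<in> convex hull (C - {v})" using facet_nonempty[OF v] by blast
  have "convex hull (C - {v}) \<subseteq> {x. \<mu> \<bullet> x = \<mu> \<bullet> y0}"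
    using orth[OF _ y0] by (auto simp: inner_diff_right)
  then have sub: "affine hull (convex hull (C - {v})) \<subseteq> {x. \<mu> \<bullet> x = \<mu> \<bullet> y0}"
    by (rule hull_minimal) (rule affine_hyperplane)
  define z where "z = \<mu> - (\<mu> \<bullet> n v) *\<^sub>R n v"
  have nz: "n v \<bullet> z = 0"
    using n_inner_n[OF v] by (simp add: z_def inner_diff_right inner_commute)
  have "fdist v (y0 + z) = 0"
    using y0 mem_facet_iff[OF v] nz by (simp add: fdist_add)
  then have "y0 + z \<in> affine hull (convex hull (C - {v}))"
    unfolding affine_hull_convex_facet[OF v] by (simp add: fdist_def)
  then have "\<mu> \<bullet> z = 0" using sub by (auto simp: inner_add_right)
  moreover have "z \<bullet> z = \<mu> \<bullet> z - (\<mu> \<bullet> n v) * (n v \<bullet> z)"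
    by (subst (1) z_def) (simp add: inner_diff_left)
  ultimately have "z = 0" using nz by simp
  then show ?thesis by (simp add: z_def)
qed

end

locale nsimplex_facet = nsimplex C n c
  for C :: "(real^'n) set" and n :: "real^'n \<Rightarrow> real^'n" and c :: "real^'n \<Rightarrow> real" +
  fixes v \<mu> :: "real^'n"
  assumes v: "v \<in> C" and \<mu>: "unit_normal (convex hull (C - {v})) \<mu>"
begin

lemma normal_cases: "\<mu> = n v \<or> \<mu> = - n v"
proof -
  have eq: "\<mu> = (\<mu> \<bullet> n v) *\<^sub>R n v"
    using \<mu> unfolding unit_normal_def by (intro orthogonal_to_facet[OF v]) auto
  have "norm \<mu> = \<bar>\<mu> \<bullet> n v\<bar>" using norm_n[OF v] by (subst eq) (simp only: norm_scaleR mult_1_right)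
  then have "\<mu> \<bullet> n v = 1 \<or> \<mu> \<bullet> n v = -1" using \<mu> by (auto simp: unit_normal_def)
  then show ?thesis using eq by auto
qed

text \<open>The shift \<open>a\<close> is left unspecified: it depends on the orientation of
  \<open>\<mu>\<close>, and integrals do not see it.\<close>

lemma face_measure_eq:
  obtains a where "face_measure \<mu> (convex hull (C - {v})) =
    completion (distr (restrict_space lborel (prism v a)) borel (fproj v))"
proof -
  have cp: "closest_point (affine hull (convex hull (C - {v}))) = fproj v"
    by (rule ext) (rule closest_point_facet[OF v])
  show thesis
    using normal_cases
  proof
    assume "\<mu> = n v"
    then show thesis
      by (intro that[of 0]) (simp only: face_measure_def cp prism_eq(1)[OF v])
  next
    assume "\<mu> = - n v"
    then show thesis
      by (intro that[of "-1"]) (simp only: face_measure_def cp prism_eq(2)[OF v])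
  qed
qed

lemma integral_face_measure:
  assumes [measurable]: "g \<in> borel_measurable borel"
  shows "(LINT x|face_measure \<mu> (convex hull (C - {v})). g x) =
    (LINT x|lborel. indicator (prism v 0) x * (g (fproj v x) :: real))"
proof -
  obtain a where a: "face_measure \<mu> (convex hull (C - {v})) =
    completion (distr (restrict_space lborel (prism v a)) borel (fproj v))"
    by (rule face_measure_eq)
  have meas: "fproj v \<in> measurable (restrict_space lborel (prism v a)) borel"
    by (rule measurable_restrict_space1) measurable
  have "(LINT x|face_measure \<mu> (convex hull (C - {v})). g x) =
      (LINT x|distr (restrict_space lborel (prism v a)) borel (fproj v). g x)"
    unfolding a by (rule integral_completion) measurable
  also have "\<dots> = (LINT x|restrict_space lborel (prism v a). g (fproj v x))"
    by (rule integral_distr[OF meas]) measurable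
  also have "\<dots> = (LINT x|lborel. indicator (prism v a) x * g (fproj v x))"
    by (subst integral_restrict_space) simp_all
  also have "\<dots> = (LINT x|lborel. indicator (prism v 0) x * g (fproj v x))"
    by (rule integral_prism_shift[OF v]) measurable
  finally show ?thesis .
qed

lemma AE_face_measure_mem: "AE x in face_measure \<mu> (convex hull (C - {v})). x \<in> convex hull (C - {v})"
proof -
  obtain a where a: "face_measure \<mu> (convex hull (C - {v})) =
    completion (distr (restrict_space lborel (prism v a)) borel (fproj v))"
    by (rule face_measure_eq)
  have meas: "fproj v \<in> measurable (restrict_space lborel (prism v a)) borel"
    by (rule measurable_restrict_space1) measurable
  have "AE x in restrict_space lborel (prism v a). fproj v x \<in> convex hull (C - {v})"
    by (subst AE_restrict_space_iff) (auto simp: prism_def)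
  then have "AE x in distr (restrict_space lborel (prism v a)) borel (fproj v). x \<in> convex hull (C - {v})"
    by (subst AE_distr_iff[OF meas]) auto
  then show ?thesis unfolding a by (rule AE_completion)
qed

lemma integrable_face_measure:
  assumes g: "continuous_on UNIV g"
  shows "integrable (face_measure \<mu> (convex hull (C - {v}))) (g :: real^'n \<Rightarrow> real)"
proof -
  obtain a where a: "face_measure \<mu> (convex hull (C - {v})) =
    completion (distr (restrict_space lborel (prism v a)) borel (fproj v))"
    by (rule face_measure_eq)
  have meas: "fproj v \<in> measurable (restrict_space lborel (prism v a)) borel"
    by (rule measurable_restrict_space1) measurable
  have g_meas[measurable]: "g \<in> borel_measurable borel"
    using g by (rule borel_measurable_continuous_onI)
  have "integrable lborel (\<lambda>x. indicator (prism v a) x * g (fproj v x))"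
    by (rule integrable_prism[OF v g])
  then have "integrable (restrict_space lborel (prism v a)) (\<lambda>x. g (fproj v x))"
    by (subst integrable_restrict_space) simp_all
  then have "integrable (distr (restrict_space lborel (prism v a)) borel (fproj v)) g"
    by (subst integrable_distr_eq[OF meas]) simp_all
  then show ?thesis
    unfolding a by (subst integrable_completion) simp_all
qed

text \<open>A prism over a relatively open piece of a facet has interior points.\<close>

lemma continuous_integral_face_measure_eq_0:
  assumes g: "continuous_on UNIV g" and nonneg: "\<And>x. 0 \<le> g x"
    and zero: "(LINT x|face_measure \<mu> (convex hull (C - {v})). g x) = (0::real)"
    and y: "fdist v y = 0" "\<And>u. u \<in> C - {v} \<Longrightarrow> 0 < fdist u y"
  shows "g y = 0"
proof (rule ccontr)
  assume "g y \<noteq> 0"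
  then have gy: "0 < g y" using nonneg[of y] by simp
  have g_meas[measurable]: "g \<in> borel_measurable borel"
    using g by (rule borel_measurable_continuous_onI)
  have cp: "continuous_on UNIV (fproj v)"
    unfolding fproj_def[abs_def] by (intro continuous_intros continuous_fdist)
  \<comment> \<open>The open part of the prism over the relatively open set where \<open>g\<close>
    is positive; the point at height 1/2 above \<open>y\<close> shows that it is nonempty.\<close>
  define U where "U = {x. 0 < fdist v x \<and> fdist v x < 1} \<inter> {x. 0 < g (fproj v x)} \<inter>
      (\<Inter>u\<in>C - {v}. {x. 0 < fdist u (fproj v x)})"
  have cg: "continuous_on UNIV (\<lambda>x. g (fproj v x))"
    by (rule continuous_on_compose2[OF g cp]) simp
  have cf: "continuous_on UNIV (\<lambda>x. fdist u (fproj v x))" for u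
    by (rule continuous_on_compose2[OF continuous_fdist[of UNIV] cp]) simp
  have "open U"
    unfolding U_def using finite_C
    by (intro open_Int open_INT ballI open_Collect_conj open_Collect_less continuous_on_const
        continuous_fdist cg cf) auto
  moreover have "y + (1/2) *\<^sub>R n v \<in> U"
  proof -
    have "fproj v (y + (1/2) *\<^sub>R n v) = y"
      using y(1) by (simp only: fproj_shift[OF v]) (simp add: fproj_def)
    then show ?thesis
      unfolding U_def using y gy by (simp add: fdist_unit_shift[OF v])
  qed
  ultimately have "\<not> negligible U" using open_not_negligible by blast
  have Upr: "U \<subseteq> prism v 0"
  proof
    fix x assume x: "x \<in> U"
    have "0 \<le> fdist w (fproj v x)" if "w \<in> C" for w
      using x that fdist_fproj[OF v, of x] by (cases "w = v") (auto simp: U_def less_imp_le)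
    then show "x \<in> prism v 0"
      using x fdist_fproj[OF v, of x] by (simp add: prism_def mem_facet_iff[OF v]) (simp add: U_def)
  qed
  have int: "integrable lborel (\<lambda>x. indicator (prism v 0) x * g (fproj v x))"
    by (rule integrable_prism[OF v g])
  have "(LINT x|lborel. indicator (prism v 0) x * g (fproj v x)) = 0"
    using zero integral_face_measure[OF g_meas] by simp
  then have "AE x in lborel. indicator (prism v 0) x * g (fproj v x) = 0"
    using int nonneg by (subst (asm) integral_nonneg_eq_0_iff_AE) auto
  then have "AE x in lebesgue. x \<notin> U"
    using Upr by (subst AE_completion_iff) (auto elim!: eventually_mono simp: U_def indicator_def)
  moreover have "U \<in> sets lebesgue" using \<open>open U\<close> by simp
  ultimately have "negligible U"
    using AE_iff_null_sets[of U lebesgue] unfolding negligible_iff_null_sets by blast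
  with \<open>\<not> negligible U\<close> show False by blast
qed

end

text \<open>For a facet \<open>F\<close> of \<open>K\<close> with unit normal \<open>\<mu>\<close>:
  1 if \<open>\<mu>\<close> is the outward normal of \<open>K\<close> on \<open>F\<close>, and -1 if
  it is the inward one.\<close>

definition side_sign :: "real^'n \<Rightarrow> (real^'n) set \<Rightarrow> (real^'n) set \<Rightarrow> real" where
  "side_sign \<mu> K F = (if \<forall>x\<in>K. \<forall>y\<in>F. \<mu> \<bullet> x \<le> \<mu> \<bullet> y then 1 else -1)"

context nsimplex_facet begin

lemma normal_le: "x \<in> convex hull C \<Longrightarrow> y \<in> convex hull (C - {v}) \<Longrightarrow> n v \<bullet> y \<le> n v \<bullet> x"
  using mem_hull_iff mem_facet_iff[OF v] v by (fastforce simp: fdist_def)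

lemma normal_less: "y \<in> convex hull (C - {v}) \<Longrightarrow> n v \<bullet> y < n v \<bullet> v"
  using fdist_vertex[OF v] mem_facet_iff[OF v] by (fastforce simp: fdist_def)

text \<open>The vertex \<open>v\<close> lies strictly on the inner side of its facet, so
  \<open>n v\<close> fails the outward inequality tested by \<open>side_sign\<close>; this separates
  the two cases of \<open>normal_cases\<close>.\<close>

lemma side_sign_eq: "n v = - side_sign \<mu> (convex hull C) (convex hull (C - {v})) *\<^sub>R \<mu>"
proof -
  obtain y where y: "y \<in> convex hull (C - {v})" using facet_nonempty[OF v] by blast
  have "v \<in> convex hull C" using v by (simp add: hull_inc)
  then have "\<not> (\<forall>x\<in>convex hull C. \<forall>y\<in>convex hull (C - {v}). n v \<bullet> x \<le> n v \<bullet> y)"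
    using y normal_less[OF y] by force
  then show ?thesis
    using normal_cases normal_le unfolding side_sign_def by auto
qed

end

text \<open>Inward normals are traded for prescribed ones: the minus signs of
  \<open>divergence_theorem\<close> and \<open>side_sign_eq\<close> cancel, and the prism integrals
  become surface integrals.\<close>

theorem simplex_divergence_theorem:
  fixes K :: "(real^'n) set" and w :: "real^'n \<Rightarrow> real^'n"
  assumes K: "int CARD('n) simplex K" and dim: "2 \<le> CARD('n)"
    and \<mu>: "\<And>F. F facet_of K \<Longrightarrow> unit_normal F (\<mu> F)"
    and der: "\<And>i x. GDERIV (\<lambda>x. w x $ i) x :> G i x"
    and cont: "\<And>i. continuous_on UNIV (G i)"
  shows "(LINT x|lebesgue_on K. (\<Sum>i\<in>UNIV. G i x $ i)) =
    (\<Sum>F | F facet_of K. side_sign (\<mu> F) K F * (LINT x|face_measure (\<mu> F) F. \<mu> F \<bullet> w x))"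
proof -
  have "int DIM(real^'n) simplex K" using K by simp
  then obtain C n c where "nsimplex C n c" and KC: "K = convex hull C"
    by (rule simplex_obtain_nsimplex)
  then interpret nsimplex C n c by blast
  have der': "GDERIV (\<lambda>x. w x \<bullet> j) x :> G (axis_index j) x" if "j \<in> Basis" for j x
  proof -
    have "j = axis (axis_index j) 1" using that by (simp add: axis_index)
    then have "w x \<bullet> j = w x $ axis_index j" for x by (metis cart_eq_inner_axis)
    then show ?thesis using der by simp
  qed
  have cw: "continuous_on UNIV w"
  proof -
    have "continuous_on UNIV (\<lambda>x. w x $ i)" for i
      using der[of i] unfolding gderiv_def
      by (meson continuous_at_imp_continuous_on has_derivative_continuous)
    then have "continuous_on UNIV (\<lambda>x. \<chi> i. w x $ i)"
      by (rule continuous_on_vec_lambda)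
    then show ?thesis by simp
  qed
  have basis: "(\<Sum>j\<in>Basis. G (axis_index j) x \<bullet> j) = (\<Sum>i\<in>UNIV. G i x $ i)" for x :: "real^'n"
  proof -
    have B: "(Basis :: (real^'n) set) = range (\<lambda>i. axis i 1)"
      by (auto simp: Basis_vec_def)
    have inj: "inj (\<lambda>i::'n. axis i (1::real))" by (auto intro!: injI simp: axis_eq_axis)
    show ?thesis
      unfolding B sum.reindex[OF inj] by (simp add: axis_index_axis inner_axis)
  qed
  have facets: "{F. F facet_of K} = (\<lambda>v. convex hull (C - {v})) ` C"
    unfolding KC using facet_of_hull_iff by auto
  have inj: "inj_on (\<lambda>v. convex hull (C - {v})) C"
    using vertices_distinct_hulls by (auto intro!: inj_onI)
  have face_term: "- (LINT x|lborel. indicator (prism v 0) x * (n v \<bullet> w (fproj v x))) =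
      side_sign (\<mu> (convex hull (C - {v}))) K (convex hull (C - {v})) *
      (LINT x|face_measure (\<mu> (convex hull (C - {v}))) (convex hull (C - {v})). \<mu> (convex hull (C - {v})) \<bullet> w x)"
    if v: "v \<in> C" for v
  proof -
    let ?F = "convex hull (C - {v})"
    have "?F facet_of K" using v facets by blast
    then interpret f: nsimplex_facet C n c v "\<mu> ?F"
      using v \<mu> by unfold_locales auto
    let ?s = "side_sign (\<mu> ?F) K ?F"
    have [measurable]: "(\<lambda>x. \<mu> ?F \<bullet> w x) \<in> borel_measurable borel"
      using cw by (intro borel_measurable_continuous_onI continuous_intros)
    have "(LINT x|lborel. indicator (prism v 0) x * (n v \<bullet> w (fproj v x))) =
        (LINT x|lborel. - ?s * (indicator (prism v 0) x * (\<mu> ?F \<bullet> w (fproj v x))))"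
      unfolding f.side_sign_eq KC by (simp add: mult_ac)
    also have "\<dots> = - ?s * (LINT x|face_measure (\<mu> ?F) ?F. \<mu> ?F \<bullet> w x)"
      by (subst f.integral_face_measure) simp_all
    finally show ?thesis by simp
  qed
  have "(LINT x|lebesgue_on K. (\<Sum>i\<in>UNIV. G i x $ i)) =
      (\<Sum>v\<in>C. - (LINT x|lborel. indicator (prism v 0) x * (n v \<bullet> w (fproj v x))))"
    using divergence_theorem[of w "\<lambda>j. G (axis_index j)"] dim der' cont
    unfolding basis KC[symmetric] prism_def by (simp add: sum_negf)
  then show ?thesis
    unfolding facets by (simp add: sum.reindex[OF inj] face_term)
qed


section \<open>Geometry of the mesh\<close>

text \<open>Barycentric coefficients of such a point are positive on the vertices of the facet.
  Extended by 0 at \<open>v\<close>, they give all signed distances.\<close>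

lemma (in nsimplex) rel_interior_facet:
  assumes v: "v \<in> C" and y: "y \<in> rel_interior (convex hull (C - {v}))"
  shows "fdist v y = 0" "\<And>u. u \<in> C - {v} \<Longrightarrow> 0 < fdist u y"
proof -
  have "\<not> affine_dependent (C - {v})" using indep affine_independent_Diff by blast
  then obtain a where a: "\<And>x. x \<in> C - {v} \<Longrightarrow> 0 < a x" "sum a (C - {v}) = 1"
    "(\<Sum>x\<in>C - {v}. a x *\<^sub>R x) = y"
    using y by (auto simp: rel_interior_convex_hull_explicit)
  define b where "b x = (if x = v then 0 else a x)" for x
  have "sum b C = sum b (C - {v})" "(\<Sum>x\<in>C. b x *\<^sub>R x) = (\<Sum>x\<in>C - {v}. b x *\<^sub>R x)"
    using finite_C v by (simp_all add: sum.remove[of C v] b_def)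
  moreover have "sum b (C - {v}) = sum a (C - {v})" "(\<Sum>x\<in>C - {v}. b x *\<^sub>R x) = (\<Sum>x\<in>C - {v}. a x *\<^sub>R x)"
    by (auto intro!: sum.cong simp: b_def)
  ultimately have "sum b C = 1" "(\<Sum>x\<in>C. b x *\<^sub>R x) = y" using a by simp_all
  then have "fdist u y = b u * fdist u u" if "u \<in> C" for u
    using fdist_affine_comb[of b u] that by simp
  then show "fdist v y = 0" "\<And>u. u \<in> C - {v} \<Longrightarrow> 0 < fdist u y"
    using v a(1) fdist_vertex by (auto simp: b_def)
qed

text \<open>Prepares the overlap argument: two elements with a common facet and a common inward
  normal would share interior points.\<close>

lemma (in nsimplex) eventually_interior_near_facet:
  assumes v: "v \<in> C" and y: "y \<in> rel_interior (convex hull (C - {v}))"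
  shows "\<forall>\<^sub>F t in at_right 0. y + t *\<^sub>R n v \<in> interior (convex hull C)"
proof -
  have "\<forall>\<^sub>F t in at_right 0. 0 < fdist u (y + t *\<^sub>R n v)" if u: "u \<in> C" for u
  proof (cases "u = v")
    case True
    show ?thesis
      using eventually_at_right_less[of "0::real"]
      by eventually_elim (simp add: True fdist_unit_shift[OF v] rel_interior_facet(1)[OF v y])
  next
    case False
    have "((\<lambda>t. fdist u (y + t *\<^sub>R n v)) \<longlongrightarrow> fdist u (y + 0 *\<^sub>R n v)) (at_right 0)"
      unfolding fdist_def by (intro tendsto_intros)
    moreover have "0 < fdist u (y + 0 *\<^sub>R n v)"
      using rel_interior_facet(2)[OF v y] u False by simp
    ultimately show ?thesis by (rule order_tendstoD)
  qed
  then have "\<forall>\<^sub>F t in at_right 0. \<forall>u\<in>C. 0 < fdist u (y + t *\<^sub>R n v)"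
    using finite_C by (simp add: eventually_ball_finite)
  then show ?thesis unfolding interior_hull by simp
qed

locale mesh =
  fixes \<Omega> :: "(real^'n) set" and Th :: "(real^'n) set set" and \<nu> :: "(real^'n) set \<Rightarrow> real^'n"
  assumes dim: "2 \<le> CARD('n)" and mesh: "domain_mesh \<Omega> Th"
    and normals: "\<And>e. e \<in> interior_faces Th \<Longrightarrow> unit_normal e (\<nu> e)"
begin

lemma finite_Th: "finite Th"
  using mesh unfolding domain_mesh_def triangulation_def by blast

lemma simplex_Th: "K \<in> Th \<Longrightarrow> int CARD('n) simplex K"
  using mesh unfolding domain_mesh_def by blast

lemma face_Int: "K \<in> Th \<Longrightarrow> K' \<in> Th \<Longrightarrow> K \<inter> K' face_of K"
  using mesh unfolding domain_mesh_def triangulation_def by blast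

lemma Omega_eq: "\<Omega> = interior (\<Union>Th)"
  using mesh unfolding domain_mesh_def by blast

lemma compact_Th: "K \<in> Th \<Longrightarrow> compact K"
  using simplex_Th compact_simplex by blast

lemma convex_Th: "K \<in> Th \<Longrightarrow> convex K"
  using simplex_Th convex_simplex by blast

lemma aff_dim_Th: "K \<in> Th \<Longrightarrow> aff_dim K = int CARD('n)"
  using simplex_Th aff_dim_simplex by blast

lemma obtain_nsimplex:
  assumes "K \<in> Th"
  obtains C n c where "nsimplex C n c" "K = convex hull C"
proof -
  have "int DIM(real^'n) simplex K" using simplex_Th[OF assms] by simp
  then show ?thesis using that by (rule simplex_obtain_nsimplex)
qed

lemma interior_nonempty:
  assumes "K \<in> Th" shows "interior K \<noteq> {}"
proof -
  have d: "aff_dim K = int DIM(real^'n)" using aff_dim_Th[OF assms] by simp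
  then have "K \<noteq> {}" by (auto simp: aff_dim_empty)
  moreover have "rel_interior K = interior K" by (rule interior_rel_interior[OF d])
  ultimately show ?thesis using rel_interior_eq_empty[OF convex_Th[OF assms]] by simp
qed

lemma closure_interior: "K \<in> Th \<Longrightarrow> closure (interior K) = K"
  using convex_closure_interior[OF convex_Th interior_nonempty] compact_Th compact_imp_closed closure_closed
  by metis

text \<open>A common interior point lies in \<open>K \<inter> K'\<close>, which is a face of both
  elements, and a face that meets the interior is everything.\<close>

lemma interior_disjoint:
  assumes "K \<in> Th" "K' \<in> Th" "K \<noteq> K'"
  shows "interior K \<inter> interior K' = {}"
proof (rule ccontr)
  assume "interior K \<inter> interior K' \<noteq> {}"
  then obtain x where "x \<in> interior K" "x \<in> interior K'" by blast
  moreover from this have "x \<in> K \<inter> K'" using interior_subset by blast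
  ultimately have "K \<inter> K' = K" "K' \<inter> K = K'"
    using face_of_disjoint_interior[OF face_Int[OF assms(1,2)]]
      face_of_disjoint_interior[OF face_Int[OF assms(2,1)]] by blast+
  then show False using assms(3) by blast
qed

lemma interior_subset_Omega: "K \<in> Th \<Longrightarrow> interior K \<subseteq> \<Omega>"
  unfolding Omega_eq by (intro interior_mono) blast

lemma negligible_frontier_Th: "K \<in> Th \<Longrightarrow> negligible (frontier K)"
  using convex_Th by (rule negligible_convex_frontier)

definition skeleton :: "(real^'n) set" where "skeleton = (\<Union>K\<in>Th. frontier K)"

lemma negligible_skeleton: "negligible skeleton"
  unfolding skeleton_def using finite_Th negligible_frontier_Th by (intro negligible_Union) auto

lemma Omega_cover:
  assumes "x \<in> \<Omega>" "x \<notin> skeleton" shows "\<exists>K\<in>Th. x \<in> interior K"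
proof -
  have "x \<in> \<Union>Th" using assms(1) interior_subset unfolding Omega_eq by blast
  then obtain K where K: "K \<in> Th" "x \<in> K" by blast
  then have "x \<notin> frontier K" using assms(2) by (auto simp: skeleton_def)
  then have "x \<in> interior K"
    using K(2) closure_subset[of K] by (auto simp: frontier_def)
  then show ?thesis using K(1) by blast
qed

lemma facet_aff_dim: "K \<in> Th \<Longrightarrow> F facet_of K \<Longrightarrow> aff_dim F = int CARD('n) - 1"
  using aff_dim_Th by (simp add: facet_of_def)

lemma facet_iff_face: "K \<in> Th \<Longrightarrow> aff_dim F = int CARD('n) - 1 \<Longrightarrow> F facet_of K \<longleftrightarrow> F face_of K"
  using aff_dim_Th dim by (auto simp: facet_of_def)

text \<open>\<open>K \<inter> K'\<close> is a proper face of \<open>K\<close>, hence of dimension at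
  most n - 1. It has \<open>F\<close> as a face, and a proper face of it would have a smaller
  dimension than \<open>F\<close> has.\<close>

lemma shared_facet_eq:
  assumes K: "K \<in> Th" "K' \<in> Th" "K \<noteq> K'" and F: "F face_of K" "aff_dim F = int CARD('n) - 1" "F \<subseteq> K'"
  shows "F = K \<inter> K'" "F facet_of K'" "F \<in> interior_faces Th"
proof -
  have ne: "K \<inter> K' \<noteq> K"
  proof
    assume eq: "K \<inter> K' = K"
    then have "interior K \<subseteq> interior K'" by (metis inf.cobounded2 interior_mono)
    then show False
      using interior_disjoint[OF K] interior_nonempty[OF K(1)] by blast
  qed
  have less: "aff_dim (K \<inter> K') < int CARD('n)"
    using face_of_aff_dim_lt[OF convex_Th[OF K(1)] face_Int[OF K(1,2)] ne] aff_dim_Th[OF K(1)] by simp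
  have sub: "F \<subseteq> K \<inter> K'" using F face_of_imp_subset by blast
  have face: "F face_of (K \<inter> K')" using face_of_subset[OF F(1) sub] by simp
  have "F = K \<inter> K'"
  proof (rule ccontr)
    assume "F \<noteq> K \<inter> K'"
    then have "aff_dim F < aff_dim (K \<inter> K')"
      using face_of_aff_dim_lt[OF _ face] convex_Th K by (simp add: convex_Int)
    then show False using less F(2) by simp
  qed
  then show eq: "F = K \<inter> K'" .
  then have "F face_of K'" using face_Int[OF K(2,1)] by (simp add: Int_commute)
  then show "F facet_of K'" using facet_iff_face K(2) F(2) by blast
  show "F \<in> interior_faces Th"
    unfolding interior_faces_def using eq K F(2) by auto
qed

definition facets :: "(real^'n) set set" where "facets = {F. \<exists>K\<in>Th. F facet_of K}"

lemma finite_facets_of: "K \<in> Th \<Longrightarrow> finite {F. F facet_of K}"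
  using simplex_Th simplex_imp_polytope polytope_imp_polyhedron finite_polyhedron_facets by blast

lemma finite_facets: "finite facets"
proof -
  have "facets = (\<Union>K\<in>Th. {F. F facet_of K})" by (auto simp: facets_def)
  then show ?thesis using finite_Th finite_facets_of by simp
qed

lemma interior_faces_facet:
  assumes "e \<in> interior_faces Th"
  obtains K1 K2 where "K1 \<in> Th" "K2 \<in> Th" "K1 \<noteq> K2" "e facet_of K1" "e facet_of K2"
proof -
  obtain K1 K2 where K: "e = K1 \<inter> K2" "K1 \<in> Th" "K2 \<in> Th" "K1 \<noteq> K2" "aff_dim e = int CARD('n) - 1"
    using assms unfolding interior_faces_def by auto
  then have "e facet_of K1" "e facet_of K2"
    using facet_iff_face face_Int by (metis inf_commute)+
  with K show ?thesis using that by blast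
qed

lemma interior_faces_subset: "interior_faces Th \<subseteq> facets"
  using interior_faces_facet by (metis (mono_tags, lifting) facets_def mem_Collect_eq subsetI)

text \<open>A face that contains a relative interior point of \<open>F\<close> contains all of
  \<open>F\<close>. Here the face is the intersection of the two elements.\<close>

lemma rel_interior_facet_mem:
  assumes K: "K \<in> Th" "F facet_of K" and y: "y \<in> rel_interior F" and K': "K' \<in> Th" "y \<in> K'"
  shows "F facet_of K'"
proof (cases "K = K'")
  case False
  have F: "F face_of K" "aff_dim F = int CARD('n) - 1"
    using K facet_aff_dim by (auto simp: facet_of_def)
  have "y \<in> K \<inter> K'" using y K' rel_interior_subset F(1) face_of_imp_subset by blast
  then have "F \<subseteq> K \<inter> K'"
    using y F(1) face_of_imp_subset by (intro subset_of_face_of[OF face_Int[OF K(1) K'(1)]]) blast+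
  then show ?thesis using shared_facet_eq(2)[OF K(1) K'(1) False F] by blast
qed (use K in simp)

text \<open>Separates a relative interior point of one facet from all other facets of the mesh, so
  that a bump around it sees one facet only.\<close>

lemma rel_interior_facets_disjoint:
  assumes F: "F \<in> facets" "F' \<in> facets" "F \<noteq> F'" and y: "y \<in> rel_interior F"
  shows "y \<notin> F'"
proof
  assume yF': "y \<in> F'"
  obtain K K' where K: "K \<in> Th" "F facet_of K" "K' \<in> Th" "F' facet_of K'"
    using F by (auto simp: facets_def)
  then have yK': "y \<in> K'" using yF' face_of_imp_subset by (auto simp: facet_of_def)
  have FK': "F facet_of K'" using rel_interior_facet_mem[OF K(1,2) y K(3) yK'] .
  then have "F \<subseteq> F'"
    using K(4) y yF' face_of_imp_subset
    by (intro subset_of_face_of[of F' K' F]) (auto simp: facet_of_def)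
  then have "F face_of F'"
    using FK' K(4) face_of_subset face_of_imp_subset by (metis facet_of_def)
  moreover have "aff_dim F = aff_dim F'" using facet_aff_dim K by metis
  moreover have "convex F'" using K convex_Th face_of_imp_convex by (metis facet_of_def)
  ultimately show False using face_of_aff_dim_lt F(3) by force
qed

lemma obtain_nsimplex_facet:
  assumes K: "K \<in> Th" "F facet_of K" and \<mu>: "unit_normal F \<mu>"
  obtains C n c v where "nsimplex_facet C n c v \<mu>" "K = convex hull C" "F = convex hull (C - {v})"
proof -
  obtain C n c where C: "nsimplex C n c" "K = convex hull C" by (rule obtain_nsimplex[OF K(1)])
  then obtain v where "v \<in> C" "F = convex hull (C - {v})"
    using K(2) nsimplex.facet_of_hull_iff by blast
  with C \<mu> show ?thesis
    by (intro that[of C n c v]) (auto simp: nsimplex_facet_def nsimplex_facet_axioms_def)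
qed

lemma rel_interior_facet_nonempty: "F \<in> facets \<Longrightarrow> rel_interior F \<noteq> {}"
proof -
  assume "F \<in> facets"
  then obtain K where "K \<in> Th" "F facet_of K" by (auto simp: facets_def)
  then have "convex F" "F \<noteq> {}" using convex_Th face_of_imp_convex by (auto simp: facet_of_def)
  then show ?thesis by (simp add: rel_interior_eq_empty)
qed

lemma unit_normal_exists: "F \<in> facets \<Longrightarrow> \<exists>\<mu>. unit_normal F \<mu>"
proof -
  assume "F \<in> facets"
  then obtain K where K: "K \<in> Th" "F facet_of K" by (auto simp: facets_def)
  obtain C n c where "nsimplex C n c" and C: "K = convex hull C" by (rule obtain_nsimplex[OF K(1)])
  then interpret nsimplex C n c by blast
  obtain v where v: "v \<in> C" "F = convex hull (C - {v})" using K C facet_of_hull_iff by blast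
  have "n v \<bullet> (x - y) = 0" if "x \<in> F" "y \<in> F" for x y
    using that mem_facet_iff[OF v(1)] v(2) by (auto simp: fdist_def inner_diff_right)
  then show ?thesis using norm_n[OF v(1)] unfolding unit_normal_def by blast
qed

lemma side_sign_cases: "side_sign \<mu> K F = 1 \<or> side_sign \<mu> K F = -1"
  by (auto simp: side_sign_def)

text \<open>Equal signs mean equal inward normals. Starting from a relative interior point of
  \<open>F\<close>, a short move along that normal would end in the interior of both
  elements.\<close>

lemma side_sign_opposite:
  assumes K: "K \<in> Th" "K' \<in> Th" "K \<noteq> K'" "F facet_of K" "F facet_of K'" and \<mu>: "unit_normal F \<mu>"
  shows "side_sign \<mu> K' F = - side_sign \<mu> K F"
proof (rule ccontr)
  assume "\<not> ?thesis"
  then have eq: "side_sign \<mu> K' F = side_sign \<mu> K F"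
    using side_sign_cases[of \<mu> K F] side_sign_cases[of \<mu> K' F] by auto
  obtain C n c v where "nsimplex_facet C n c v \<mu>" and C: "K = convex hull C" "F = convex hull (C - {v})"
    by (rule obtain_nsimplex_facet[OF K(1,4) \<mu>])
  then interpret A: nsimplex_facet C n c v \<mu> by blast
  obtain C' n' c' v' where "nsimplex_facet C' n' c' v' \<mu>"
    and C': "K' = convex hull C'" "F = convex hull (C' - {v'})"
    by (rule obtain_nsimplex_facet[OF K(2,5) \<mu>])
  then interpret B: nsimplex_facet C' n' c' v' \<mu> by blast
  have nn: "n v = n' v'"
    using A.side_sign_eq B.side_sign_eq eq by (simp add: C'[symmetric] C[symmetric])
  have "F \<in> facets" using K by (auto simp: facets_def)
  then obtain y where y: "y \<in> rel_interior F" using rel_interior_facet_nonempty by blast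
  have "\<forall>\<^sub>F t in at_right 0. y + t *\<^sub>R n v \<in> interior K"
    using A.eventually_interior_near_facet[OF A.v] y C by simp
  moreover have "\<forall>\<^sub>F t in at_right 0. y + t *\<^sub>R n v \<in> interior K'"
    using B.eventually_interior_near_facet[OF B.v] y C' nn by simp
  ultimately have "\<forall>\<^sub>F t in at_right 0. y + t *\<^sub>R n v \<in> interior K \<inter> interior K'"
    by eventually_elim simp
  then have "\<exists>t. y + t *\<^sub>R n v \<in> interior K \<inter> interior K'"
    by (rule eventually_happens'[OF trivial_limit_at_right_real])
  then show False using interior_disjoint[OF K(1-3)] by blast
qed

lemma side_sign_iff:
  assumes K: "K \<in> Th" "F facet_of K" and \<mu>: "unit_normal F \<mu>"
  shows "(\<forall>x\<in>K. \<forall>y\<in>F. \<mu> \<bullet> x \<le> \<mu> \<bullet> y) \<longleftrightarrow> side_sign \<mu> K F = 1"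
    "(\<forall>x\<in>K. \<forall>y\<in>F. \<mu> \<bullet> y \<le> \<mu> \<bullet> x) \<longleftrightarrow> side_sign \<mu> K F = -1"
proof -
  show "(\<forall>x\<in>K. \<forall>y\<in>F. \<mu> \<bullet> x \<le> \<mu> \<bullet> y) \<longleftrightarrow> side_sign \<mu> K F = 1"
    by (auto simp: side_sign_def)
  obtain C n c v where "nsimplex_facet C n c v \<mu>" and C: "K = convex hull C" "F = convex hull (C - {v})"
    by (rule obtain_nsimplex_facet[OF K \<mu>])
  then interpret A: nsimplex_facet C n c v \<mu> by blast
  have le: "n v \<bullet> y \<le> n v \<bullet> x" if "x \<in> K" "y \<in> F" for x y
    using A.normal_le that C by blast
  obtain y where y: "y \<in> F" using A.facet_nonempty[OF A.v] C by blast
  have vK: "v \<in> K" using A.v C by (simp add: hull_inc)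
  have less: "n v \<bullet> y < n v \<bullet> v" using A.normal_less y C by blast
  show "(\<forall>x\<in>K. \<forall>y\<in>F. \<mu> \<bullet> y \<le> \<mu> \<bullet> x) \<longleftrightarrow> side_sign \<mu> K F = -1"
  proof
    assume *: "\<forall>x\<in>K. \<forall>y\<in>F. \<mu> \<bullet> y \<le> \<mu> \<bullet> x"
    show "side_sign \<mu> K F = -1"
    proof (rule ccontr)
      assume "side_sign \<mu> K F \<noteq> -1"
      then have "n v = - \<mu>" using side_sign_cases[of \<mu> K F] A.side_sign_eq C by auto
      then show False using less * vK y by force
    qed
  next
    assume "side_sign \<mu> K F = -1"
    then have "n v = \<mu>" using A.side_sign_eq C by auto
    then show "\<forall>x\<in>K. \<forall>y\<in>F. \<mu> \<bullet> y \<le> \<mu> \<bullet> x" using le by auto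
  qed
qed

text \<open>Justifies the definite descriptions in \<open>elem1\<close> and \<open>elem2\<close>:
  distinct elements at a facet have opposite signs, so each sign determines one element and there
  are exactly two.\<close>

lemma interior_face_elements:
  assumes e: "e \<in> interior_faces Th"
  shows "elem1 Th (\<nu> e) e \<in> Th" "elem2 Th (\<nu> e) e \<in> Th"
    "e facet_of elem1 Th (\<nu> e) e" "e facet_of elem2 Th (\<nu> e) e"
    "elem1 Th (\<nu> e) e \<noteq> elem2 Th (\<nu> e) e"
    "side_sign (\<nu> e) (elem1 Th (\<nu> e) e) e = 1" "side_sign (\<nu> e) (elem2 Th (\<nu> e) e) e = -1"
    "{K \<in> Th. e facet_of K} = {elem1 Th (\<nu> e) e, elem2 Th (\<nu> e) e}"
proof -
  note \<nu> = normals[OF e]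
  obtain K1 K2 where K: "K1 \<in> Th" "K2 \<in> Th" "K1 \<noteq> K2" "e facet_of K1" "e facet_of K2"
    by (rule interior_faces_facet[OF e])
  obtain A B where AB: "A \<in> Th" "B \<in> Th" "A \<noteq> B" "e facet_of A" "e facet_of B"
    "side_sign (\<nu> e) A e = 1" "side_sign (\<nu> e) B e = -1"
  proof (cases "side_sign (\<nu> e) K1 e = 1")
    case True
    then show thesis using that[of K1 K2] K side_sign_opposite[OF K \<nu>] by simp
  next
    case False
    then have "side_sign (\<nu> e) K1 e = -1" using side_sign_cases by blast
    then show thesis using that[of K2 K1] K side_sign_opposite[OF K \<nu>] by simp
  qed
  have dim_e: "aff_dim e = int CARD('n) - 1" using facet_aff_dim K by blast
  have uniq: "K = A" if "K \<in> Th" "e facet_of K" "side_sign (\<nu> e) K e = 1" for K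
    using side_sign_opposite[of K A e "\<nu> e"] that AB \<nu> by (metis one_neq_neg_one)
  have uniq2: "K = B" if "K \<in> Th" "e facet_of K" "side_sign (\<nu> e) K e = -1" for K
    using side_sign_opposite[of K B e "\<nu> e"] that AB \<nu> by (metis one_neq_neg_one minus_minus)
  have A: "elem1 Th (\<nu> e) e = A"
    unfolding elem1_def
  proof (rule the_equality)
    show "A \<in> Th \<and> e face_of A \<and> (\<forall>x\<in>A. \<forall>y\<in>e. \<nu> e \<bullet> x \<le> \<nu> e \<bullet> y)"
      using AB side_sign_iff(1)[OF AB(1,4) \<nu>] by (simp add: facet_of_def)
    fix K assume K: "K \<in> Th \<and> e face_of K \<and> (\<forall>x\<in>K. \<forall>y\<in>e. \<nu> e \<bullet> x \<le> \<nu> e \<bullet> y)"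
    then have "e facet_of K" using facet_iff_face dim_e by blast
    then show "K = A" using uniq K side_sign_iff(1)[OF _ _ \<nu>] by blast
  qed
  have B: "elem2 Th (\<nu> e) e = B"
    unfolding elem2_def
  proof (rule the_equality)
    show "B \<in> Th \<and> e face_of B \<and> (\<forall>x\<in>B. \<forall>y\<in>e. \<nu> e \<bullet> y \<le> \<nu> e \<bullet> x)"
      using AB side_sign_iff(2)[OF AB(2,5) \<nu>] by (simp add: facet_of_def)
    fix K assume K: "K \<in> Th \<and> e face_of K \<and> (\<forall>x\<in>K. \<forall>y\<in>e. \<nu> e \<bullet> y \<le> \<nu> e \<bullet> x)"
    then have "e facet_of K" using facet_iff_face dim_e by blast
    then show "K = B" using uniq2 K side_sign_iff(2)[OF _ _ \<nu>] by blast
  qed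
  show "elem1 Th (\<nu> e) e \<in> Th" "elem2 Th (\<nu> e) e \<in> Th"
    "e facet_of elem1 Th (\<nu> e) e" "e facet_of elem2 Th (\<nu> e) e"
    "elem1 Th (\<nu> e) e \<noteq> elem2 Th (\<nu> e) e"
    "side_sign (\<nu> e) (elem1 Th (\<nu> e) e) e = 1" "side_sign (\<nu> e) (elem2 Th (\<nu> e) e) e = -1"
    unfolding A B using AB by auto
  show "{K \<in> Th. e facet_of K} = {elem1 Th (\<nu> e) e, elem2 Th (\<nu> e) e}"
    unfolding A B using AB uniq uniq2 side_sign_cases by blast
qed

lemma boundary_facet_unique:
  assumes "F \<notin> interior_faces Th" "K \<in> Th" "K' \<in> Th" "F facet_of K" "F facet_of K'"
  shows "K = K'"
proof (rule ccontr)
  assume "K \<noteq> K'"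
  moreover have "F \<subseteq> K'" "F face_of K" using assms face_of_imp_subset by (auto simp: facet_of_def)
  ultimately show False
    using shared_facet_eq(3)[of K K' F] facet_aff_dim assms by blast
qed

text \<open>Boundary facets carry no prescribed normal. Any choice serves, since only the vanishing
  of the normal component matters there.\<close>

definition facet_normal :: "(real^'n) set \<Rightarrow> real^'n" where
  "facet_normal F = (if F \<in> interior_faces Th then \<nu> F else SOME \<mu>. unit_normal F \<mu>)"

lemma facet_normal: "F \<in> facets \<Longrightarrow> unit_normal F (facet_normal F)"
  unfolding facet_normal_def using normals someI_ex[OF unit_normal_exists] by simp

lemma sum_facets_swap:
  "(\<Sum>K\<in>Th. \<Sum>F | F facet_of K. T K F) = (\<Sum>F\<in>facets. \<Sum>K | K \<in> Th \<and> F facet_of K. T K F)"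
proof -
  have "(\<Sum>K\<in>Th. \<Sum>F | F facet_of K. T K F) = (\<Sum>K\<in>Th. \<Sum>F | F \<in> facets \<and> F facet_of K. T K F)"
    by (intro sum.cong refl) (auto simp: facets_def)
  also have "\<dots> = (\<Sum>F\<in>facets. \<Sum>K | K \<in> Th \<and> F facet_of K. T K F)"
    using finite_Th finite_facets by (rule sum.swap_restrict)
  finally show ?thesis .
qed

end


section \<open>Green's formula and discrete incompressibility\<close>

lemma polys_affine: "(\<lambda>x. a \<bullet> x + b) \<in> polys (Suc r)"
  unfolding inner_vec_def inner_real_def
  by (intro polys_add polys_sum polys_cmult polys_coord polys_const)

lemma polys_inner_vpolys: "p \<in> vpolys r \<Longrightarrow> (\<lambda>x. a \<bullet> p x) \<in> polys r"
  unfolding inner_vec_def inner_real_def vpolys_def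
  by (intro polys_sum polys_cmult) simp

lemma polys_sqdist: "(\<lambda>x. d - (x - y) \<bullet> (x - y)) \<in> polys 2"
proof -
  have 1: "(\<lambda>x. x $ i - y $ i) \<in> polys 1" for i
    using polys_add[OF polys_coord[of i 0] polys_const[of "- (y $ i)"]] by simp
  have "(\<lambda>x. (x $ i - y $ i) * (x $ i - y $ i)) \<in> polys 2" for i
    using polys_mult[OF 1 1] by (simp add: numeral_2_eq_2)
  then have "(\<lambda>x. (-1) * (\<Sum>i\<in>UNIV. (x $ i - y $ i) * (x $ i - y $ i))) \<in> polys 2"
    by (intro polys_cmult polys_sum)
  from polys_add[OF polys_const this] show ?thesis by (simp add: inner_vec_def)
qed

lemma vpolys_continuous: "p \<in> vpolys r \<Longrightarrow> continuous_on A p"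
proof -
  assume "p \<in> vpolys r"
  then have "continuous_on A (\<lambda>x. p x $ i)" for i
    unfolding vpolys_def by (auto intro: polys_continuous)
  then have "continuous_on A (\<lambda>x. \<chi> i. p x $ i)" by (rule continuous_on_vec_lambda)
  then show ?thesis by simp
qed

text \<open>The set where \<open>g\<close> is nonzero in the interior is open and null, hence empty.
  Continuity extends this to the closure of the interior, so a lower-dimensional part of
  \<open>K\<close> is not covered.\<close>

lemma continuous_integral_eq_0:
  fixes g :: "'a::euclidean_space \<Rightarrow> real"
  assumes K: "compact K" and g: "continuous_on UNIV g" and nonneg: "\<And>x. 0 \<le> g x"
    and zero: "(LINT x|lebesgue_on K. g x) = 0" and x: "x \<in> closure (interior K)"
  shows "g x = 0"
proof -
  have int: "integrable (lebesgue_on K) g"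
    using K g by (intro integrable_lebesgue_on_compact continuous_on_subset[OF g]) auto
  have Km: "K \<in> sets lebesgue" using K by (simp add: borel_compact)
  have "AE x in lebesgue_on K. g x = 0"
    using zero int nonneg by (subst (asm) integral_nonneg_eq_0_iff_AE) auto
  then have ae: "AE x in lebesgue. x \<in> K \<longrightarrow> g x = 0"
    using Km by (subst (asm) AE_restrict_space_iff) auto
  define U where "U = interior K \<inter> {x. g x \<noteq> 0}"
  have U: "open U"
    unfolding U_def using g by (intro open_Int open_interior open_Collect_neq continuous_on_const)
  have "AE x in lebesgue. x \<notin> U"
    using ae by eventually_elim (use interior_subset in \<open>auto simp: U_def\<close>)
  moreover have "U \<in> sets lebesgue" using U by simp
  ultimately have "negligible U"
    using AE_iff_null_sets[of U lebesgue] unfolding negligible_iff_null_sets by blast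
  then have "U = {}" using U open_not_negligible by blast
  then have "interior K \<subseteq> {x. g x = 0}" by (auto simp: U_def)
  moreover have "closed {x. g x = 0}" by (intro closed_Collect_eq g continuous_on_const)
  ultimately have "closure (interior K) \<subseteq> {x. g x = 0}" by (rule closure_minimal)
  then show ?thesis using x by blast
qed

context mesh begin

lemma sets_lebesgue[simp]: "\<Omega> \<in> sets lebesgue" "interior K \<in> sets lebesgue"
  by (simp_all add: Omega_eq)

lemma sets_lebesgue_Th[simp]: "K \<in> Th \<Longrightarrow> K \<in> sets lebesgue"
  using compact_Th by (simp add: borel_compact)

lemma LINT_interior:
  fixes f g :: "real^'n \<Rightarrow> 'b::{banach, second_countable_topology}"
  assumes K: "K \<in> Th" and eq: "\<And>x. x \<in> interior K \<Longrightarrow> f x = g x"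
  shows "integrable (lebesgue_on (interior K)) f \<longleftrightarrow> integrable (lebesgue_on K) g"
    "(LINT x|lebesgue_on (interior K). f x) = (LINT x|lebesgue_on K. g x)"
proof -
  have "indicator (interior K) x *\<^sub>R f x = indicator K x *\<^sub>R g x" if "x \<notin> frontier K" for x
    using that eq interior_subset[of K] closure_subset[of K] by (auto simp: indicator_def frontier_def)
  from LINT_cong_negligible[OF sets_lebesgue(2) sets_lebesgue_Th[OF K] negligible_frontier_Th[OF K] this]
  show "integrable (lebesgue_on (interior K)) f \<longleftrightarrow> integrable (lebesgue_on K) g"
    "(LINT x|lebesgue_on (interior K). f x) = (LINT x|lebesgue_on K. g x)" by auto
qed

lemma Omega_integral_interiors:
  fixes f :: "real^'n \<Rightarrow> 'b::{banach, second_countable_topology}"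
  assumes int: "\<And>K. K \<in> Th \<Longrightarrow> integrable (lebesgue_on (interior K)) f"
  shows "integrable (lebesgue_on \<Omega>) f"
    "(LINT x|lebesgue_on \<Omega>. f x) = (\<Sum>K\<in>Th. LINT x|lebesgue_on (interior K). f x)"
proof -
  have i: "integrable lebesgue (\<lambda>x. indicator (interior K) x *\<^sub>R f x)" if "K \<in> Th" for K
    using int[OF that] by (simp add: integrable_restrict_space)
  have "indicator \<Omega> x *\<^sub>R f x = (\<Sum>K\<in>Th. indicator (interior K) x *\<^sub>R f x)" if x: "x \<notin> skeleton" for x
  proof (cases "x \<in> \<Omega>")
    case True
    then obtain K where K: "K \<in> Th" "x \<in> interior K" using Omega_cover x by blast
    have "(\<Sum>K\<in>Th. indicator (interior K) x *\<^sub>R f x) = (\<Sum>K\<in>{K}. indicator (interior K) x *\<^sub>R f x)"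
      by (rule sum.mono_neutral_right) (use K finite_Th interior_disjoint in \<open>auto simp: indicator_def\<close>)
    then show ?thesis using True K by simp
  next
    case False
    then have "x \<notin> interior K" if "K \<in> Th" for K using interior_subset_Omega that by blast
    then show ?thesis using False by simp
  qed
  moreover have "AE x in lebesgue. x \<notin> skeleton"
    using negligible_skeleton by (simp add: negligible_iff_null_sets AE_not_in)
  ultimately have "AE x in lebesgue. indicator \<Omega> x *\<^sub>R f x = (\<Sum>K\<in>Th. indicator (interior K) x *\<^sub>R f x)"
    by (auto elim: eventually_mono)
  note * = integral_cong_AE_complete[OF completion.complete_measure_axioms this]
  show "integrable (lebesgue_on \<Omega>) f"
    using i by (simp add: integrable_restrict_space *(1))
  show "(LINT x|lebesgue_on \<Omega>. f x) = (\<Sum>K\<in>Th. LINT x|lebesgue_on (interior K). f x)"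
    using i by (simp add: integral_restrict_space *(2) Bochner_Integration.integral_sum)
qed

text \<open>The pieces \<open>g K\<close> are continuous up to the boundary and beyond, which yields
  integrability over the compact elements; the element boundaries form a null set.\<close>

lemma Omega_integral_pieces:
  fixes f :: "real^'n \<Rightarrow> 'b::{banach, second_countable_topology}"
  assumes eq: "\<And>K x. K \<in> Th \<Longrightarrow> x \<in> interior K \<Longrightarrow> f x = g K x"
    and cont: "\<And>K. K \<in> Th \<Longrightarrow> continuous_on UNIV (g K)"
  shows "integrable (lebesgue_on \<Omega>) f"
    "(LINT x|lebesgue_on \<Omega>. f x) = (\<Sum>K\<in>Th. LINT x|lebesgue_on K. g K x)"
proof -
  have "integrable (lebesgue_on (interior K)) f"
    "(LINT x|lebesgue_on (interior K). f x) = (LINT x|lebesgue_on K. g K x)" if K: "K \<in> Th" for K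
  proof -
    have "integrable (lebesgue_on K) (g K)"
      by (rule integrable_lebesgue_on_compact[OF compact_Th[OF K] continuous_on_subset[OF cont[OF K]]]) simp
    then show "integrable (lebesgue_on (interior K)) f"
      using LINT_interior(1)[OF K eq[OF K]] by simp
    show "(LINT x|lebesgue_on (interior K). f x) = (LINT x|lebesgue_on K. g K x)"
      by (rule LINT_interior(2)[OF K eq[OF K]])
  qed
  then show "integrable (lebesgue_on \<Omega>) f"
    "(LINT x|lebesgue_on \<Omega>. f x) = (\<Sum>K\<in>Th. LINT x|lebesgue_on K. g K x)"
    using Omega_integral_interiors[of f] by auto
qed

lemma integrable_interior:
  fixes f :: "real^'n \<Rightarrow> real"
  assumes "integrable (lebesgue_on \<Omega>) f" "K \<in> Th"
  shows "integrable (lebesgue_on (interior K)) f"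
proof -
  have "integrable lebesgue (\<lambda>x. indicator (interior K) x *\<^sub>R (indicator \<Omega> x *\<^sub>R f x))"
    using assms by (intro integrable_mult_indicator[OF sets_lebesgue(2)]) (simp add: integrable_restrict_space)
  moreover have "(\<lambda>x. indicator (interior K) x *\<^sub>R (indicator \<Omega> x *\<^sub>R f x)) =
      (\<lambda>x. indicator (interior K) x *\<^sub>R f x)"
    using interior_subset_Omega[OF assms(2)] by (auto simp: indicator_def fun_eq_iff)
  ultimately have "integrable lebesgue (\<lambda>x. indicator (interior K) x *\<^sub>R f x)" by (simp only:)
  then show ?thesis by (simp add: integrable_restrict_space)
qed

text \<open>From |d \<phi>| \<le> d^2 + \<phi>^2, where the second square is integrable because
  compact elements cover \<open>\<Omega>\<close>.\<close>

lemma integrable_L2_mult: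
  fixes d \<phi> :: "real^'n \<Rightarrow> real"
  assumes d: "d \<in> L2 \<Omega>" and \<phi>: "continuous_on UNIV \<phi>"
  shows "integrable (lebesgue_on \<Omega>) (\<lambda>x. d x * \<phi> x)"
proof (rule Bochner_Integration.integrable_bound)
  have "integrable (lebesgue_on \<Omega>) (\<lambda>x. (\<phi> x)\<^sup>2)"
    by (rule Omega_integral_pieces(1)[where g = "\<lambda>_ x. (\<phi> x)\<^sup>2"]) (auto intro!: continuous_intros \<phi>)
  then show "integrable (lebesgue_on \<Omega>) (\<lambda>x. (norm (d x))\<^sup>2 + (\<phi> x)\<^sup>2)"
    using d by (intro Bochner_Integration.integrable_add) (simp_all add: L2_def)
  have "\<phi> \<in> borel_measurable (lebesgue_on \<Omega>)"
    using borel_measurable_continuous_onI[OF \<phi>] by (simp add: measurable_completion measurable_restrict_space1)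
  then show "(\<lambda>x. d x * \<phi> x) \<in> borel_measurable (lebesgue_on \<Omega>)"
    using d by (intro borel_measurable_times) (simp_all add: L2_def)
  show "AE x in lebesgue_on \<Omega>. norm (d x * \<phi> x) \<le> norm ((norm (d x))\<^sup>2 + (\<phi> x)\<^sup>2)"
  proof (rule AE_I2)
    fix x
    have "0 \<le> (\<bar>d x\<bar> - \<bar>\<phi> x\<bar>)\<^sup>2" by simp
    then have "2 * (\<bar>d x\<bar> * \<bar>\<phi> x\<bar>) \<le> (d x)\<^sup>2 + (\<phi> x)\<^sup>2"
      by (simp add: power2_diff)
    moreover have "0 \<le> \<bar>d x\<bar> * \<bar>\<phi> x\<bar>" by simp
    ultimately have "\<bar>d x * \<phi> x\<bar> \<le> (d x)\<^sup>2 + (\<phi> x)\<^sup>2"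
      unfolding abs_mult by linarith
    then show "norm (d x * \<phi> x) \<le> norm ((norm (d x))\<^sup>2 + (\<phi> x)\<^sup>2)"
      by simp
  qed
qed

lemma elem_trace_eq:
  assumes K: "K \<in> Th" "x \<in> K" and eq: "\<And>y. y \<in> interior K \<Longrightarrow> f y = p y"
    and p: "continuous_on UNIV (p :: real^'n \<Rightarrow> 'b::t2_space)"
  shows "elem_trace K f x = p x"
  unfolding elem_trace_def
proof (rule tendsto_Lim)
  have "x islimpt interior K"
  proof (cases "x \<in> interior K")
    case True
    then have "x \<in> interior (interior K)" by simp
    then show ?thesis by (rule interior_limit_point)
  next
    case False
    then show ?thesis using closure_interior[OF K(1)] K(2) by (auto simp: closure_def)
  qed
  then show "at x within interior K \<noteq> bot" by (simp add: trivial_limit_within)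
  have "(p \<longlongrightarrow> p x) (at x within interior K)"
    using p by (metis UNIV_I continuous_on_def tendsto_within_subset subset_UNIV)
  moreover have "\<forall>\<^sub>F y in at x within interior K. p y = f y"
    using eq by (simp add: eventually_at_filter)
  ultimately show "(f \<longlongrightarrow> p x) (at x within interior K)"
    by (rule Lim_transform_eventually)
qed

lemma facet_subset: "K \<in> Th \<Longrightarrow> F facet_of K \<Longrightarrow> F \<subseteq> K"
  using face_of_imp_subset by (auto simp: facet_of_def)

lemma facet_disjoint_interior: "K \<in> Th \<Longrightarrow> F facet_of K \<Longrightarrow> F \<inter> interior K = {}"
  by (intro face_of_disjoint_interior) (auto simp: facet_of_def)

lemma face_AE_mem:
  assumes F: "F \<in> facets" and \<mu>: "unit_normal F \<mu>" shows "AE x in face_measure \<mu> F. x \<in> F"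
proof -
  obtain K where K: "K \<in> Th" "F facet_of K" using F by (auto simp: facets_def)
  obtain C n c v where "nsimplex_facet C n c v \<mu>" and C: "K = convex hull C" "F = convex hull (C - {v})"
    by (rule obtain_nsimplex_facet[OF K \<mu>])
  then interpret nsimplex_facet C n c v \<mu> by blast
  show ?thesis unfolding C(2) by (rule AE_face_measure_mem)
qed

lemma face_integrable:
  assumes F: "F \<in> facets" and \<mu>: "unit_normal F \<mu>" and g: "continuous_on UNIV (g :: real^'n \<Rightarrow> real)"
  shows "integrable (face_measure \<mu> F) g"
proof -
  obtain K where K: "K \<in> Th" "F facet_of K" using F by (auto simp: facets_def)
  obtain C n c v where "nsimplex_facet C n c v \<mu>" and C: "K = convex hull C" "F = convex hull (C - {v})"
    by (rule obtain_nsimplex_facet[OF K \<mu>])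
  then interpret nsimplex_facet C n c v \<mu> by blast
  show ?thesis unfolding C(2) by (rule integrable_face_measure[OF g])
qed

lemma face_integral_eq_0D:
  assumes F: "F \<in> facets" and \<mu>: "unit_normal F \<mu>" and g: "continuous_on UNIV g" "\<And>x. 0 \<le> g x"
    and zero: "(LINT x|face_measure \<mu> F. g x) = (0::real)" and y: "y \<in> rel_interior F"
  shows "g y = 0"
proof -
  obtain K where K: "K \<in> Th" "F facet_of K" using F by (auto simp: facets_def)
  obtain C n c v where "nsimplex_facet C n c v \<mu>" and C: "K = convex hull C" "F = convex hull (C - {v})"
    by (rule obtain_nsimplex_facet[OF K \<mu>])
  then interpret nsimplex_facet C n c v \<mu> by blast
  show ?thesis
    using continuous_integral_face_measure_eq_0[OF g, of y] zero rel_interior_facet[OF v, of y] y C by auto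
qed

lemma face_integral_cong:
  fixes f g :: "real^'n \<Rightarrow> real"
  assumes F: "F \<in> facets" and \<mu>: "unit_normal F \<mu>" and eq: "\<And>x. x \<in> F \<Longrightarrow> f x = g x"
  shows "(LINT x|face_measure \<mu> F. f x) = (LINT x|face_measure \<mu> F. g x)"
proof -
  have "AE x in face_measure \<mu> F. f x = g x"
    using face_AE_mem[OF F \<mu>] by eventually_elim (rule eq)
  then show ?thesis
    unfolding face_measure_def by (rule integral_cong_AE_complete(2)[OF completion.complete_measure_axioms])
qed

lemma green_element:
  assumes K: "K \<in> Th" and \<phi>: "smooth \<phi>" and p: "p \<in> vpolys r"
  shows "(LINT x|lebesgue_on K. \<phi> x * pdiv p x + p x \<bullet> grad \<phi> x) =
    (\<Sum>F | F facet_of K. side_sign (facet_normal F) K F *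
       (LINT x|face_measure (facet_normal F) F. \<phi> x * (facet_normal F \<bullet> p x)))"
proof -
  define G where "G i x = \<phi> x *\<^sub>R grad (\<lambda>x. p x $ i) x + p x $ i *\<^sub>R grad \<phi> x" for i x
  have pi: "(\<lambda>x. p x $ i) \<in> polys r" for i using p by (simp add: vpolys_def)
  have der: "GDERIV (\<lambda>x. (\<phi> x *\<^sub>R p x) $ i) x :> G i x" for i x
    unfolding G_def vector_scaleR_component real_scaleR_def
    by (intro GDERIV_mult smooth_GDERIV[OF \<phi>] polys_grad(1)[OF pi])
  have cont: "continuous_on UNIV (G i)" for i
    unfolding G_def
    by (intro continuous_intros smooth_continuous smooth_grad_continuous \<phi> smooth_polys[OF pi])
  have \<mu>: "unit_normal F (facet_normal F)" if "F facet_of K" for F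
    using facet_normal that K by (auto simp: facets_def)
  have "(LINT x|lebesgue_on K. (\<Sum>i\<in>UNIV. G i x $ i)) =
    (\<Sum>F | F facet_of K. side_sign (facet_normal F) K F *
      (LINT x|face_measure (facet_normal F) F. facet_normal F \<bullet> (\<phi> x *\<^sub>R p x)))"
    by (rule simplex_divergence_theorem[OF simplex_Th[OF K] dim \<mu> der cont])
  moreover have "(\<Sum>i\<in>UNIV. G i x $ i) = \<phi> x * pdiv p x + p x \<bullet> grad \<phi> x" for x
    by (simp add: G_def pdiv_def inner_vec_def sum.distrib sum_distrib_left)
  ultimately show ?thesis by simp
qed

text \<open>Localises the distributional divergence to one element: \<open>\<phi>\<close> times a smooth bump that
  increases to the indicator function of the open element is an admissible test function.\<close>

lemma weak_div_element:
  assumes d: "weak_div \<Omega> u d" and K: "K \<in> Th" and p: "p \<in> vpolys r"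
    and up: "\<And>x. x \<in> interior K \<Longrightarrow> u x = p x" and \<phi>: "smooth \<phi>"
  shows "(LINT x|lebesgue_on (interior K). d x * \<phi> x) = (LINT x|lebesgue_on K. \<phi> x * pdiv p x)"
proof -
  obtain C n c where "nsimplex C n c" and C: "K = convex hull C" by (rule obtain_nsimplex[OF K])
  then interpret nsimplex C n c by blast
  have c\<phi>: "continuous_on UNIV \<phi>" using \<phi> by (rule smooth_continuous)
  have cdiv: "continuous_on UNIV (pdiv p)" by (rule polys_continuous[OF pdiv_vpolys[OF p]])
  \<comment> \<open>A factor is nonzero only at distance more than \<open>1 / real (Suc k)\<close>
    from its facet, so the bump is supported in a compact subset \<open>S k\<close> of the open
    element.\<close>
  define bump where "bump k x = (\<Prod>v\<in>C. flat 0 (real (Suc k) * fdist v x - 1))" for k x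
  define \<Phi> where "\<Phi> k x = \<phi> x * bump k x" for k x
  define S where "S k = {x. \<forall>v\<in>C. 1 / real (Suc k) \<le> fdist v x}" for k
  have bump01: "0 \<le> bump k x" "bump k x \<le> 1" for k x
    unfolding bump_def by (auto intro!: prod_nonneg prod_le_1 simp: flat_def)
  have bump0: "bump k x = 0" if notS: "x \<notin> S k" for k x
  proof -
    obtain v where v: "v \<in> C" "fdist v x < 1 / real (Suc k)" using notS by (auto simp: S_def not_le simp del: of_nat_Suc)
    then have "real (Suc k) * fdist v x - 1 < 0" by (simp add: field_simps)
    then have "flat 0 (real (Suc k) * fdist v x - 1) = 0" by (simp add: flat_def)
    then show ?thesis unfolding bump_def using v finite_C by (intro prod_zero) auto
  qed
  have S_closed: "closed (S k)" for k
  proof -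
    have "S k = (\<Inter>v\<in>C. {x. 1 / real (Suc k) \<le> fdist v x})" by (auto simp: S_def)
    then show ?thesis by (auto intro!: closed_INT closed_Collect_le continuous_fdist continuous_on_const)
  qed
  have S_int: "S k \<subseteq> interior K" for k
    unfolding C interior_hull S_def
  proof clarify
    fix x v assume "\<forall>v\<in>C. 1 / real (Suc k) \<le> fdist v x" "v \<in> C"
    moreover have "0 < 1 / real (Suc k)" by simp
    ultimately show "0 < fdist v x" by (meson less_le_trans)
  qed
  have smooth_bump: "smooth (bump k)" for k
    unfolding bump_def
  proof (intro smooth_prod smooth_flat)
    fix v
    have "(\<lambda>x. real (Suc k) * fdist v x - 1) =
        (\<lambda>x. (real (Suc k) *\<^sub>R n v) \<bullet> x + (real (Suc k) * c v - 1))"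
      by (simp add: fdist_def distrib_left fun_eq_iff del: of_nat_Suc)
    then show "smooth (\<lambda>x. real (Suc k) * fdist v x - 1)"
      using smooth_polys[OF polys_affine] by (simp only:)
  qed
  have smooth_\<Phi>: "smooth (\<Phi> k)" for k
    unfolding \<Phi>_def by (intro smooth_mult \<phi> smooth_bump)
  have \<Phi>0: "\<Phi> k x = 0" if "x \<notin> S k" for k x using bump0[OF that] by (simp add: \<Phi>_def)
  have supp: "closure {x. \<Phi> k x \<noteq> 0} \<subseteq> S k" for k
    using \<Phi>0 by (intro closure_minimal S_closed) auto
  have test: "test_function \<Omega> (\<Phi> k)" for k
    unfolding test_function_def
  proof (intro conjI smooth_\<Phi>)
    have "{x. \<Phi> k x \<noteq> 0} \<subseteq> K" using \<Phi>0 S_int interior_subset by blast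
    then have "bounded {x. \<Phi> k x \<noteq> 0}"
      using compact_Th[OF K] compact_imp_bounded bounded_subset by blast
    then show "compact (closure {x. \<Phi> k x \<noteq> 0})" by simp
    show "closure {x. \<Phi> k x \<noteq> 0} \<subseteq> \<Omega>"
      using supp S_int interior_subset_Omega[OF K] by blast
  qed
  have grad0: "grad (\<Phi> k) x = 0" if "x \<notin> S k" for k x
  proof (rule grad_eqI)
    have "((\<lambda>x. 0) has_derivative (\<lambda>h. h \<bullet> 0)) (at x)" by simp
    then have "(\<Phi> k has_derivative (\<lambda>h. h \<bullet> 0)) (at x)"
      by (rule has_derivative_transform_within_open[OF _ open_Compl[OF S_closed[of k]]])
        (use that \<Phi>0 in auto)
    then show "GDERIV (\<Phi> k) x :> 0" by (simp add: gderiv_def)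
  qed
  have grad0': "grad (\<Phi> k) x = 0" if "x \<notin> interior K" for k x
    using grad0 S_int that by blast
  \<comment> \<open>\<open>\<Phi> k\<close> vanishes on the boundary of \<open>K\<close>. So Green's
    formula has no face terms, and the weak and the classical divergence have the same integral
    against it.\<close>
  have eq: "(LINT x|lebesgue_on (interior K). d x * \<Phi> k x) = (LINT x|lebesgue_on (interior K). \<Phi> k x * pdiv p x)" for k
  proof -
    have "L2_inner \<Omega> u (grad (\<Phi> k)) = - L2_inner \<Omega> d (\<Phi> k)"
      using d test unfolding weak_div_def by blast
    moreover have "L2_inner \<Omega> d (\<Phi> k) = (LINT x|lebesgue_on (interior K). d x * \<Phi> k x)"
      unfolding L2_inner_def
      by (rule LINT_cong_negligible(2)[where N = "{}"])
        (use \<Phi>0 S_int[of k] interior_subset_Omega[OF K] in \<open>auto simp: indicator_def\<close>)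
    moreover have "L2_inner \<Omega> u (grad (\<Phi> k)) = (LINT x|lebesgue_on (interior K). p x \<bullet> grad (\<Phi> k) x)"
      unfolding L2_inner_def
      by (rule LINT_cong_negligible(2)[where N = "{}"])
        (use grad0' up interior_subset_Omega[OF K] in \<open>auto simp: indicator_def\<close>)
    moreover have "(LINT x|lebesgue_on K. \<Phi> k x * pdiv p x + p x \<bullet> grad (\<Phi> k) x) = 0"
    proof -
      have "(LINT x|face_measure (facet_normal F) F. \<Phi> k x * (facet_normal F \<bullet> p x)) = 0"
        if F: "F facet_of K" for F
      proof -
        have Ff: "F \<in> facets" using F K by (auto simp: facets_def)
        have "(LINT x|face_measure (facet_normal F) F. \<Phi> k x * (facet_normal F \<bullet> p x)) =
            (LINT x|face_measure (facet_normal F) F. 0)"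
          by (rule face_integral_cong[OF Ff facet_normal[OF Ff]])
            (use \<Phi>0 S_int facet_disjoint_interior[OF K F] in force)
        then show ?thesis by simp
      qed
      then show ?thesis using green_element[OF K smooth_\<Phi> p] by simp
    qed
    moreover have "(LINT x|lebesgue_on K. \<Phi> k x * pdiv p x + p x \<bullet> grad (\<Phi> k) x) =
        (LINT x|lebesgue_on K. \<Phi> k x * pdiv p x) + (LINT x|lebesgue_on K. p x \<bullet> grad (\<Phi> k) x)"
    proof (rule Bochner_Integration.integral_add)
      show "integrable (lebesgue_on K) (\<lambda>x. \<Phi> k x * pdiv p x)"
        by (intro integrable_lebesgue_on_compact compact_Th[OF K] continuous_intros
            smooth_continuous[OF smooth_\<Phi>] continuous_on_subset[OF cdiv]) simp
      show "integrable (lebesgue_on K) (\<lambda>x. p x \<bullet> grad (\<Phi> k) x)"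
        by (intro integrable_lebesgue_on_compact compact_Th[OF K] continuous_intros
            smooth_grad_continuous[OF smooth_\<Phi>] vpolys_continuous[OF p])
    qed
    ultimately show ?thesis
      using LINT_interior(2)[OF K refl, of "\<lambda>x. p x \<bullet> grad (\<Phi> k) x"]
        LINT_interior(2)[OF K refl, of "\<lambda>x. \<Phi> k x * pdiv p x"] by linarith
  qed
  \<comment> \<open>At an interior point the arguments of \<open>flat 0\<close> tend to infinity and
    exp (- 1/t) tends to 1. Since the bump is at most 1, \<open>g\<close> dominates.\<close>
  have lim: "(\<lambda>k. LINT x|lebesgue_on (interior K). g x * bump k x) \<longlonglongrightarrow> (LINT x|lebesgue_on (interior K). g x)"
    if g: "integrable (lebesgue_on (interior K)) g" for g :: "real^'n \<Rightarrow> real"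
  proof (rule integral_dominated_convergence)
    show "g \<in> borel_measurable (lebesgue_on (interior K))"
      using g by (rule borel_measurable_integrable)
    have "bump k \<in> borel_measurable (lebesgue_on (interior K))" for k
      using borel_measurable_continuous_onI[OF smooth_continuous[OF smooth_bump]]
      by (simp add: measurable_completion measurable_restrict_space1)
    then show "(\<lambda>x. g x * bump k x) \<in> borel_measurable (lebesgue_on (interior K))" for k
      using borel_measurable_integrable[OF g] by (intro borel_measurable_times)
    show "integrable (lebesgue_on (interior K)) (\<lambda>x. \<bar>g x\<bar>)" using g by (rule integrable_abs)
    show "AE x in lebesgue_on (interior K). norm (g x * bump k x) \<le> \<bar>g x\<bar>" for k
      using bump01 by (intro AE_I2) (simp add: abs_mult mult_left_le)
    have "(\<lambda>k. g x * bump k x) \<longlonglongrightarrow> g x" if x: "x \<in> interior K" for x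
    proof -
      have "(\<lambda>k. bump k x) \<longlonglongrightarrow> (\<Prod>v\<in>C. 1)"
        unfolding bump_def
      proof (rule tendsto_prod)
        fix v assume v: "v \<in> C"
        have pos: "0 < fdist v x" using x v unfolding C interior_hull by blast
        have "filterlim (\<lambda>k. real (Suc k)) at_top sequentially"
          by (rule filterlim_compose[OF filterlim_real_sequentially filterlim_Suc])
        then have "filterlim (\<lambda>k. real (Suc k) * fdist v x) at_top sequentially"
          by (rule filterlim_at_top_mult_tendsto_pos[OF tendsto_const pos])
        then have *: "filterlim (\<lambda>k. - 1 + real (Suc k) * fdist v x) at_top sequentially"
          by (rule filterlim_tendsto_add_at_top[OF tendsto_const])
        then have "(\<lambda>k. inverse (- 1 + real (Suc k) * fdist v x)) \<longlonglongrightarrow> 0"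
          by (rule tendsto_inverse_0_at_top)
        then have "(\<lambda>k. exp (- inverse (- 1 + real (Suc k) * fdist v x))) \<longlonglongrightarrow> exp (- 0)"
          by (intro tendsto_intros)
        moreover have "\<forall>\<^sub>F k in sequentially. exp (- inverse (- 1 + real (Suc k) * fdist v x)) =
            flat 0 (real (Suc k) * fdist v x - 1)"
        proof -
          have "\<forall>\<^sub>F k in sequentially. 0 < - 1 + real (Suc k) * fdist v x"
            using * unfolding filterlim_at_top_dense by blast
          then show ?thesis by eventually_elim (simp add: flat_def inverse_eq_divide)
        qed
        ultimately show "(\<lambda>k. flat 0 (real (Suc k) * fdist v x - 1)) \<longlonglongrightarrow> 1"
          using Lim_transform_eventually by fastforce
      qed
      then show ?thesis using tendsto_mult[OF tendsto_const[of "g x"]] by fastforce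
    qed
    then show "AE x in lebesgue_on (interior K). (\<lambda>k. g x * bump k x) \<longlonglongrightarrow> g x"
      by (intro AE_I2) simp
  qed
  have "d \<in> L2 \<Omega>" using d by (simp add: weak_div_def)
  then have "integrable (lebesgue_on (interior K)) (\<lambda>x. d x * \<phi> x)"
    by (intro integrable_interior[OF _ K] integrable_L2_mult c\<phi>)
  note 1 = lim[OF this]
  have "integrable (lebesgue_on K) (\<lambda>x. \<phi> x * pdiv p x)"
    by (intro integrable_lebesgue_on_compact compact_Th[OF K] continuous_intros
        continuous_on_subset[OF c\<phi>] continuous_on_subset[OF cdiv]) simp_all
  then have "integrable (lebesgue_on (interior K)) (\<lambda>x. \<phi> x * pdiv p x)"
    using LINT_interior(1)[OF K refl] by blast
  note 2 = lim[OF this]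
  have "(LINT x|lebesgue_on (interior K). d x * \<phi> x * bump k x) =
      (LINT x|lebesgue_on (interior K). \<phi> x * pdiv p x * bump k x)" for k
    using eq[of k] by (simp add: \<Phi>_def mult_ac)
  then have "(LINT x|lebesgue_on (interior K). d x * \<phi> x) = (LINT x|lebesgue_on (interior K). \<phi> x * pdiv p x)"
    using 1 2 LIMSEQ_unique by simp
  then show ?thesis using LINT_interior(2)[OF K refl, of "\<lambda>x. \<phi> x * pdiv p x"] by simp
qed

lemma DG_glue:
  assumes "\<And>K. K \<in> Th \<Longrightarrow> p K \<in> polys s"
  obtains q where "q \<in> DG \<Omega> Th s" "\<And>K x. K \<in> Th \<Longrightarrow> x \<in> interior K \<Longrightarrow> q x = p K x"
proof -
  have cp: "continuous_on UNIV (p K)" if "K \<in> Th" for K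
    using polys_continuous[OF assms[OF that]] .
  define q where "q x = (\<Sum>K\<in>Th. indicator (interior K) x * p K x)" for x
  have q_eq: "q x = p K x" if K: "K \<in> Th" "x \<in> interior K" for K x
  proof -
    have "(\<Sum>K\<in>Th. indicator (interior K) x * p K x) = (\<Sum>K\<in>{K}. indicator (interior K) x * p K x)"
      by (rule sum.mono_neutral_right) (use K finite_Th interior_disjoint in \<open>auto simp: indicator_def\<close>)
    then show ?thesis using K(2) by (simp add: q_def)
  qed
  have "q \<in> borel_measurable borel"
    unfolding q_def[abs_def]
    by (intro borel_measurable_sum borel_measurable_times borel_measurable_indicator
        borel_measurable_continuous_onI[OF cp]) auto
  then have "q \<in> borel_measurable (lebesgue_on \<Omega>)"
    by (simp add: measurable_completion measurable_restrict_space1)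
  moreover have "integrable (lebesgue_on \<Omega>) (\<lambda>x. (norm (q x))\<^sup>2)"
    by (rule Omega_integral_pieces(1)[where g = "\<lambda>K x. (p K x)\<^sup>2"])
      (auto simp: q_eq intro!: continuous_intros cp)
  ultimately have "q \<in> DG \<Omega> Th s"
    unfolding DG_def L2_def piecewise_def using q_eq assms by auto
  then show ?thesis using that q_eq by blast
qed

text \<open>The piecewise divergence is an admissible multiplier in the discrete incompressibility
  condition, hence it vanishes.\<close>

lemma discretely_div_free:
  assumes u: "u \<in> H0_div \<Omega>" and p: "\<And>K. K \<in> Th \<Longrightarrow> p K \<in> vpolys r"
    and up: "\<And>K x. K \<in> Th \<Longrightarrow> x \<in> interior K \<Longrightarrow> u x = p K x"
    and deg: "\<And>K. K \<in> Th \<Longrightarrow> pdiv (p K) \<in> polys s"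
    and incomp: "\<And>q. q \<in> DG \<Omega> Th s \<Longrightarrow> L2_inner \<Omega> (divergence \<Omega> u) q = 0"
  shows "\<And>K x. K \<in> Th \<Longrightarrow> x \<in> K \<Longrightarrow> pdiv (p K) x = 0"
    and "smooth \<phi> \<Longrightarrow> (\<Sum>K\<in>Th. LINT x|lebesgue_on K. p K x \<bullet> grad \<phi> x) = 0"
proof -
  define d where "d = divergence \<Omega> u"
  have d: "weak_div \<Omega> u d"
    using u unfolding d_def divergence_def H0_div_def by (blast intro: someI_ex[of "weak_div \<Omega> u"])
  then have dL2: "d \<in> L2 \<Omega>" by (simp add: weak_div_def)
  have cdiv: "continuous_on A (pdiv (p K))" if "K \<in> Th" for K A
    using polys_continuous[OF deg[OF that]] .
  have el: "(LINT x|lebesgue_on (interior K). d x * \<phi> x) = (LINT x|lebesgue_on K. \<phi> x * pdiv (p K) x)"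
    if "K \<in> Th" "smooth \<phi>" for K \<phi>
    using weak_div_element[OF d that(1) p[OF that(1)] up[OF that(1)] that(2)] .
  obtain q where q: "q \<in> DG \<Omega> Th s" and q_eq: "\<And>K x. K \<in> Th \<Longrightarrow> x \<in> interior K \<Longrightarrow> q x = pdiv (p K) x"
    using DG_glue[of "\<lambda>K. pdiv (p K)" s] deg by blast
  have "L2_inner \<Omega> d q = 0" unfolding d_def using q by (rule incomp)
  \<comment> \<open>On an element \<open>d\<close> is known only through integrals against smooth
    functions. Taking \<open>pdiv (p K)\<close> itself as the smooth function produces a sum of
    squares.\<close>
  moreover have "L2_inner \<Omega> d q = (\<Sum>K\<in>Th. LINT x|lebesgue_on K. (pdiv (p K) x)\<^sup>2)"
  proof -
    have int: "integrable (lebesgue_on (interior K)) (\<lambda>x. d x * q x)"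
      "(LINT x|lebesgue_on (interior K). d x * q x) = (LINT x|lebesgue_on K. (pdiv (p K) x)\<^sup>2)" if K: "K \<in> Th" for K
    proof -
      have i: "integrable (lebesgue_on (interior K)) (\<lambda>x. d x * pdiv (p K) x)"
        by (intro integrable_interior[OF _ K] integrable_L2_mult dL2 cdiv[OF K])
      have *: "d x * q x = d x * pdiv (p K) x" if "x \<in> space (lebesgue_on (interior K))" for x
        using that q_eq[OF K] by (simp add: space_restrict_space)
      have "integrable (lebesgue_on (interior K)) (\<lambda>x. d x * q x) \<longleftrightarrow>
          integrable (lebesgue_on (interior K)) (\<lambda>x. d x * pdiv (p K) x)"
        by (rule Bochner_Integration.integrable_cong[OF refl]) (rule *)
      with i show "integrable (lebesgue_on (interior K)) (\<lambda>x. d x * q x)" by simp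
      have "(LINT x|lebesgue_on (interior K). d x * q x) = (LINT x|lebesgue_on (interior K). d x * pdiv (p K) x)"
        by (rule Bochner_Integration.integral_cong[OF refl]) (rule *)
      then show "(LINT x|lebesgue_on (interior K). d x * q x) = (LINT x|lebesgue_on K. (pdiv (p K) x)\<^sup>2)"
        using el[OF K smooth_polys[OF deg[OF K]]] by (simp add: power2_eq_square)
    qed
    show ?thesis
      unfolding L2_inner_def inner_real_def using Omega_integral_interiors(2)[OF int(1)] int(2) by simp
  qed
  ultimately have "(\<Sum>K\<in>Th. LINT x|lebesgue_on K. (pdiv (p K) x)\<^sup>2) = 0" by simp
  then have zero: "(LINT x|lebesgue_on K. (pdiv (p K) x)\<^sup>2) = 0" if "K \<in> Th" for K
    using that finite_Th by (subst (asm) sum_nonneg_eq_0_iff) auto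
  show div0: "pdiv (p K) x = 0" if K: "K \<in> Th" and x: "x \<in> K" for K x
  proof -
    have "(pdiv (p K) x)\<^sup>2 = 0"
      by (rule continuous_integral_eq_0[OF compact_Th[OF K] _ _ zero[OF K]])
        (use x closure_interior[OF K] in \<open>auto intro!: continuous_intros cdiv[OF K]\<close>)
    then show ?thesis by simp
  qed
  show "(\<Sum>K\<in>Th. LINT x|lebesgue_on K. p K x \<bullet> grad \<phi> x) = 0" if \<phi>: "smooth \<phi>"
  proof -
    have c\<phi>: "continuous_on UNIV \<phi>" using \<phi> by (rule smooth_continuous)
    have "(LINT x|lebesgue_on (interior K). d x * \<phi> x) = 0" if K: "K \<in> Th" for K
    proof -
      have "(LINT x|lebesgue_on K. \<phi> x * pdiv (p K) x) = (LINT x|lebesgue_on K. 0)"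
        by (rule Bochner_Integration.integral_cong[OF refl]) (simp add: space_restrict_space div0[OF K])
      then show ?thesis using el[OF K \<phi>] by simp
    qed
    then have "L2_inner \<Omega> d \<phi> = 0"
      unfolding L2_inner_def inner_real_def
      by (subst Omega_integral_interiors(2)) (auto intro: integrable_interior integrable_L2_mult[OF dL2 c\<phi>])
    \<comment> \<open>\<open>\<phi>\<close> may be nonzero on the boundary of the domain; the
      vanishing normal trace demanded by \<open>H0_div\<close> enters here.\<close>
    then have "L2_inner \<Omega> u (grad \<phi>) = 0"
      using u \<phi> unfolding H0_div_def d_def by auto
    moreover have "L2_inner \<Omega> u (grad \<phi>) = (\<Sum>K\<in>Th. LINT x|lebesgue_on K. p K x \<bullet> grad \<phi> x)"
      unfolding L2_inner_def
      by (rule Omega_integral_pieces(2))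
        (auto simp: up intro!: continuous_intros vpolys_continuous[OF p] smooth_grad_continuous[OF \<phi>])
    ultimately show ?thesis by simp
  qed
qed

text \<open>Testing with a bump that lives near one point of the relative interior of a single facet
  shows that normal components match there, and vanish on boundary facets.\<close>

lemma normal_trace_balance:
  assumes p: "\<And>K. K \<in> Th \<Longrightarrow> p K \<in> vpolys r"
    and div0: "\<And>K x. K \<in> Th \<Longrightarrow> x \<in> K \<Longrightarrow> pdiv (p K) x = 0"
    and weak: "\<And>\<phi>. smooth \<phi> \<Longrightarrow> (\<Sum>K\<in>Th. LINT x|lebesgue_on K. p K x \<bullet> grad \<phi> x) = 0"
    and F: "F \<in> facets" and x: "x \<in> F"
  shows "(\<Sum>K | K \<in> Th \<and> F facet_of K. side_sign (facet_normal F) K F * (facet_normal F \<bullet> p K x)) = 0"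
proof -
  \<comment> \<open>On an interior face this is the jump of the normal component; on a boundary
    facet the sum has one term, the outward normal component.\<close>
  define g where "g x = (\<Sum>K | K \<in> Th \<and> F facet_of K. side_sign (facet_normal F) K F * (facet_normal F \<bullet> p K x))" for x
  have g_poly: "g \<in> polys r"
    unfolding g_def using p by (intro polys_sum polys_cmult polys_inner_vpolys) auto
  have rel: "g y = 0" if y: "y \<in> rel_interior F" for y
  proof -
    define A where "A = \<Union>(facets - {F})"
    have cl: "closed F'" if "F' \<in> facets" for F'
      using that compact_Th face_of_imp_compact convex_Th compact_imp_closed
      unfolding facets_def facet_of_def by blast
    have "closed A" unfolding A_def using finite_facets cl by (intro closed_Union) auto
    moreover have "y \<notin> A" unfolding A_def using rel_interior_facets_disjoint[OF F _ _ y] by blast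
    ultimately obtain \<delta> where \<delta>: "0 < \<delta>" "ball y \<delta> \<subseteq> - A"
      using open_contains_ball[of "- A"] by (auto simp: open_Compl)
    define \<theta> where "\<theta> x = flat 0 (\<delta>\<^sup>2 - (x - y) \<bullet> (x - y))" for x
    have \<theta>_nonneg: "0 \<le> \<theta> x" for x by (simp add: \<theta>_def flat_def)
    have \<theta>_y: "0 < \<theta> y" using \<delta>(1) by (simp add: \<theta>_def flat_def)
    have \<theta>_A: "\<theta> x = 0" if "x \<in> A" for x
    proof -
      have "\<delta> \<le> norm (x - y)" using that \<delta>(2) by (force simp: dist_norm norm_minus_commute)
      then have "\<delta>\<^sup>2 \<le> (norm (x - y))\<^sup>2" using \<delta>(1) by (intro power_mono) auto
      then show ?thesis by (simp add: \<theta>_def flat_def power2_norm_eq_inner)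
    qed
    have smooth_\<theta>: "smooth \<theta>"
      unfolding \<theta>_def by (intro smooth_flat smooth_polys[OF polys_sqdist])
    \<comment> \<open>With the factor \<open>g\<close> the surviving face term becomes the integral
      of \<open>\<theta> x * (g x)\<^sup>2\<close>, whose integrand is nonnegative.\<close>
    define \<phi> where "\<phi> x = \<theta> x * g x" for x
    have \<phi>: "smooth \<phi>" unfolding \<phi>_def by (intro smooth_mult smooth_\<theta> smooth_polys[OF g_poly])
    let ?T = "\<lambda>K F. side_sign (facet_normal F) K F *
        (LINT x|face_measure (facet_normal F) F. \<phi> x * (facet_normal F \<bullet> p K x))"
    have "0 = (\<Sum>K\<in>Th. LINT x|lebesgue_on K. p K x \<bullet> grad \<phi> x)" using weak[OF \<phi>] by simp
    also have "\<dots> = (\<Sum>K\<in>Th. LINT x|lebesgue_on K. \<phi> x * pdiv (p K) x + p K x \<bullet> grad \<phi> x)"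
      by (intro sum.cong refl Bochner_Integration.integral_cong) (simp add: space_restrict_space div0)
    also have "\<dots> = (\<Sum>K\<in>Th. \<Sum>F | F facet_of K. ?T K F)"
      by (intro sum.cong refl green_element[OF _ \<phi> p])
    also have "\<dots> = (\<Sum>F\<in>facets. \<Sum>K | K \<in> Th \<and> F facet_of K. ?T K F)"
      by (rule sum_facets_swap)
    also have "\<dots> = (\<Sum>F\<in>{F}. \<Sum>K | K \<in> Th \<and> F facet_of K. ?T K F)"
    proof (rule sum.mono_neutral_right[OF finite_facets])
      show "\<forall>F'\<in>facets - {F}. (\<Sum>K | K \<in> Th \<and> F' facet_of K. ?T K F') = 0"
      proof (intro ballI sum.neutral)
        fix F' K assume F': "F' \<in> facets - {F}"
        have "(LINT x|face_measure (facet_normal F') F'. \<phi> x * (facet_normal F' \<bullet> p K x)) =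
            (LINT x|face_measure (facet_normal F') F'. 0)"
          using F' \<theta>_A by (intro face_integral_cong facet_normal) (auto simp: \<phi>_def A_def)
        then show "?T K F' = 0" by simp
      qed
    qed (use F in auto)
    also have "\<dots> = (\<Sum>K | K \<in> Th \<and> F facet_of K. ?T K F)" by simp
    also have "\<dots> = (\<Sum>K | K \<in> Th \<and> F facet_of K.
        LINT x|face_measure (facet_normal F) F. side_sign (facet_normal F) K F * (\<phi> x * (facet_normal F \<bullet> p K x)))"
      by simp
    also have "\<dots> = (LINT x|face_measure (facet_normal F) F. (\<Sum>K | K \<in> Th \<and> F facet_of K.
        side_sign (facet_normal F) K F * (\<phi> x * (facet_normal F \<bullet> p K x))))"
      by (rule Bochner_Integration.integral_sum[symmetric])
        (use p in \<open>auto intro!: face_integrable[OF F facet_normal[OF F]] continuous_intros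
          smooth_continuous[OF \<phi>] vpolys_continuous\<close>)
    also have "\<dots> = (LINT x|face_measure (facet_normal F) F. \<theta> x * (g x)\<^sup>2)"
    proof (intro Bochner_Integration.integral_cong refl)
      fix x
      have "(\<Sum>K | K \<in> Th \<and> F facet_of K. side_sign (facet_normal F) K F * (\<phi> x * (facet_normal F \<bullet> p K x))) = \<phi> x * g x"
        unfolding g_def sum_distrib_left by (intro sum.cong refl) (simp add: mult_ac)
      then show "(\<Sum>K | K \<in> Th \<and> F facet_of K. side_sign (facet_normal F) K F * (\<phi> x * (facet_normal F \<bullet> p K x))) = \<theta> x * (g x)\<^sup>2"
        by (simp add: \<phi>_def power2_eq_square)
    qed
    finally have "(LINT x|face_measure (facet_normal F) F. \<theta> x * (g x)\<^sup>2) = 0" by simp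
    moreover have "continuous_on UNIV (\<lambda>x. \<theta> x * (g x)\<^sup>2)"
      by (intro continuous_intros smooth_continuous[OF smooth_\<theta>] polys_continuous[OF g_poly])
    moreover have "0 \<le> \<theta> x * (g x)\<^sup>2" for x using \<theta>_nonneg by simp
    ultimately have "\<theta> y * (g y)\<^sup>2 = 0"
      using face_integral_eq_0D[OF F facet_normal[OF F], where g = "\<lambda>x. \<theta> x * (g x)\<^sup>2" and y = y] y
      by blast
    then show ?thesis using \<theta>_y by simp
  qed
  \<comment> \<open>The bump argument reaches relative interior points only; continuity of
    \<open>g\<close> carries the result to the rest of the facet.\<close>
  have "closed {x. g x = 0}"
    by (intro closed_Collect_eq continuous_on_const polys_continuous[OF g_poly])
  then have "closure (rel_interior F) \<subseteq> {x. g x = 0}"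
    using rel by (intro closure_minimal) auto
  moreover have "convex F" using F convex_Th face_of_imp_convex by (auto simp: facets_def facet_of_def)
  then have "F \<subseteq> closure (rel_interior F)"
    using convex_closure_rel_interior closure_subset by blast
  ultimately have "g x = 0" using x by blast
  then show ?thesis unfolding g_def .
qed

end


section \<open>The transport form vanishes on the diagonal\<close>

context mesh begin

lemma tr_eq:
  assumes e: "e \<in> interior_faces Th" and x: "x \<in> e"
    and f: "\<And>K x. K \<in> Th \<Longrightarrow> x \<in> interior K \<Longrightarrow> f x = q K x"
    and q: "\<And>K. K \<in> Th \<Longrightarrow> continuous_on UNIV (q K :: real^'n \<Rightarrow> 'b::t2_space)"
  shows "tr1 Th \<nu> e f x = q (elem1 Th (\<nu> e) e) x" "tr2 Th \<nu> e f x = q (elem2 Th (\<nu> e) e) x"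
proof -
  note E = interior_face_elements[OF e]
  have "x \<in> elem1 Th (\<nu> e) e" "x \<in> elem2 Th (\<nu> e) e"
    using x facet_subset[OF E(1,3)] facet_subset[OF E(2,4)] by auto
  then show "tr1 Th \<nu> e f x = q (elem1 Th (\<nu> e) e) x" "tr2 Th \<nu> e f x = q (elem2 Th (\<nu> e) e) x"
    unfolding tr1_def tr2_def using E(1,2) by (auto intro!: elem_trace_eq f q)
qed

lemma interior_face_integral_cong:
  fixes f g :: "real^'n \<Rightarrow> real"
  assumes "e \<in> interior_faces Th" "\<And>x. x \<in> e \<Longrightarrow> f x = g x"
  shows "(LINT x|face_measure (\<nu> e) e. f x) = (LINT x|face_measure (\<nu> e) e. g x)"
  using assms interior_faces_subset normals by (intro face_integral_cong) auto

lemma LINT_Th_cong: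
  fixes f g :: "real^'n \<Rightarrow> real"
  assumes "K \<in> Th" "\<And>x. x \<in> interior K \<Longrightarrow> f x = g x"
  shows "(LINT x|lebesgue_on K. f x) = (LINT x|lebesgue_on K. g x)"
  using LINT_interior(2)[OF assms(1) refl, of f] LINT_interior(2)[OF assms] by simp

lemma grad_cong_interior:
  assumes "x \<in> interior K" "\<And>y. y \<in> interior K \<Longrightarrow> f y = q y" "GDERIV q x :> D"
  shows "grad f x = D"
proof (rule grad_eqI)
  have "(f has_derivative (\<lambda>h. h \<bullet> D)) (at x)"
    using assms(3) unfolding gderiv_def
    by (rule has_derivative_transform_within_open[OF _ open_interior assms(1)]) (simp add: assms(2))
  then show "GDERIV f x :> D" by (simp add: gderiv_def)
qed

lemma jump_const:
  assumes e: "e \<in> interior_faces Th" "x \<in> e"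
  shows "jump Th \<nu> e (\<lambda>_. a) x = 0"
  using tr_eq[OF e, of "\<lambda>_. a" "\<lambda>_ _. a"] by (simp add: jump_def)

lemma b_form_const: "b_form Th \<nu> u (\<lambda>_. a) g = 0"
proof -
  have "(LINT x|face_measure (\<nu> e) e. (tr1 Th \<nu> e u x \<bullet> jump Th \<nu> e (\<lambda>_. a) x) * avg Th \<nu> e g x) = 0"
    if e: "e \<in> interior_faces Th" for e
  proof -
    have "(LINT x|face_measure (\<nu> e) e. (tr1 Th \<nu> e u x \<bullet> jump Th \<nu> e (\<lambda>_. a) x) * avg Th \<nu> e g x) =
        (LINT x|face_measure (\<nu> e) e. 0)"
      by (intro interior_face_integral_cong[OF e]) (simp add: jump_const[OF e])
    then show ?thesis by simp
  qed
  moreover have "grad (\<lambda>_. a) x = 0" for x :: "real^'n" by (rule grad_eqI[OF GDERIV_const])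
  ultimately show ?thesis by (simp add: b_form_def)
qed

text \<open>On every face the jump of \<open>f\<^sup>2\<close> is twice the jump of \<open>f\<close> times its average, so this is the
  integral of \<open>u \<cdot> \<nabla>(f\<^sup>2/2)\<close> integrated by parts element by element.\<close>

lemma b_form_self:
  assumes p: "\<And>K. K \<in> Th \<Longrightarrow> p K \<in> vpolys r"
    and up: "\<And>K x. K \<in> Th \<Longrightarrow> x \<in> interior K \<Longrightarrow> u x = p K x"
    and div0: "\<And>K x. K \<in> Th \<Longrightarrow> x \<in> K \<Longrightarrow> pdiv (p K) x = 0"
    and weak: "\<And>\<phi>. smooth \<phi> \<Longrightarrow> (\<Sum>K\<in>Th. LINT x|lebesgue_on K. p K x \<bullet> grad \<phi> x) = 0"
    and q: "\<And>K. K \<in> Th \<Longrightarrow> q K \<in> polys m"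
    and fq: "\<And>K x. K \<in> Th \<Longrightarrow> x \<in> interior K \<Longrightarrow> f x = q K x"
  shows "b_form Th \<nu> u f f = 0"
proof -
  let ?\<phi> = "\<lambda>K x. q K x * q K x"
  have cq: "continuous_on A (q K)" if "K \<in> Th" for K A using polys_continuous[OF q[OF that]] .
  have cp: "continuous_on A (p K)" if "K \<in> Th" for K A using vpolys_continuous[OF p[OF that]] .
  have \<phi>: "smooth (?\<phi> K)" if "K \<in> Th" for K using smooth_mult smooth_polys[OF q[OF that]] by blast
  have grad_\<phi>: "grad (?\<phi> K) x = (2 * q K x) *\<^sub>R grad (q K) x" if "K \<in> Th" for K x
  proof (rule grad_eqI, rule GDERIV_subst)
    show "GDERIV (?\<phi> K) x :> q K x *\<^sub>R grad (q K) x + q K x *\<^sub>R grad (q K) x"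
      by (intro GDERIV_mult polys_grad(1)[OF q[OF that]])
    show "q K x *\<^sub>R grad (q K) x + q K x *\<^sub>R grad (q K) x = (2 * q K x) *\<^sub>R grad (q K) x"
      by (simp flip: scaleR_add_left)
  qed
  let ?T = "\<lambda>K F. side_sign (facet_normal F) K F *
        (LINT x|face_measure (facet_normal F) F. ?\<phi> K x * (facet_normal F \<bullet> p K x))"
  let ?J = "\<lambda>e x. (tr1 Th \<nu> e u x \<bullet> jump Th \<nu> e f x) * avg Th \<nu> e f x"
  have vol: "2 * (LINT x|lebesgue_on K. (u x \<bullet> grad f x) * f x) = (\<Sum>F | F facet_of K. ?T K F)"
    if K: "K \<in> Th" for K
  proof -
    have "2 * (LINT x|lebesgue_on K. (u x \<bullet> grad f x) * f x) =
        (LINT x|lebesgue_on K. 2 * ((u x \<bullet> grad f x) * f x))" by simp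
    also have "\<dots> = (LINT x|lebesgue_on K. ?\<phi> K x * pdiv (p K) x + p K x \<bullet> grad (?\<phi> K) x)"
    proof (rule LINT_Th_cong[OF K])
      fix x assume x: "x \<in> interior K"
      have "grad f x = grad (q K) x"
        using grad_cong_interior[OF x fq[OF K] polys_grad(1)[OF q[OF K]]] .
      moreover have "x \<in> K" using x interior_subset by blast
      ultimately show "2 * ((u x \<bullet> grad f x) * f x) = ?\<phi> K x * pdiv (p K) x + p K x \<bullet> grad (?\<phi> K) x"
        using x by (simp add: grad_\<phi>[OF K] up[OF K] fq[OF K] div0[OF K])
    qed
    also have "\<dots> = (\<Sum>F | F facet_of K. ?T K F)" by (rule green_element[OF K \<phi>[OF K] p[OF K]])
    finally show ?thesis .
  qed
  have face: "(\<Sum>K | K \<in> Th \<and> F facet_of K. ?T K F) =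
      (if F \<in> interior_faces Th then 2 * (LINT x|face_measure (\<nu> F) F. ?J F x) else 0)"
    if F: "F \<in> facets" for F
  proof (cases "F \<in> interior_faces Th")
    case True
    note E = interior_face_elements[OF True]
    define A where "A = elem1 Th (\<nu> F) F"
    define B where "B = elem2 Th (\<nu> F) F"
    note E = E[folded A_def B_def]
    have fn: "facet_normal F = \<nu> F" using True by (simp add: facet_normal_def)
    have int: "integrable (face_measure (\<nu> F) F) (\<lambda>x. ?\<phi> K x * (\<nu> F \<bullet> p K x))" if "K \<in> Th" for K
      by (intro face_integrable[OF F normals[OF True]] continuous_intros cq[OF that] cp[OF that])
    \<comment> \<open>The two elements enter the balance of normal traces with opposite
      signs.\<close>
    have bal: "\<nu> F \<bullet> p A x = \<nu> F \<bullet> p B x" if "x \<in> F" for x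
      using normal_trace_balance[OF p div0 weak F that] E(5-7) unfolding E(8) fn by simp
    have "(\<Sum>K | K \<in> Th \<and> F facet_of K. ?T K F) =
        (LINT x|face_measure (\<nu> F) F. ?\<phi> A x * (\<nu> F \<bullet> p A x)) -
        (LINT x|face_measure (\<nu> F) F. ?\<phi> B x * (\<nu> F \<bullet> p B x))"
      using E(5-7) unfolding E(8) fn by simp
    also have "\<dots> = (LINT x|face_measure (\<nu> F) F. ?\<phi> A x * (\<nu> F \<bullet> p A x) - ?\<phi> B x * (\<nu> F \<bullet> p B x))"
      by (rule Bochner_Integration.integral_diff[symmetric]) (intro int E(1,2))+
    also have "\<dots> = (LINT x|face_measure (\<nu> F) F. 2 * ?J F x)"
    proof (rule interior_face_integral_cong[OF True])
      fix x assume x: "x \<in> F"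
      have "tr1 Th \<nu> F u x = p A x" "tr1 Th \<nu> F f x = q A x" "tr2 Th \<nu> F f x = q B x"
        unfolding A_def B_def
        by (rule tr_eq(1)[OF True x up cp], assumption+)
          (rule tr_eq(1)[OF True x fq cq] tr_eq(2)[OF True x fq cq]; assumption)+
      then have "?J F x = (\<nu> F \<bullet> p A x) * (q A x - q B x) * (q A x + q B x) / 2"
        by (simp add: jump_def avg_def inner_diff_right inner_commute algebra_simps)
      then show "?\<phi> A x * (\<nu> F \<bullet> p A x) - ?\<phi> B x * (\<nu> F \<bullet> p B x) = 2 * ?J F x"
        using bal[OF x] by (simp add: algebra_simps)
    qed
    finally show ?thesis using True by simp
  next
    case False
    have "?T K F = 0" if K: "K \<in> Th" "F facet_of K" for K
    proof -
      \<comment> \<open>With a single summand, the balance says that the normal component itself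
        vanishes.\<close>
      have single: "{K'. K' \<in> Th \<and> F facet_of K'} = {K}"
        using boundary_facet_unique[OF False] K by blast
      have "facet_normal F \<bullet> p K x = 0" if "x \<in> F" for x
        using normal_trace_balance[OF p div0 weak F that] side_sign_cases[of "facet_normal F" K F]
        unfolding single by auto
      then have "(LINT x|face_measure (facet_normal F) F. ?\<phi> K x * (facet_normal F \<bullet> p K x)) =
          (LINT x|face_measure (facet_normal F) F. 0)"
        by (intro face_integral_cong[OF F facet_normal[OF F]]) simp
      then show ?thesis by simp
    qed
    then have "(\<Sum>K | K \<in> Th \<and> F facet_of K. ?T K F) = 0" by (intro sum.neutral) blast
    then show ?thesis using False by simp
  qed
  have "2 * (\<Sum>K\<in>Th. LINT x|lebesgue_on K. (u x \<bullet> grad f x) * f x) = (\<Sum>K\<in>Th. \<Sum>F | F facet_of K. ?T K F)"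
    unfolding sum_distrib_left by (intro sum.cong refl vol)
  also have "\<dots> = (\<Sum>F\<in>facets. \<Sum>K | K \<in> Th \<and> F facet_of K. ?T K F)"
    by (rule sum_facets_swap)
  also have "\<dots> = (\<Sum>F\<in>facets. if F \<in> interior_faces Th then 2 * (LINT x|face_measure (\<nu> F) F. ?J F x) else 0)"
    by (intro sum.cong refl face)
  also have "\<dots> = (\<Sum>F\<in>facets \<inter> interior_faces Th. 2 * (LINT x|face_measure (\<nu> F) F. ?J F x))"
    by (rule sum.inter_restrict[OF finite_facets, symmetric])
  also have "facets \<inter> interior_faces Th = interior_faces Th" using interior_faces_subset by blast
  finally show ?thesis
    unfolding b_form_def by (simp flip: sum_distrib_left)
qed

end


section \<open>Time derivatives and projections\<close>

text \<open>Polynomials are determined by finitely many point values, with polynomial interpolation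
  weights; hence pointwise differentiability in time carries over to coefficients.\<close>

lemma polys_interpolation:
  fixes S :: "(real^'n) set"
  shows "\<exists>(N::nat) y l. (\<forall>i<N. y i \<in> S \<and> l i \<in> polys r) \<and>
    (\<forall>f\<in>polys r. \<forall>x\<in>S. f x = (\<Sum>i<N. f (y i) * l i x))"
proof -
  let ?M = "{k::'n \<Rightarrow> nat. (\<Sum>i\<in>UNIV. k i) \<le> r}"
  let ?f = "\<lambda>A c x. \<Sum>k\<in>A. c k * monomial k x"
  have "\<exists>(N::nat) y l. (\<forall>i<N. y i \<in> S \<and> l i \<in> polys r) \<and>
    (\<forall>c. \<forall>x\<in>S. ?f A c x = (\<Sum>i<N. ?f A c (y i) * l i x))" if "A \<subseteq> ?M" for A
    using finite_subset[OF that finite_degree_le] that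
  proof (induction A rule: finite_induct)
    case empty
    show ?case by (rule exI[of _ 0]) simp
  next
    case (insert k A)
    then have "A \<subseteq> ?M" by blast
    from insert.IH[OF this] obtain N y l where yl0: "\<forall>i<(N::nat). y i \<in> S \<and> l i \<in> polys r"
      and IH0: "\<forall>c. \<forall>x\<in>S. ?f A c x = (\<Sum>i<N. ?f A c (y i) * l i x)"
      by blast
    note yl = yl0[rule_format] and IH = IH0[rule_format]
    \<comment> \<open>The error of interpolating the new monomial at the old nodes.\<close>
    define R where "R x = monomial k x + (-1) * (\<Sum>i<N. monomial k (y i) * l i x)" for x
    have R: "R \<in> polys r"
      unfolding R_def using insert.prems yl
      by (intro polys_add polys_cmult polys_sum polys_monomial) auto
    \<comment> \<open>Interpolation is exact on combinations of the monomials in \<open>A\<close>,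
      so only the coefficient of \<open>k\<close> contributes. If \<open>R\<close> vanishes on
      \<open>S\<close>, the old nodes therefore suffice.\<close>
    have resid: "?f (insert k A) c x - (\<Sum>i<N. ?f (insert k A) c (y i) * l i x) = c k * R x"
      if x: "x \<in> S" for c x
    proof -
      have "(\<Sum>i<N. ?f (insert k A) c (y i) * l i x) =
          c k * (\<Sum>i<N. monomial k (y i) * l i x) + (\<Sum>i<N. ?f A c (y i) * l i x)"
        using insert.hyps by (simp add: distrib_right sum.distrib sum_distrib_left mult.assoc)
      then show ?thesis
        using insert.hyps IH[OF x, of c] by (simp add: R_def algebra_simps)
    qed
    show ?case
    proof (cases "\<exists>x0\<in>S. R x0 \<noteq> 0")
      case False
      then have interp: "?f (insert k A) c x = (\<Sum>i<N. ?f (insert k A) c (y i) * l i x)" if "x \<in> S" for c x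
        using resid[OF that, of c] that by simp
      show ?thesis
        by (rule exI[of _ N], rule exI[of _ y], rule exI[of _ l], intro conjI allI impI ballI)
          (use yl in blast, use yl in blast, rule interp)
    next
      case True
      then obtain x0 where x0: "x0 \<in> S" "R x0 \<noteq> 0" by blast
      define y' where "y' i = (if i = N then x0 else y i)" for i
      \<comment> \<open>The weight of the new node is \<open>R\<close> scaled to 1 at
        \<open>x0\<close>. Each old weight is corrected by the multiple of \<open>R\<close> that
        makes it vanish at \<open>x0\<close>.\<close>
      define l' where "l' i = (if i = N then (\<lambda>x. (1 / R x0) * R x)
          else (\<lambda>x. l i x + (- (l i x0 / R x0)) * R x))" for i
      have mem: "y' i \<in> S \<and> l' i \<in> polys r" if i: "i < Suc N" for i
      proof (cases "i = N")
        case True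
        have "(\<lambda>x. (1 / R x0) * R x) \<in> polys r" by (rule polys_cmult[OF R])
        then show ?thesis using True x0(1) by (simp only: y'_def l'_def if_True simp_thms)
      next
        case False
        then have iN: "i < N" using i by simp
        have "(\<lambda>x. l i x + (- (l i x0 / R x0)) * R x) \<in> polys r"
          using yl[OF iN] by (intro polys_add polys_cmult[OF R]) blast
        then show ?thesis using False yl[OF iN] by (simp only: y'_def l'_def if_False simp_thms)
      qed
      have interp: "?f (insert k A) c x = (\<Sum>i<Suc N. ?f (insert k A) c (y' i) * l' i x)"
        if x: "x \<in> S" for c x
      proof -
        let ?g = "?f (insert k A) c"
        have "(\<Sum>i<N. ?g (y' i) * l' i x) = (\<Sum>i<N. ?g (y i) * l i x - ?g (y i) * l i x0 * (R x / R x0))"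
          by (intro sum.cong refl) (auto simp: y'_def l'_def algebra_simps)
        also have "\<dots> = (\<Sum>i<N. ?g (y i) * l i x) - (\<Sum>i<N. ?g (y i) * l i x0) * (R x / R x0)"
          by (simp only: sum_subtractf sum_distrib_right)
        finally have "(\<Sum>i<Suc N. ?g (y' i) * l' i x) = (\<Sum>i<N. ?g (y i) * l i x) +
            (?g x0 - (\<Sum>i<N. ?g (y i) * l i x0)) * (R x / R x0)"
          by (simp add: y'_def l'_def algebra_simps)
        also have "\<dots> = (\<Sum>i<N. ?g (y i) * l i x) + c k * R x"
          using x0(2) unfolding resid[OF x0(1)] by simp
        also have "\<dots> = ?g x" using resid[OF x, of c] by simp
        finally show ?thesis by simp
      qed
      show ?thesis
        by (rule exI[of _ "Suc N"], rule exI[of _ y'], rule exI[of _ l'], intro conjI allI impI ballI)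
          (use mem in blast, use mem in blast, rule interp)
    qed
  qed
  from this[OF order_refl] obtain N y l where
    yl: "\<forall>i<(N::nat). y i \<in> S \<and> l i \<in> polys r" and
    int0: "\<forall>c. \<forall>x\<in>S. ?f ?M c x = (\<Sum>i<N. ?f ?M c (y i) * l i x)"
    by blast
  note int = int0[rule_format]
  have "f x = (\<Sum>i<N. f (y i) * l i x)" if f: "f \<in> polys r" and x: "x \<in> S" for f x
  proof -
    obtain c where c: "\<And>x. f x = ?f ?M c x" using f unfolding polys_def by blast
    show ?thesis unfolding c using int[OF x] .
  qed
  then show ?thesis using yl by (intro exI[of _ N] exI[of _ y] exI[of _ l] conjI ballI)
qed

text \<open>Differentiable curves in \<open>polys r\<close>, described without a choice of coordinates.\<close>

inductive diff_poly :: "real set \<Rightarrow> real \<Rightarrow> nat \<Rightarrow> (real \<Rightarrow> real^'n \<Rightarrow> real) \<Rightarrow> bool" for I t r where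
  diff_poly_base: "(a has_real_derivative a') (at t within I) \<Longrightarrow> l \<in> polys r \<Longrightarrow>
    diff_poly I t r (\<lambda>\<tau> x. a \<tau> * l x)"
| diff_poly_add: "diff_poly I t r F \<Longrightarrow> diff_poly I t r G \<Longrightarrow> diff_poly I t r (\<lambda>\<tau> x. F \<tau> x + G \<tau> x)"

lemma diff_poly_zero: "diff_poly I t r (\<lambda>\<tau> x. 0)"
  using diff_poly_base[OF DERIV_const polys_zero, where t = t and I = I and r = r] by simp

lemma diff_poly_sum: "(\<And>i. i \<in> A \<Longrightarrow> diff_poly I t r (F i)) \<Longrightarrow> diff_poly I t r (\<lambda>\<tau> x. \<Sum>i\<in>A. F i \<tau> x)"
proof (induction A rule: infinite_finite_induct)
  case (insert i A)
  have "diff_poly I t r (\<lambda>\<tau> x. F i \<tau> x + (\<Sum>i\<in>A. F i \<tau> x))"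
    by (rule diff_poly_add) (use insert in simp_all)
  then show ?case using insert by simp
qed (simp_all add: diff_poly_zero)

lemma diff_poly_mult:
  assumes "diff_poly I t r F" "diff_poly I t r' G"
  shows "diff_poly I t (r + r') (\<lambda>\<tau> x. F \<tau> x * G \<tau> x)"
  using assms(1)
proof induction
  case (diff_poly_base a a' l)
  note a = diff_poly_base
  from assms(2) show ?case
  proof induction
    case (diff_poly_base b b' k)
    have "diff_poly I t (r + r') (\<lambda>\<tau> x. (a \<tau> * b \<tau>) * (l x * k x))"
      by (rule diff_poly.diff_poly_base[OF DERIV_mult[OF a(1) diff_poly_base(1)] polys_mult[OF a(2) diff_poly_base(2)]])
    then show ?case by (simp add: mult_ac)
  next
    case (diff_poly_add G H)
    from diff_poly.diff_poly_add[OF diff_poly_add.IH] show ?case by (simp add: distrib_left)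
  qed
next
  case (diff_poly_add F H)
  from diff_poly.diff_poly_add[OF diff_poly_add.IH] show ?case by (simp add: distrib_right)
qed

lemma diff_poly_polys: "diff_poly I t r F \<Longrightarrow> F \<tau> \<in> polys r"
  by (induction rule: diff_poly.induct) (auto intro: polys_cmult polys_add)

text \<open>For finite sums of products \<open>a \<tau> * l x\<close>, differentiation under the
  integral is mere linearity. One polynomial \<open>F'\<close> serves both for point values and for
  integrals.\<close>

lemma diff_poly_derivative:
  assumes "diff_poly I t r F"
  shows "\<exists>F'\<in>polys r. (\<forall>x. ((\<lambda>\<tau>. F \<tau> x) has_real_derivative F' x) (at t within I)) \<and>
    (\<forall>K. compact K \<longrightarrow>
      ((\<lambda>\<tau>. LINT x|lebesgue_on K. F \<tau> x) has_real_derivative (LINT x|lebesgue_on K. F' x)) (at t within I))"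
  using assms
proof induction
  case (diff_poly_base a a' l)
  have "((\<lambda>\<tau>. a \<tau> * c) has_real_derivative a' * c) (at t within I)" for c
    using DERIV_cmult_right[OF diff_poly_base(1)] .
  then show ?case
    using polys_cmult[OF diff_poly_base(2), of a'] by (intro bexI[of _ "\<lambda>x. a' * l x"]) auto
next
  case (diff_poly_add F G)
  then obtain F' G' where F': "F' \<in> polys r"
      "\<And>x. ((\<lambda>\<tau>. F \<tau> x) has_real_derivative F' x) (at t within I)"
      "\<And>K. compact K \<Longrightarrow>
        ((\<lambda>\<tau>. LINT x|lebesgue_on K. F \<tau> x) has_real_derivative (LINT x|lebesgue_on K. F' x)) (at t within I)"
    and G': "G' \<in> polys r"
      "\<And>x. ((\<lambda>\<tau>. G \<tau> x) has_real_derivative G' x) (at t within I)"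
      "\<And>K. compact K \<Longrightarrow>
        ((\<lambda>\<tau>. LINT x|lebesgue_on K. G \<tau> x) has_real_derivative (LINT x|lebesgue_on K. G' x)) (at t within I)"
    by blast
  have int: "integrable (lebesgue_on K) f" if "compact K" "f \<in> polys r" for K f
    using that by (intro integrable_lebesgue_on_compact polys_continuous)
  have "((\<lambda>\<tau>. LINT x|lebesgue_on K. F \<tau> x + G \<tau> x) has_real_derivative
      (LINT x|lebesgue_on K. F' x + G' x)) (at t within I)" if K: "compact K" for K
    using DERIV_add[OF F'(3)[OF K] G'(3)[OF K]]
      int[OF K diff_poly_polys[OF diff_poly_add.hyps(1)]] int[OF K diff_poly_polys[OF diff_poly_add.hyps(2)]]
      int[OF K F'(1)] int[OF K G'(1)]
    by simp
  then show ?case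
    using polys_add[OF F'(1) G'(1)] DERIV_add[OF F'(2) G'(2)]
    by (intro bexI[of _ "\<lambda>x. F' x + G' x"]) auto
qed

text \<open>The coefficients in the interpolation formula are the point values
  \<open>f \<tau> (y i)\<close> at finitely many points of \<open>S\<close>, and these are
  differentiable by assumption.\<close>

lemma diff_poly_curve:
  fixes f :: "real \<Rightarrow> real^'n \<Rightarrow> real"
  assumes poly: "\<And>\<tau>. \<tau> \<in> I \<Longrightarrow> \<exists>p\<in>polys r. \<forall>x\<in>S. f \<tau> x = p x"
    and diff: "\<And>x. x \<in> S \<Longrightarrow> (\<lambda>\<tau>. f \<tau> x) differentiable (at t within I)"
  obtains F where "diff_poly I t r F" "\<And>\<tau> x. \<tau> \<in> I \<Longrightarrow> x \<in> S \<Longrightarrow> f \<tau> x = F \<tau> x"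
proof -
  obtain N y l where yl: "\<And>i. i < (N::nat) \<Longrightarrow> y i \<in> S \<and> l i \<in> polys r"
    and int: "\<And>p x. p \<in> polys r \<Longrightarrow> x \<in> S \<Longrightarrow> p x = (\<Sum>i<N. p (y i) * l i x)"
    using polys_interpolation[of S r] by blast
  have "diff_poly I t r (\<lambda>\<tau> x. \<Sum>i<N. f \<tau> (y i) * l i x)"
  proof (rule diff_poly_sum)
    fix i assume "i \<in> {..<N}"
    then have i: "y i \<in> S" "l i \<in> polys r" using yl by auto
    obtain D where "((\<lambda>\<tau>. f \<tau> (y i)) has_real_derivative D) (at t within I)"
      using diff[OF i(1)] real_differentiable_def by blast
    then show "diff_poly I t r (\<lambda>\<tau> x. f \<tau> (y i) * l i x)" using i(2) by (rule diff_poly_base)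
  qed
  moreover have "f \<tau> x = (\<Sum>i<N. f \<tau> (y i) * l i x)" if \<tau>: "\<tau> \<in> I" and x: "x \<in> S" for \<tau> x
  proof -
    obtain p where p: "p \<in> polys r" "\<forall>x\<in>S. f \<tau> x = p x" using poly[OF \<tau>] by blast
    have "(\<Sum>i<N. f \<tau> (y i) * l i x) = (\<Sum>i<N. p (y i) * l i x)"
      using p(2) yl by (intro sum.cong refl) auto
    then show ?thesis using int[OF p(1) x] p(2) x by simp
  qed
  ultimately show ?thesis using that by blast
qed

text \<open>Gram-Schmidt: the clause on \<open>h\<close> says that \<open>g\<close> lies in the span of the monomials in \<open>A\<close>,
  up to functions that vanish on \<open>K\<close>.\<close>

lemma L2_projection_element:
  fixes f :: "real^'n \<Rightarrow> real"
  assumes K: "compact K" and K': "K \<subseteq> closure (interior K)" and f: "continuous_on UNIV f"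
  shows "\<exists>g\<in>polys m. \<forall>v\<in>polys m. (LINT x|lebesgue_on K. (f x - g x) * v x) = 0"
proof -
  let ?M = "{k::'n \<Rightarrow> nat. (\<Sum>i\<in>UNIV. k i) \<le> m}"
  let ?ip = "\<lambda>f g. LINT x|lebesgue_on K. f x * (g x :: real)"
  have int: "integrable (lebesgue_on K) (\<lambda>x. f x * (g x :: real))"
    if "continuous_on UNIV f" "continuous_on UNIV g" for f g
    using that by (intro integrable_lebesgue_on_compact[OF K] continuous_intros)
      (blast intro: continuous_on_subset)+
  have ip_diff: "?ip (\<lambda>x. f x - g x) h = ?ip f h - ?ip g h"
    if "continuous_on UNIV f" "continuous_on UNIV g" "continuous_on UNIV h" for f g h
    using int that by (simp add: left_diff_distrib)
  have ip_add: "?ip (\<lambda>x. f x + a * g x) h = ?ip f h + a * ?ip g h"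
    if "continuous_on UNIV f" "continuous_on UNIV g" "continuous_on UNIV h" for f g h a
    using int that by (simp add: distrib_right mult.assoc)
  have ip_commute: "?ip f g = ?ip g f" for f g by (simp add: mult.commute)
  have cpoly: "continuous_on UNIV p" if "p \<in> polys m" for p :: "real^'n \<Rightarrow> real"
    using polys_continuous[OF that] .
  have cmono: "continuous_on UNIV (monomial k)" for k :: "'n \<Rightarrow> nat"
    by (rule polys_continuous[OF polys_monomial[OF order_refl]])
  have "\<exists>g\<in>polys m. (\<forall>k\<in>A. ?ip (\<lambda>x. f x - g x) (monomial k) = 0) \<and>
      (\<forall>h. continuous_on UNIV h \<longrightarrow> (\<forall>k\<in>A. ?ip h (monomial k) = 0) \<longrightarrow> ?ip h g = 0)"
    if "A \<subseteq> ?M" "continuous_on UNIV f" for A f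
    using finite_subset[OF that(1) finite_degree_le] that
  proof (induction A arbitrary: f rule: finite_induct)
    case empty
    show ?case by (rule bexI[of _ "\<lambda>x. 0"]) (simp_all add: polys_zero)
  next
    case (insert k A)
    obtain g where g: "g \<in> polys m" "\<And>j. j \<in> A \<Longrightarrow> ?ip (\<lambda>x. f x - g x) (monomial j) = 0"
      "\<And>h. continuous_on UNIV h \<Longrightarrow> (\<forall>k\<in>A. ?ip h (monomial k) = 0) \<Longrightarrow> ?ip h g = 0"
      using insert.IH[OF _ insert.prems(2)] insert.prems(1) by auto
    obtain b where b: "b \<in> polys m" "\<And>j. j \<in> A \<Longrightarrow> ?ip (\<lambda>x. monomial k x - b x) (monomial j) = 0"
      "\<And>h. continuous_on UNIV h \<Longrightarrow> (\<forall>k\<in>A. ?ip h (monomial k) = 0) \<Longrightarrow> ?ip h b = 0"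
      using insert.IH[OF _ cmono[of k]] insert.prems(1) by auto
    \<comment> \<open>The new direction, orthogonal on \<open>K\<close> to the monomials in
      \<open>A\<close>.\<close>
    define r where "r x = monomial k x - b x" for x
    have r: "r \<in> polys m"
      using polys_add[OF polys_monomial polys_cmult[OF b(1), of "-1"], of k] insert.prems(1)
      by (simp add: r_def[abs_def])
    note cont = insert.prems(2) cpoly[OF g(1)] cpoly[OF b(1)] cpoly[OF r] cmono
    have cfg: "continuous_on UNIV (\<lambda>x. f x - g x)" using cont by (intro continuous_intros)
    have r_orth: "?ip r (monomial j) = 0" if "j \<in> A" for j
      using b(2)[OF that] by (simp add: r_def)
    have k_eq: "?ip h (monomial k) = ?ip h r + ?ip h b" if "continuous_on UNIV h" for h
    proof -
      have "?ip (monomial k) h = ?ip (\<lambda>x. monomial k x - b x) h + ?ip b h"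
        using ip_diff[OF cmono cont(3) that] by simp
      then show ?thesis unfolding r_def using ip_commute by metis
    qed
    \<comment> \<open>If \<open>?ip r r = 0\<close>, then \<open>r\<close> vanishes on
      \<open>K\<close> and contributes nothing, so the coefficient 0 is right in that case.\<close>
    define a where "a = (if ?ip r r = 0 then 0 else ?ip (\<lambda>x. f x - g x) r / ?ip r r)"
    define G where "G x = g x + a * r x" for x
    have G: "G \<in> polys m" unfolding G_def by (intro polys_add polys_cmult g(1) r)
    have diff: "?ip (\<lambda>x. f x - G x) h = ?ip (\<lambda>x. f x - g x) h - a * ?ip r h" if "continuous_on UNIV h" for h
      using ip_add[OF cfg cont(4) that, of "-a"] by (simp add: G_def algebra_simps)
    have fr: "?ip (\<lambda>x. f x - G x) r = 0"
    proof (cases "?ip r r = 0")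
      case True
      have "r x * r x = 0" if "x \<in> K" for x
        using continuous_integral_eq_0[OF K _ _ True, of x] K' that cont(4)
        by (auto intro: continuous_intros)
      then have "?ip (\<lambda>x. f x - g x) r = (LINT x|lebesgue_on K. 0)"
        by (intro Bochner_Integration.integral_cong refl) (auto simp: space_restrict_space)
      then show ?thesis using diff[OF cont(4)] True by simp
    next
      case False
      then show ?thesis using diff[OF cont(4)] by (simp add: a_def)
    qed
    have A_orth: "?ip (\<lambda>x. f x - G x) (monomial j) = 0" if "j \<in> A" for j
      using diff[OF cmono] g(2)[OF that] r_orth[OF that] by simp
    have cfG: "continuous_on UNIV (\<lambda>x. f x - G x)" using cont(1) cpoly[OF G] by (intro continuous_intros)
    have "?ip (\<lambda>x. f x - G x) (monomial k) = 0"
      using k_eq[OF cfG] fr b(3)[OF cfG] A_orth by simp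
    moreover have "?ip h G = 0" if h: "continuous_on UNIV h" "\<forall>j\<in>insert k A. ?ip h (monomial j) = 0" for h
    proof -
      have "?ip h b = 0" "?ip h g = 0" using h b(3) g(3) by auto
      then have "?ip h r = 0" using k_eq[OF h(1)] h(2) by simp
      have "?ip G h = ?ip g h + a * ?ip r h"
        unfolding G_def by (rule ip_add[OF cont(2,4) h(1)])
      then show ?thesis using \<open>?ip h g = 0\<close> \<open>?ip h r = 0\<close> by (simp add: mult.commute)
    qed
    ultimately show ?case using G A_orth by (intro bexI[of _ G]) auto
  qed
  from this[OF order_refl f] obtain g where g: "g \<in> polys m"
    "\<And>k. k \<in> ?M \<Longrightarrow> ?ip (\<lambda>x. f x - g x) (monomial k) = 0" by auto
  have cfg: "continuous_on UNIV (\<lambda>x. f x - g x)" using f cpoly[OF g(1)] by (intro continuous_intros)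
  have "?ip (\<lambda>x. f x - g x) v = 0" if v: "v \<in> polys m" for v
  proof -
    obtain c where c: "\<And>x. v x = (\<Sum>k\<in>?M. c k * monomial k x)" using v unfolding polys_def by blast
    have "?ip (\<lambda>x. f x - g x) v = (LINT x|lebesgue_on K. (\<Sum>k\<in>?M. c k * ((f x - g x) * monomial k x)))"
      unfolding c by (simp add: sum_distrib_left mult_ac)
    also have "\<dots> = (\<Sum>k\<in>?M. c k * ?ip (\<lambda>x. f x - g x) (monomial k))"
      using int[OF cfg cmono] by (subst Bochner_Integration.integral_sum) auto
    finally show ?thesis using g(2) by simp
  qed
  then show ?thesis using g(1) by blast
qed

context mesh begin

lemma L2_inner_cong:
  assumes "\<And>K x. K \<in> Th \<Longrightarrow> x \<in> interior K \<Longrightarrow> f x \<bullet> g x = f' x \<bullet> g' x"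
  shows "L2_inner \<Omega> f g = L2_inner \<Omega> f' g'"
  unfolding L2_inner_def
proof (rule LINT_cong_negligible(2)[OF sets_lebesgue(1) sets_lebesgue(1) negligible_skeleton])
  fix x assume x: "x \<notin> skeleton"
  show "indicator \<Omega> x *\<^sub>R (f x \<bullet> g x) = indicator \<Omega> x *\<^sub>R (f' x \<bullet> g' x)"
  proof (cases "x \<in> \<Omega>")
    case True
    then obtain K where "K \<in> Th" "x \<in> interior K" using Omega_cover x by blast
    then show ?thesis using assms by simp
  qed simp
qed

text \<open>\<open>L2_proj\<close> picks by \<open>SOME\<close>; existence comes from projecting on
  each element and gluing, since functions in \<open>DG\<close> satisfy no continuity condition
  across faces.\<close>

lemma L2_proj_DG:
  assumes f: "\<And>K x. K \<in> Th \<Longrightarrow> x \<in> interior K \<Longrightarrow> f x = q K x"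
    and q: "\<And>K. K \<in> Th \<Longrightarrow> continuous_on UNIV (q K)"
  shows "L2_proj \<Omega> (DG \<Omega> Th m) f \<in> DG \<Omega> Th m"
    "v \<in> DG \<Omega> Th m \<Longrightarrow> L2_inner \<Omega> (\<lambda>x. f x - L2_proj \<Omega> (DG \<Omega> Th m) f x) v = 0"
proof -
  have "\<exists>g. \<forall>K\<in>Th. g K \<in> polys m \<and> (\<forall>v\<in>polys m. (LINT x|lebesgue_on K. (q K x - g K x) * v x) = 0)"
    using L2_projection_element[OF compact_Th _ q] closure_interior by (intro bchoice) blast
  then obtain g where g: "\<And>K. K \<in> Th \<Longrightarrow> g K \<in> polys m"
    "\<And>K v. K \<in> Th \<Longrightarrow> v \<in> polys m \<Longrightarrow> (LINT x|lebesgue_on K. (q K x - g K x) * v x) = 0" by blast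
  obtain G where G: "G \<in> DG \<Omega> Th m" "\<And>K x. K \<in> Th \<Longrightarrow> x \<in> interior K \<Longrightarrow> G x = g K x"
    using DG_glue[of g m] g(1) by blast
  have "L2_inner \<Omega> (\<lambda>x. f x - G x) v = 0" if v: "v \<in> DG \<Omega> Th m" for v
  proof -
    have "\<forall>K\<in>Th. \<exists>p. p \<in> polys m \<and> (\<forall>x\<in>interior K. v x = p x)"
      using v unfolding DG_def piecewise_def by blast
    from bchoice[OF this] obtain w where w: "\<And>K. K \<in> Th \<Longrightarrow> w K \<in> polys m"
      "\<And>K x. K \<in> Th \<Longrightarrow> x \<in> interior K \<Longrightarrow> v x = w K x"
      by blast
    have "L2_inner \<Omega> (\<lambda>x. f x - G x) v = (\<Sum>K\<in>Th. LINT x|lebesgue_on K. (q K x - g K x) * w K x)"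
      unfolding L2_inner_def inner_real_def
      by (rule Omega_integral_pieces(2))
        (auto simp: f G(2) w(2) intro!: continuous_intros q polys_continuous[OF g(1)] polys_continuous[OF w(1)])
    also have "\<dots> = 0" using g(2) w(1) by (intro sum.neutral) auto
    finally show ?thesis .
  qed
  then have "G \<in> DG \<Omega> Th m \<and> (\<forall>v\<in>DG \<Omega> Th m. L2_inner \<Omega> (\<lambda>x. f x - G x) v = 0)"
    using G(1) by blast
  from someI[of "\<lambda>g. g \<in> DG \<Omega> Th m \<and> (\<forall>v\<in>DG \<Omega> Th m. L2_inner \<Omega> (\<lambda>x. f x - g x) v = 0)", OF this]
  show "L2_proj \<Omega> (DG \<Omega> Th m) f \<in> DG \<Omega> Th m"
    "v \<in> DG \<Omega> Th m \<Longrightarrow> L2_inner \<Omega> (\<lambda>x. f x - L2_proj \<Omega> (DG \<Omega> Th m) f x) v = 0"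
    unfolding L2_proj_def by blast+
qed

text \<open>Inside an element, \<open>D\<close> and the derivative of the polynomial curve are both
  derivatives of \<open>F\<close> at \<open>t\<close>, and a nontrivial limit makes them equal. The
  second claim records that \<open>D\<close> is piecewise polynomial, from which later steps obtain
  integrability.\<close>

lemma Omega_integral_derivative:
  assumes t: "t \<in> I" "at t within I \<noteq> bot"
    and G: "\<And>K. K \<in> Th \<Longrightarrow> diff_poly I t (r::nat) (G K)"
    and eq: "\<And>K \<tau> x. K \<in> Th \<Longrightarrow> \<tau> \<in> I \<Longrightarrow> x \<in> interior K \<Longrightarrow> F \<tau> x = G K \<tau> x"
    and D: "\<And>K x. K \<in> Th \<Longrightarrow> x \<in> interior K \<Longrightarrow> ((\<lambda>\<tau>. F \<tau> x) has_real_derivative D x) (at t within I)"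
  shows "((\<lambda>\<tau>. LINT x|lebesgue_on \<Omega>. F \<tau> x) has_real_derivative (LINT x|lebesgue_on \<Omega>. D x)) (at t within I)"
    "\<exists>d. \<forall>K\<in>Th. d K \<in> polys r \<and> (\<forall>x\<in>interior K. D x = d K x)"
proof -
  let ?P = "\<lambda>K d. d \<in> polys r \<and> (\<forall>x. ((\<lambda>\<tau>. G K \<tau> x) has_real_derivative d x) (at t within I)) \<and>
    (\<forall>L. compact L \<longrightarrow>
      ((\<lambda>\<tau>. LINT x|lebesgue_on L. G K \<tau> x) has_real_derivative (LINT x|lebesgue_on L. d x)) (at t within I))"
  have "\<forall>K\<in>Th. \<exists>d. ?P K d"
    using diff_poly_derivative[OF G] unfolding Bex_def by (intro ballI)
  from bchoice[OF this] obtain d where d0: "\<forall>K\<in>Th. ?P K (d K)" by (elim exE)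
  have d: "d K \<in> polys r" "((\<lambda>\<tau>. G K \<tau> x) has_real_derivative d K x) (at t within I)"
    "((\<lambda>\<tau>. LINT x|lebesgue_on K. G K \<tau> x) has_real_derivative (LINT x|lebesgue_on K. d K x)) (at t within I)"
    if "K \<in> Th" for K x
    using bspec[OF d0 that] compact_Th[OF that] by blast+
  have Dd: "D x = d K x" if K: "K \<in> Th" "x \<in> interior K" for K x
  proof -
    have "((\<lambda>\<tau>. F \<tau> x) has_real_derivative d K x) (at t within I)"
      by (rule has_field_derivative_transform_within[OF d(2)[OF K(1)] zero_less_one t(1)])
        (use eq K in auto)
    then show ?thesis
      using D[OF K] by (intro vector_derivative_unique_within[OF t(2), of "\<lambda>\<tau>. F \<tau> x"])
        (simp_all add: has_real_derivative_iff_has_vector_derivative)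
  qed
  have "((\<lambda>\<tau>. \<Sum>K\<in>Th. LINT x|lebesgue_on K. G K \<tau> x) has_real_derivative
      (\<Sum>K\<in>Th. LINT x|lebesgue_on K. d K x)) (at t within I)"
    by (rule DERIV_sum) (rule d(3))
  moreover have "(\<Sum>K\<in>Th. LINT x|lebesgue_on K. d K x) = (LINT x|lebesgue_on \<Omega>. D x)"
    by (rule Omega_integral_pieces(2)[symmetric]) (simp_all add: Dd polys_continuous[OF d(1)])
  ultimately have deriv: "((\<lambda>\<tau>. \<Sum>K\<in>Th. LINT x|lebesgue_on K. G K \<tau> x) has_real_derivative
      (LINT x|lebesgue_on \<Omega>. D x)) (at t within I)" by simp
  have "(\<Sum>K\<in>Th. LINT x|lebesgue_on K. G K \<tau> x) = (LINT x|lebesgue_on \<Omega>. F \<tau> x)" if "\<tau> \<in> I" for \<tau>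
    by (rule Omega_integral_pieces(2)[symmetric])
      (simp_all add: eq that polys_continuous[OF diff_poly_polys[OF G]])
  then show "((\<lambda>\<tau>. LINT x|lebesgue_on \<Omega>. F \<tau> x) has_real_derivative
      (LINT x|lebesgue_on \<Omega>. D x)) (at t within I)"
    by (rule has_field_derivative_transform_within[OF deriv zero_less_one t(1)])
  show "\<exists>d. \<forall>K\<in>Th. d K \<in> polys r \<and> (\<forall>x\<in>interior K. D x = d K x)"
    using d(1) Dd by blast
qed

end


section \<open>Conservation laws\<close>

lemma cross_self: "cross v v = 0"
  by (simp add: cross_def cross_refl)

lemma cross_jump_self: "cross_jump Th \<nu> e u u x = 0"
  by (simp add: cross_jump_def cross_self)

text \<open>The volume term and the face term are both antisymmetric in the last two
  arguments.\<close>

lemma a_form_self: "a_form Th \<nu> w u u = 0"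
  by (simp add: a_form_def cross_jump_self)

text \<open>Derivatives within \<open>I\<close> are unique, also at end points, because a
  nondegenerate interval has no isolated points.\<close>

lemma at_within_interval_nontrivial:
  fixes I :: "real set"
  assumes "is_interval I" "interior I \<noteq> {}" "t \<in> I"
  shows "at t within I \<noteq> bot"
proof -
  have "connected I" using assms(1) is_interval_connected by blast
  moreover have "\<nexists>a. I = {a}" using assms(2) by auto
  ultimately have "t islimpt I" using assms(3) by (intro connected_imp_perfect) auto
  then show ?thesis by (simp add: trivial_limit_within)
qed

context mesh begin

lemma DG_const: "(\<lambda>_. a) \<in> DG \<Omega> Th m"
proof -
  have "integrable (lebesgue_on \<Omega>) (\<lambda>_. (norm a)\<^sup>2)"
    by (rule Omega_integral_pieces(1)[where g = "\<lambda>_ _. (norm a)\<^sup>2"]) auto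
  then show ?thesis
    unfolding DG_def L2_def piecewise_def using polys_const[of a m] by auto
qed

lemma DG_pieces:
  assumes "f \<in> DG \<Omega> Th m"
  obtains q where "\<And>K. K \<in> Th \<Longrightarrow> q K \<in> polys m" "\<And>K x. K \<in> Th \<Longrightarrow> x \<in> interior K \<Longrightarrow> f x = q K x"
proof -
  have "\<forall>K\<in>Th. \<exists>p. p \<in> polys m \<and> (\<forall>x\<in>interior K. f x = p x)"
    using assms unfolding DG_def piecewise_def by blast
  from bchoice[OF this] that show ?thesis by blast
qed

text \<open>Collects what the two velocity spaces have in common: pieces of degree s + 1 whose
  divergence has degree s and thus fits the multipliers in \<open>Qh\<close>.\<close>

lemma velocity_pieces:
  assumes "Uh = RT \<Omega> Th s \<or> Uh = BDM \<Omega> Th (s + 1)" "v \<in> Uh"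
  obtains p where "\<And>K. K \<in> Th \<Longrightarrow> p K \<in> vpolys (Suc s)" "\<And>K. K \<in> Th \<Longrightarrow> pdiv (p K) \<in> polys s"
    "\<And>K x. K \<in> Th \<Longrightarrow> x \<in> interior K \<Longrightarrow> v x = p K x"
proof -
  have "\<exists>p. p \<in> vpolys (Suc s) \<and> pdiv p \<in> polys s \<and> (\<forall>x\<in>interior K. v x = p x)" if K: "K \<in> Th" for K
    using assms(1)
  proof
    assume "Uh = RT \<Omega> Th s"
    then obtain p where "p \<in> RT_polys s" "\<forall>x\<in>interior K. v x = p x"
      using assms(2) K unfolding RT_def piecewise_def by blast
    then show ?thesis using RT_polys_subset pdiv_RT_polys by blast
  next
    assume "Uh = BDM \<Omega> Th (s + 1)"
    then obtain p where p: "p \<in> vpolys (Suc s)" "\<forall>x\<in>interior K. v x = p x"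
      using assms(2) K unfolding BDM_def piecewise_def by auto
    then have "pdiv p \<in> polys s" using pdiv_vpolys[OF p(1)] by simp
    with p show ?thesis by blast
  qed
  then have "\<forall>K\<in>Th. \<exists>p. p \<in> vpolys (Suc s) \<and> pdiv p \<in> polys s \<and> (\<forall>x\<in>interior K. v x = p x)" by blast
  from bchoice[OF this] that show ?thesis by blast
qed

end

theorem proposition2p2:
  fixes \<Omega> :: "('n::{finite,comm_ring_1} pt) set"
    and Th :: "('n pt) set set"
    and \<nu> :: "('n pt) set \<Rightarrow> 'n pt"
    and s m :: nat
    and Uh :: "('n pt \<Rightarrow> 'n pt) set"
    and Fh Qh :: "('n pt \<Rightarrow> real) set"
    and \<alpha> \<beta> :: "('n pt) set \<Rightarrow> ('n pt \<Rightarrow> 'n pt) \<Rightarrow> 'n pt \<Rightarrow> real"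
    and I :: "real set"
    and u :: "real \<Rightarrow> 'n pt \<Rightarrow> 'n pt"
    and \<rho> p :: "real \<Rightarrow> 'n pt \<Rightarrow> real"
  assumes dim: "CARD('n) = 2 \<or> CARD('n) = 3"
    and domain: "open \<Omega>" "connected \<Omega>" "bounded \<Omega>" "\<Omega> \<noteq> {}"
    and mesh: "domain_mesh \<Omega> Th"
    and normals: "\<And>e. e \<in> interior_faces Th \<Longrightarrow> unit_normal e (\<nu> e)"
    and Uh: "Uh = RT \<Omega> Th s \<or> Uh = BDM \<Omega> Th (s + 1)"
    and Fh: "Fh = DG \<Omega> Th m"
    and Qh: "Qh = DG \<Omega> Th s"
    and \<alpha>_nonneg: "\<And>e v x. e \<in> interior_faces Th \<Longrightarrow> v \<in> Uh \<Longrightarrow> x \<in> e \<Longrightarrow> 0 \<le> \<alpha> e v x"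
    and \<beta>_nonneg: "\<And>e v x. e \<in> interior_faces Th \<Longrightarrow> v \<in> Uh \<Longrightarrow> x \<in> e \<Longrightarrow> 0 \<le> \<beta> e v x"
    and time: "is_interval I" "interior I \<noteq> {}"
    and u: "\<And>t. t \<in> I \<Longrightarrow> u t \<in> Uh" "time_differentiable I Th u"
    and \<rho>: "\<And>t. t \<in> I \<Longrightarrow> \<rho> t \<in> Fh" "time_differentiable I Th \<rho>"
    and p: "\<And>t. t \<in> I \<Longrightarrow> p t \<in> Qh"
    \<comment> \<open>the quotient of \<open>\<beta> e (u t)\<close> by the squared normal component of \<open>u t\<close> makes sense,
       with \<open>0 / 0\<close> read as \<open>0\<close>\<close>
    and quotient: "\<And>t e. t \<in> I \<Longrightarrow> e \<in> interior_faces Th \<Longrightarrow>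
          AE x in face_measure (\<nu> e) e. ncomp Th \<nu> e (u t) x = 0 \<longrightarrow> \<beta> e (u t) x = 0"
    and momentum: "\<And>t v. t \<in> I \<Longrightarrow> v \<in> Uh \<Longrightarrow>
          (\<Sum>e\<in>interior_faces Th. LINT x|face_measure (\<nu> e) e.
             \<alpha> e (u t) x * (cross (\<nu> e) (vjump Th \<nu> e (\<lambda>y. \<rho> t y *\<^sub>R u t y) x)
                              \<bullet> cross_jump Th \<nu> e (u t) v x)
             + \<beta> e (u t) x / (2 * \<bar>ncomp Th \<nu> e (u t) x\<bar>\<^sup>2)
                 * ncomp Th \<nu> e (u t) x * ncomp Th \<nu> e v x
                 * (jump Th \<nu> e (L2_proj \<Omega> Fh (\<lambda>y. u t y \<bullet> u t y)) x \<bullet> jump Th \<nu> e (\<rho> t) x))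
          + L2_inner \<Omega> (time_deriv I (\<lambda>\<tau> y. \<rho> \<tau> y *\<^sub>R u \<tau> y) t) v
          + a_form Th \<nu> (\<lambda>y. \<rho> t y *\<^sub>R u t y) (u t) v
          - 1/2 * b_form Th \<nu> v (L2_proj \<Omega> Fh (\<lambda>y. u t y \<bullet> u t y)) (\<rho> t)
          - L2_inner \<Omega> (p t) (divergence \<Omega> v) = 0"
    and continuity: "\<And>t \<sigma>. t \<in> I \<Longrightarrow> \<sigma> \<in> Fh \<Longrightarrow>
          L2_inner \<Omega> (time_deriv I \<rho> t) \<sigma>
          - b_form Th \<nu> (u t) \<sigma> (\<rho> t)
          + (\<Sum>e\<in>interior_faces Th. LINT x|face_measure (\<nu> e) e.
               \<beta> e (u t) x * (jump Th \<nu> e \<sigma> x \<bullet> jump Th \<nu> e (\<rho> t) x)) = 0"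
    and incompressibility: "\<And>t q. t \<in> I \<Longrightarrow> q \<in> Qh \<Longrightarrow> L2_inner \<Omega> (divergence \<Omega> (u t)) q = 0"
  shows "\<forall>t\<in>I.
      ((\<lambda>\<tau>. LINT x|lebesgue_on \<Omega>. \<rho> \<tau> x) has_real_derivative 0) (at t within I) \<and>
      (\<exists>D. ((\<lambda>\<tau>. LINT x|lebesgue_on \<Omega>. (\<rho> \<tau> x)\<^sup>2) has_real_derivative D) (at t within I) \<and>
           D \<le> 0 \<and>
           ((\<forall>e\<in>interior_faces Th. \<forall>x\<in>e. \<beta> e (u t) x = 0) \<longrightarrow> D = 0)) \<and>
      ((\<lambda>\<tau>. LINT x|lebesgue_on \<Omega>. \<rho> \<tau> x * (u \<tau> x \<bullet> u \<tau> x)) has_real_derivative 0)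
        (at t within I)"
proof
  fix t assume t: "t \<in> I"
  interpret mesh \<Omega> Th \<nu>
    using dim mesh normals by unfold_locales auto
  have nontriv: "at t within I \<noteq> bot"
    using time t by (rule at_within_interval_nontrivial)
  have Uh_H0: "v \<in> H0_div \<Omega>" if "v \<in> Uh" for v
    using that Uh by (auto simp: RT_def BDM_def)

  \<comment> \<open>Polynomial pieces of the solution at time \<open>t\<close>\<close>
  obtain pu where pu: "\<And>K. K \<in> Th \<Longrightarrow> pu K \<in> vpolys (Suc s)" "\<And>K. K \<in> Th \<Longrightarrow> pdiv (pu K) \<in> polys s"
    and u_eq: "\<And>K x. K \<in> Th \<Longrightarrow> x \<in> interior K \<Longrightarrow> u t x = pu K x"
    using velocity_pieces[OF Uh u(1)[OF t]] by blast
  have cpu: "continuous_on UNIV (pu K)" if "K \<in> Th" for K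
    using vpolys_continuous[OF pu(1)[OF that]] .
  have \<rho>_DG: "\<rho> \<tau> \<in> DG \<Omega> Th m" if "\<tau> \<in> I" for \<tau> using \<rho>(1)[OF that] Fh by simp
  obtain q\<rho> where q\<rho>: "\<And>K. K \<in> Th \<Longrightarrow> q\<rho> K \<in> polys m"
    and \<rho>_eq: "\<And>K x. K \<in> Th \<Longrightarrow> x \<in> interior K \<Longrightarrow> \<rho> t x = q\<rho> K x"
    using DG_pieces[OF \<rho>_DG[OF t]] by blast
  have cq\<rho>: "continuous_on UNIV (q\<rho> K)" if "K \<in> Th" for K
    using polys_continuous[OF q\<rho>[OF that]] .

  \<comment> \<open>Exact incompressibility\<close>
  have incomp: "L2_inner \<Omega> (divergence \<Omega> (u t)) q = 0" if "q \<in> DG \<Omega> Th s" for q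
    using incompressibility[OF t, of q] that Qh by simp
  have div0: "K \<in> Th \<Longrightarrow> x \<in> K \<Longrightarrow> pdiv (pu K) x = 0" for K x
    by (rule discretely_div_free(1)[OF Uh_H0[OF u(1)[OF t]] pu(1) u_eq pu(2) incomp])
  have weak0: "smooth \<phi> \<Longrightarrow> (\<Sum>K\<in>Th. LINT x|lebesgue_on K. pu K x \<bullet> grad \<phi> x) = 0" for \<phi>
    by (rule discretely_div_free(2)[OF Uh_H0[OF u(1)[OF t]] pu(1) u_eq pu(2) incomp])

  \<comment> \<open>Time derivatives and polynomial curves\<close>
  define d\<rho> where "d\<rho> = time_deriv I \<rho> t"
  define du where "du = time_deriv I u t"
  define dm where "dm = time_deriv I (\<lambda>\<tau> y. \<rho> \<tau> y *\<^sub>R u \<tau> y) t"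
  have D\<rho>: "((\<lambda>\<tau>. \<rho> \<tau> x) has_real_derivative d\<rho> x) (at t within I)"
    and Du: "((\<lambda>\<tau>. u \<tau> x) has_vector_derivative du x) (at t within I)"
    if "K \<in> Th" "x \<in> interior K" for K x
  proof -
    have "(\<lambda>\<tau>. \<rho> \<tau> x) differentiable (at t within I)" "(\<lambda>\<tau>. u \<tau> x) differentiable (at t within I)"
      using \<rho>(2) u(2) t that unfolding time_differentiable_def by blast+
    then show "((\<lambda>\<tau>. \<rho> \<tau> x) has_real_derivative d\<rho> x) (at t within I)"
      "((\<lambda>\<tau>. u \<tau> x) has_vector_derivative du x) (at t within I)"
      unfolding d\<rho>_def du_def time_deriv_def has_real_derivative_iff_has_vector_derivative
      by (simp_all add: vector_derivative_works)
  qed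
  have dm_eq: "dm x = \<rho> t x *\<^sub>R du x + d\<rho> x *\<^sub>R u t x" if "K \<in> Th" "x \<in> interior K" for K x
  proof -
    have "((\<lambda>\<tau>. \<rho> \<tau> x *\<^sub>R u \<tau> x) has_vector_derivative (\<rho> t x *\<^sub>R du x + d\<rho> x *\<^sub>R u t x)) (at t within I)"
      by (rule has_vector_derivative_scaleR[OF D\<rho>[OF that] Du[OF that]])
    then show ?thesis unfolding dm_def time_deriv_def by (rule vector_derivative_within[OF nontriv])
  qed

  have "\<exists>G. diff_poly I t m G \<and> (\<forall>\<tau>\<in>I. \<forall>x\<in>interior K. \<rho> \<tau> x = G \<tau> x)" if K: "K \<in> Th" for K
  proof -
    have "\<exists>p\<in>polys m. \<forall>x\<in>interior K. \<rho> \<tau> x = p x" if "\<tau> \<in> I" for \<tau>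
      using \<rho>_DG[OF that] K unfolding DG_def piecewise_def by blast
    moreover have "(\<lambda>\<tau>. \<rho> \<tau> x) differentiable (at t within I)" if "x \<in> interior K" for x
      using \<rho>(2) t K that unfolding time_differentiable_def by blast
    ultimately show ?thesis
      by (rule diff_poly_curve[where I = I and S = "interior K" and f = \<rho> and r = m and t = t]) blast+
  qed
  then have "\<forall>K\<in>Th. \<exists>G. diff_poly I t m G \<and> (\<forall>\<tau>\<in>I. \<forall>x\<in>interior K. \<rho> \<tau> x = G \<tau> x)" by blast
  from bchoice[OF this] obtain G\<rho> where G\<rho>: "\<And>K. K \<in> Th \<Longrightarrow> diff_poly I t m (G\<rho> K)"
    and G\<rho>_eq: "\<And>K \<tau> x. K \<in> Th \<Longrightarrow> \<tau> \<in> I \<Longrightarrow> x \<in> interior K \<Longrightarrow> \<rho> \<tau> x = G\<rho> K \<tau> x"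
    by blast
  have "\<exists>G. diff_poly I t (Suc s) G \<and> (\<forall>\<tau>\<in>I. \<forall>x\<in>interior K. u \<tau> x $ i = G \<tau> x)" if K: "K \<in> Th" for K i
  proof -
    have "\<exists>p\<in>polys (Suc s). \<forall>x\<in>interior K. u \<tau> x $ i = p x" if \<tau>: "\<tau> \<in> I" for \<tau>
    proof -
      obtain p where "p K \<in> vpolys (Suc s)" "\<And>x. x \<in> interior K \<Longrightarrow> u \<tau> x = p K x"
        using velocity_pieces[OF Uh u(1)[OF \<tau>]] K by metis
      then show ?thesis by (intro bexI[of _ "\<lambda>x. p K x $ i"]) (simp_all add: vpolys_def)
    qed
    moreover have "(\<lambda>\<tau>. u \<tau> x $ i) differentiable (at t within I)" if "x \<in> interior K" for x
      using bounded_linear.has_vector_derivative[OF bounded_linear_vec_nth Du[OF K that]]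
      by (rule differentiableI_vector)
    ultimately show ?thesis
      by (rule diff_poly_curve[where I = I and S = "interior K" and f = "\<lambda>\<tau> x. u \<tau> x $ i" and r = "Suc s" and t = t]) blast+
  qed
  then have "\<forall>K\<in>Th. \<exists>G. \<forall>i. diff_poly I t (Suc s) (G i) \<and> (\<forall>\<tau>\<in>I. \<forall>x\<in>interior K. u \<tau> x $ i = G i \<tau> x)"
    by (intro ballI choice) blast
  from bchoice[OF this] obtain Gu where Gu: "\<And>K i. K \<in> Th \<Longrightarrow> diff_poly I t (Suc s) (Gu K i)"
    and Gu_eq: "\<And>K i \<tau> x. K \<in> Th \<Longrightarrow> \<tau> \<in> I \<Longrightarrow> x \<in> interior K \<Longrightarrow> u \<tau> x $ i = Gu K i \<tau> x"
    by blast

  have mass: "((\<lambda>\<tau>. LINT x|lebesgue_on \<Omega>. \<rho> \<tau> x) has_real_derivative (LINT x|lebesgue_on \<Omega>. d\<rho> x)) (at t within I)"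
    by (rule Omega_integral_derivative(1)[OF t nontriv G\<rho> G\<rho>_eq D\<rho>])
  have mass': "\<exists>d. \<forall>K\<in>Th. d K \<in> polys m \<and> (\<forall>x\<in>interior K. d\<rho> x = d K x)"
    by (rule Omega_integral_derivative(2)[OF t nontriv G\<rho> G\<rho>_eq D\<rho>])
  obtain dd where dd: "\<And>K. K \<in> Th \<Longrightarrow> dd K \<in> polys m"
    and dd_eq: "\<And>K x. K \<in> Th \<Longrightarrow> x \<in> interior K \<Longrightarrow> d\<rho> x = dd K x"
    using mass' by blast
  have cdd: "continuous_on UNIV (dd K)" if "K \<in> Th" for K
    using polys_continuous[OF dd[OF that]] .

  \<comment> \<open>Conservation of mass\<close>
  let ?S = "\<lambda>\<sigma>. \<Sum>e\<in>interior_faces Th. LINT x|face_measure (\<nu> e) e.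
    \<beta> e (u t) x * (jump Th \<nu> e \<sigma> x \<bullet> jump Th \<nu> e (\<rho> t) x)"
  have cont_eq: "L2_inner \<Omega> d\<rho> \<sigma> = b_form Th \<nu> (u t) \<sigma> (\<rho> t) - ?S \<sigma>" if "\<sigma> \<in> DG \<Omega> Th m" for \<sigma>
    using continuity[OF t, of \<sigma>] that Fh unfolding d\<rho>_def by simp

  have "?S (\<lambda>_. 1) = 0"
  proof (rule sum.neutral, rule ballI)
    fix e assume e: "e \<in> interior_faces Th"
    have "(LINT x|face_measure (\<nu> e) e. \<beta> e (u t) x * (jump Th \<nu> e (\<lambda>_. 1) x \<bullet> jump Th \<nu> e (\<rho> t) x)) =
        (LINT x|face_measure (\<nu> e) e. 0)"
      by (rule interior_face_integral_cong[OF e]) (simp add: jump_const[OF e])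
    then show "(LINT x|face_measure (\<nu> e) e. \<beta> e (u t) x * (jump Th \<nu> e (\<lambda>_. 1) x \<bullet> jump Th \<nu> e (\<rho> t) x)) = 0"
      by simp
  qed
  then have "L2_inner \<Omega> d\<rho> (\<lambda>_. 1) = 0"
    using cont_eq[OF DG_const[of 1]] b_form_const[of "u t" 1 "\<rho> t"] by simp
  then have "(LINT x|lebesgue_on \<Omega>. d\<rho> x) = 0" by (simp add: L2_inner_def)
  then have claim1: "((\<lambda>\<tau>. LINT x|lebesgue_on \<Omega>. \<rho> \<tau> x) has_real_derivative 0) (at t within I)"
    using mass by simp

  \<comment> \<open>Dissipation of the squared density\<close>
  have b0: "b_form Th \<nu> (u t) (\<rho> t) (\<rho> t) = 0"
    by (rule b_form_self[OF pu(1) u_eq div0 weak0 q\<rho> \<rho>_eq])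
  have sq: "((\<lambda>\<tau>. LINT x|lebesgue_on \<Omega>. (\<rho> \<tau> x)\<^sup>2) has_real_derivative
      (LINT x|lebesgue_on \<Omega>. 2 * (d\<rho> x * \<rho> t x))) (at t within I)"
  proof (rule Omega_integral_derivative(1)[OF t nontriv diff_poly_mult[OF G\<rho> G\<rho>]])
    fix K x assume K: "K \<in> Th" "x \<in> interior K"
    show "(\<rho> \<tau> x)\<^sup>2 = G\<rho> K \<tau> x * G\<rho> K \<tau> x" if "\<tau> \<in> I" for \<tau>
      using G\<rho>_eq[OF K(1) that K(2)] by (simp add: power2_eq_square)
    show "((\<lambda>\<tau>. (\<rho> \<tau> x)\<^sup>2) has_real_derivative 2 * (d\<rho> x * \<rho> t x)) (at t within I)"
      using DERIV_power[OF D\<rho>[OF K], of 2] by (simp add: mult_ac)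
  qed
  have D_eq: "(LINT x|lebesgue_on \<Omega>. 2 * (d\<rho> x * \<rho> t x)) = - 2 * ?S (\<rho> t)"
    using cont_eq[OF \<rho>_DG[OF t]] b0 by (simp add: L2_inner_def)
  \<comment> \<open>Nonnegativity of the integrand suffices even if \<open>\<beta>\<close> is not
    measurable, because a nonintegrable function has integral 0.\<close>
  have S_nonneg: "0 \<le> ?S (\<rho> t)"
  proof (rule sum_nonneg, rule Bochner_Integration.integral_nonneg_AE)
    fix e assume e: "e \<in> interior_faces Th"
    have "AE x in face_measure (\<nu> e) e. x \<in> e"
      using e interior_faces_subset normals by (intro face_AE_mem) auto
    then show "AE x in face_measure (\<nu> e) e. 0 \<le> \<beta> e (u t) x * (jump Th \<nu> e (\<rho> t) x \<bullet> jump Th \<nu> e (\<rho> t) x)"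
      by eventually_elim (use \<beta>_nonneg[OF e u(1)[OF t]] in simp)
  qed
  have S_zero: "?S (\<rho> t) = 0" if \<beta>0: "\<forall>e\<in>interior_faces Th. \<forall>x\<in>e. \<beta> e (u t) x = 0"
  proof (rule sum.neutral, rule ballI)
    fix e assume e: "e \<in> interior_faces Th"
    have "(LINT x|face_measure (\<nu> e) e. \<beta> e (u t) x * (jump Th \<nu> e (\<rho> t) x \<bullet> jump Th \<nu> e (\<rho> t) x)) =
        (LINT x|face_measure (\<nu> e) e. 0)"
      by (rule interior_face_integral_cong[OF e]) (simp add: \<beta>0 e)
    then show "(LINT x|face_measure (\<nu> e) e. \<beta> e (u t) x * (jump Th \<nu> e (\<rho> t) x \<bullet> jump Th \<nu> e (\<rho> t) x)) = 0"
      by simp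
  qed
  have claim2: "\<exists>D. ((\<lambda>\<tau>. LINT x|lebesgue_on \<Omega>. (\<rho> \<tau> x)\<^sup>2) has_real_derivative D) (at t within I) \<and>
      D \<le> 0 \<and> ((\<forall>e\<in>interior_faces Th. \<forall>x\<in>e. \<beta> e (u t) x = 0) \<longrightarrow> D = 0)"
    using sq S_nonneg S_zero unfolding D_eq by (intro exI[of _ "- 2 * ?S (\<rho> t)"]) auto

  \<comment> \<open>Projection of the squared velocity\<close>
  define w where "w y = u t y \<bullet> u t y" for y
  define W where "W = L2_proj \<Omega> (DG \<Omega> Th m) w"
  have w_eq: "w x = pu K x \<bullet> pu K x" if "K \<in> Th" "x \<in> interior K" for K x
    using u_eq[OF that] by (simp add: w_def)
  have cw: "continuous_on UNIV (\<lambda>x. pu K x \<bullet> pu K x)" if "K \<in> Th" for K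
    by (intro continuous_intros cpu that)
  have W: "W \<in> DG \<Omega> Th m"
    unfolding W_def by (rule L2_proj_DG(1)[OF w_eq cw])
  have W_orth: "v \<in> DG \<Omega> Th m \<Longrightarrow> L2_inner \<Omega> (\<lambda>x. w x - W x) v = 0" for v
    unfolding W_def by (rule L2_proj_DG(2)[OF w_eq cw])
  obtain qW where qW: "\<And>K. K \<in> Th \<Longrightarrow> qW K \<in> polys m"
    and W_eq: "\<And>K x. K \<in> Th \<Longrightarrow> x \<in> interior K \<Longrightarrow> W x = qW K x"
    using DG_pieces[OF W] by blast
  have int_w: "integrable (lebesgue_on \<Omega>) (\<lambda>x. w x * d\<rho> x)"
    by (rule Omega_integral_pieces(1)[where g = "\<lambda>K x. (pu K x \<bullet> pu K x) * dd K x"])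
      (auto simp: w_eq dd_eq intro!: continuous_intros cpu cdd)
  have int_W: "integrable (lebesgue_on \<Omega>) (\<lambda>x. W x * d\<rho> x)"
    by (rule Omega_integral_pieces(1)[where g = "\<lambda>K x. qW K x * dd K x"])
      (auto simp: W_eq dd_eq intro!: continuous_intros polys_continuous[OF qW] cdd)
  \<comment> \<open>Off the skeleton, \<open>d\<rho>\<close> coincides with a function
    \<open>v\<close> in \<open>Fh\<close>, to which the error of the projection is orthogonal; so
    \<open>W\<close> may replace \<open>w\<close>.\<close>
  have proj: "(LINT x|lebesgue_on \<Omega>. w x * d\<rho> x) = L2_inner \<Omega> d\<rho> W"
  proof -
    obtain v where v: "v \<in> DG \<Omega> Th m" "\<And>K x. K \<in> Th \<Longrightarrow> x \<in> interior K \<Longrightarrow> v x = dd K x"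
      using DG_glue[of dd m] dd by blast
    have "L2_inner \<Omega> (\<lambda>x. w x - W x) d\<rho> = L2_inner \<Omega> (\<lambda>x. w x - W x) v"
      by (rule L2_inner_cong) (simp add: v(2) dd_eq)
    also have "\<dots> = 0" by (rule W_orth[OF v(1)])
    finally have "(LINT x|lebesgue_on \<Omega>. w x * d\<rho> x - W x * d\<rho> x) = 0"
      by (simp add: L2_inner_def left_diff_distrib)
    then show ?thesis using int_w int_W by (simp add: L2_inner_def mult.commute)
  qed

  \<comment> \<open>Momentum equation tested with the velocity\<close>
  have faces: "(LINT x|face_measure (\<nu> e) e.
        \<alpha> e (u t) x * (cross (\<nu> e) (vjump Th \<nu> e (\<lambda>y. \<rho> t y *\<^sub>R u t y) x) \<bullet> cross_jump Th \<nu> e (u t) (u t) x)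
         + \<beta> e (u t) x / (2 * \<bar>ncomp Th \<nu> e (u t) x\<bar>\<^sup>2)
             * ncomp Th \<nu> e (u t) x * ncomp Th \<nu> e (u t) x
             * (jump Th \<nu> e W x \<bullet> jump Th \<nu> e (\<rho> t) x)) =
      1/2 * (LINT x|face_measure (\<nu> e) e. \<beta> e (u t) x * (jump Th \<nu> e W x \<bullet> jump Th \<nu> e (\<rho> t) x))"
    (is "(LINT x|_. ?l x) = 1/2 * (LINT x|_. ?r x)") if e: "e \<in> interior_faces Th" for e
  proof -
    \<comment> \<open>Where the normal component is nonzero, its square cancels and leaves half of
      \<open>\<beta>\<close>. Where it is 0, the left side is 0 because division by 0 yields 0, and
      \<open>quotient\<close> makes \<open>\<beta>\<close> vanish on the right.\<close>
    have "AE x in face_measure (\<nu> e) e. ?l x = 1/2 * ?r x"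
      using quotient[OF t e]
    proof eventually_elim
      case (elim x)
      show ?case
      proof (cases "ncomp Th \<nu> e (u t) x = 0")
        case True
        then show ?thesis using elim by (simp add: cross_jump_self)
      next
        case False
        then show ?thesis by (simp add: cross_jump_self power2_eq_square)
      qed
    qed
    then have "(LINT x|face_measure (\<nu> e) e. ?l x) = (LINT x|face_measure (\<nu> e) e. 1/2 * ?r x)"
      unfolding face_measure_def by (rule integral_cong_AE_complete(2)[OF completion.complete_measure_axioms])
    then show ?thesis by (simp only: integral_mult_right_zero)
  qed
  have face_sum: "(\<Sum>e\<in>interior_faces Th. LINT x|face_measure (\<nu> e) e.
        \<alpha> e (u t) x * (cross (\<nu> e) (vjump Th \<nu> e (\<lambda>y. \<rho> t y *\<^sub>R u t y) x) \<bullet> cross_jump Th \<nu> e (u t) (u t) x)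
         + \<beta> e (u t) x / (2 * \<bar>ncomp Th \<nu> e (u t) x\<bar>\<^sup>2)
             * ncomp Th \<nu> e (u t) x * ncomp Th \<nu> e (u t) x
             * (jump Th \<nu> e W x \<bullet> jump Th \<nu> e (\<rho> t) x)) = 1/2 * ?S W"
    unfolding sum_distrib_left by (intro sum.cong refl faces)
  have "1/2 * ?S W + L2_inner \<Omega> dm (u t) - 1/2 * b_form Th \<nu> (u t) W (\<rho> t) = 0"
  proof -
    \<comment> \<open>The pressure is itself an admissible multiplier in the incompressibility
      condition.\<close>
    have "p t \<in> DG \<Omega> Th s" using p[OF t] Qh by simp
    then have p0: "L2_inner \<Omega> (p t) (divergence \<Omega> (u t)) = 0"
      using incomp[of "p t"] by (simp add: L2_inner_def mult.commute)
    show ?thesis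
      using momentum[OF t u(1)[OF t]]
      unfolding Fh w_def[abs_def, symmetric] W_def[symmetric] dm_def[symmetric] a_form_self p0 face_sum
      by simp
  qed
  then have energy: "2 * L2_inner \<Omega> dm (u t) = L2_inner \<Omega> d\<rho> W"
    using cont_eq[OF W] by simp

  \<comment> \<open>Conservation of energy\<close>
  define D where "D x = 2 * (dm x \<bullet> u t x) - w x * d\<rho> x" for x
  have GE: "K \<in> Th \<Longrightarrow> diff_poly I t (m + (Suc s + Suc s))
      (\<lambda>\<tau> x. G\<rho> K \<tau> x * (\<Sum>i\<in>UNIV. Gu K i \<tau> x * Gu K i \<tau> x))" for K
    by (intro diff_poly_mult diff_poly_sum G\<rho> Gu)
  have GE_eq: "K \<in> Th \<Longrightarrow> \<tau> \<in> I \<Longrightarrow> x \<in> interior K \<Longrightarrow>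
      \<rho> \<tau> x * (u \<tau> x \<bullet> u \<tau> x) = G\<rho> K \<tau> x * (\<Sum>i\<in>UNIV. Gu K i \<tau> x * Gu K i \<tau> x)" for K \<tau> x
    by (simp add: inner_vec_def G\<rho>_eq Gu_eq)
  \<comment> \<open>Insert
    \<open>dm x = \<rho> t x *\<^sub>R du x + d\<rho> x *\<^sub>R u t x\<close>: the term 2
    \<open>dm\<close> . u counts |u|^2 \<open>d\<rho>\<close> twice, the product rule only once,
    whence the subtraction in \<open>D\<close>.\<close>
  have DE: "((\<lambda>\<tau>. \<rho> \<tau> x * (u \<tau> x \<bullet> u \<tau> x)) has_real_derivative D x) (at t within I)"
    if K: "K \<in> Th" "x \<in> interior K" for K x
  proof -
    have uu: "((\<lambda>\<tau>. u \<tau> x \<bullet> u \<tau> x) has_real_derivative (u t x \<bullet> du x + du x \<bullet> u t x)) (at t within I)"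
      unfolding has_real_derivative_iff_has_vector_derivative
      by (rule bounded_bilinear.has_vector_derivative[OF bounded_bilinear_inner Du[OF K] Du[OF K]])
    show ?thesis
      using DERIV_mult[OF D\<rho>[OF K] uu]
      by (rule DERIV_cong)
        (simp add: D_def dm_eq[OF K] w_def inner_add_left inner_commute algebra_simps)
  qed
  have D_deriv: "((\<lambda>\<tau>. LINT x|lebesgue_on \<Omega>. \<rho> \<tau> x * (u \<tau> x \<bullet> u \<tau> x)) has_real_derivative
      (LINT x|lebesgue_on \<Omega>. D x)) (at t within I)"
    by (rule Omega_integral_derivative(1)[OF t nontriv GE GE_eq DE])
  \<comment> \<open>Gives integrability of \<open>D\<close>, so that the integral of
    \<open>D x + w x * d\<rho> x\<close> may be split below.\<close>
  have "\<exists>d. \<forall>K\<in>Th. d K \<in> polys (m + (Suc s + Suc s)) \<and> (\<forall>x\<in>interior K. D x = d K x)"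
    by (rule Omega_integral_derivative(2)[OF t nontriv GE GE_eq DE])
  then obtain d where d: "\<And>K. K \<in> Th \<Longrightarrow> d K \<in> polys (m + (Suc s + Suc s))"
    and d_eq: "\<And>K x. K \<in> Th \<Longrightarrow> x \<in> interior K \<Longrightarrow> D x = d K x" by blast
  have int_D: "integrable (lebesgue_on \<Omega>) D"
    by (rule Omega_integral_pieces(1)[where g = d]) (simp_all add: d_eq polys_continuous[OF d])
  have "2 * L2_inner \<Omega> dm (u t) = (LINT x|lebesgue_on \<Omega>. D x + w x * d\<rho> x)"
    by (simp add: L2_inner_def D_def)
  also have "\<dots> = (LINT x|lebesgue_on \<Omega>. D x) + L2_inner \<Omega> d\<rho> W"
    using int_D int_w by (simp add: proj)
  finally have "(LINT x|lebesgue_on \<Omega>. D x) = 0" using energy by simp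
  then have claim3: "((\<lambda>\<tau>. LINT x|lebesgue_on \<Omega>. \<rho> \<tau> x * (u \<tau> x \<bullet> u \<tau> x)) has_real_derivative 0) (at t within I)"
    using D_deriv by simp

  show "((\<lambda>\<tau>. LINT x|lebesgue_on \<Omega>. \<rho> \<tau> x) has_real_derivative 0) (at t within I) \<and>
      (\<exists>D. ((\<lambda>\<tau>. LINT x|lebesgue_on \<Omega>. (\<rho> \<tau> x)\<^sup>2) has_real_derivative D) (at t within I) \<and>
           D \<le> 0 \<and>
           ((\<forall>e\<in>interior_faces Th. \<forall>x\<in>e. \<beta> e (u t) x = 0) \<longrightarrow> D = 0)) \<and>
      ((\<lambda>\<tau>. LINT x|lebesgue_on \<Omega>. \<rho> \<tau> x * (u \<tau> x \<bullet> u \<tau> x)) has_real_derivative 0)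
        (at t within I)"
    using claim1 claim2 claim3 by blast
qed

end
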